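(* Let $p$ be a prime, $n\ge 1$, and let $G$ and $H$ be two extra-special $p$-groups of order $p^{2n+1}$. Then the following hold: (i) If $n=1$, then the equivalence class of $G$ with respect to $\sim_{\mathbb C}$ (among groups of order $p^3$, up to isomorphism) is a singleton; that is, any group $K$ of order $p^3$ with $K\sim_{\mathbb C}G$ is isomorphic to $G$. (ii) If $n>1$, then $G\sim_{\mathbb C}H$.
   Context: A $p$-group $G$ is extra-special if $Z(G)=G'$ has order $p$ and $G/Z(G)$ is elementary abelian. For a finite group $G$, $Z^2(G,\mathbb C^\times)$ is the group of $2$-cocycles with trivial $G$-action on $\mathbb C^\times$, and $H^2(G,\mathbb C^\times)$ is the second cohomology group. For $\alpha\in Z^2(G,\mathbb C^\times)$, the twisted group algebra $\mathbb C^\alpha G$ is the $\mathbb C$-vector space with basis $\{\bar g: g\in G\}$ and multiplication determined by $\bar g\,\bar h=\alpha(g,h)\overline{gh}$; up to isomorphism it depends only on the class $[\alpha]$. For finite groups $G,H$ we write $G\sim_{\mathbb C}H$ if there is a group isomorphism $\psi:H^2(G,\mathbb C^\times)\to H^2(H,\mathbb C^\times)$ such that $\mathbb C^\alpha G\cong\mathbb C^{\psi(\alpha)}H$ (as $\mathbb C$-algebras) for every $[\alpha]\in H^2(G,\mathbb C^\times)$, where $\psi(\alpha)$ denotes a cocycle representing $\psi([\alpha])$. This is an equivalence relation on groups of a given order. *)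

theory Defs
  imports Complex_Main "HOL-Algebra.Algebra"
begin

section \<open>Extra-special groups\<close>

definition group_center :: "('a, 'm) monoid_scheme \<Rightarrow> 'a set" where
  "group_center G =
     {z \<in> carrier G. \<forall>g \<in> carrier G. z \<otimes>\<^bsub>G\<^esub> g = g \<otimes>\<^bsub>G\<^esub> z}"

text \<open>An infinite carrier has \<^const>\<open>Coset.order\<close> \<open>0\<close>, so for prime \<open>p\<close> this forces \<open>G\<close> to be finite.\<close>

definition p_group :: "nat \<Rightarrow> ('a, 'm) monoid_scheme \<Rightarrow> bool" where
  "p_group p G \<longleftrightarrow> group G \<and> (\<exists>k. Coset.order G = p ^ k)"

definition elementary_abelian :: "nat \<Rightarrow> ('a, 'm) monoid_scheme \<Rightarrow> bool" where
  "elementary_abelian p A \<longleftrightarrow>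
     comm_group A \<and> (\<forall>x \<in> carrier A. x [^]\<^bsub>A\<^esub> p = \<one>\<^bsub>A\<^esub>)"

definition extra_special :: "nat \<Rightarrow> ('a, 'm) monoid_scheme \<Rightarrow> bool" where
  "extra_special p G \<longleftrightarrow>
     p_group p G \<and>
     group_center G = derived G (carrier G) \<and>
     card (group_center G) = p \<and>
     elementary_abelian p (G Mod group_center G)"


section \<open>The second cohomology group with trivial action\<close>

text \<open>Cocycles and coboundaries are extensional functions on pairs of group elements, so that
  equality of functions is equality on \<open>carrier G \<times> carrier G\<close>.  They are not assumed to be
  normalized.\<close>

definition cocycles :: "('a, 'm) monoid_scheme \<Rightarrow> ('a \<times> 'a \<Rightarrow> complex) set" where
  "cocycles G =
     {\<alpha> \<in> carrier G \<times> carrier G \<rightarrow>\<^sub>E UNIV - {0}.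
        \<forall>g \<in> carrier G. \<forall>h \<in> carrier G. \<forall>k \<in> carrier G.
          \<alpha> (g, h) * \<alpha> (g \<otimes>\<^bsub>G\<^esub> h, k) = \<alpha> (g, h \<otimes>\<^bsub>G\<^esub> k) * \<alpha> (h, k)}"

definition cocycle_group ::
  "('a, 'm) monoid_scheme \<Rightarrow> ('a \<times> 'a \<Rightarrow> complex) monoid" where
  "cocycle_group G =
     \<lparr>carrier = cocycles G,
      monoid.mult = (\<lambda>\<alpha> \<beta>. \<lambda>x \<in> carrier G \<times> carrier G. \<alpha> x * \<beta> x),
      one = (\<lambda>x \<in> carrier G \<times> carrier G. 1)\<rparr>"

definition coboundary ::
  "('a, 'm) monoid_scheme \<Rightarrow> ('a \<Rightarrow> complex) \<Rightarrow> 'a \<times> 'a \<Rightarrow> complex" where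
  "coboundary G f = (\<lambda>(g, h) \<in> carrier G \<times> carrier G. f g * f h / f (g \<otimes>\<^bsub>G\<^esub> h))"

definition coboundaries :: "('a, 'm) monoid_scheme \<Rightarrow> ('a \<times> 'a \<Rightarrow> complex) set" where
  "coboundaries G = coboundary G ` (carrier G \<rightarrow> UNIV - {0})"

definition second_cohomology ::
  "('a, 'm) monoid_scheme \<Rightarrow> ('a \<times> 'a \<Rightarrow> complex) set monoid" where
  "second_cohomology G = cocycle_group G Mod coboundaries G"


section \<open>Twisted group algebras\<close>

text \<open>For finite \<open>G\<close>, the formal sum of the \<open>u g\<close> times the basis vectors is the function \<open>u\<close>,
  extended by zero outside \<open>carrier G\<close>.  As cocycles need not be normalized, the identity of
  the algebra is \<open>\<alpha>(1,1)\<^sup>-\<^sup>1\<close> times the basis vector of \<open>1\<close>.\<close>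

definition basis_vector :: "'a \<Rightarrow> 'a \<Rightarrow> complex" where
  "basis_vector g = (\<lambda>x. if x = g then 1 else 0)"

definition twisted_group_algebra ::
  "('a, 'm) monoid_scheme \<Rightarrow> ('a \<times> 'a \<Rightarrow> complex) \<Rightarrow> (complex, 'a \<Rightarrow> complex) module" where
  "twisted_group_algebra G \<alpha> =
     \<lparr>carrier = {u. \<forall>x. x \<notin> carrier G \<longrightarrow> u x = 0},
      monoid.mult = (\<lambda>u v x. \<Sum>(g, h) | g \<in> carrier G \<and> h \<in> carrier G \<and> g \<otimes>\<^bsub>G\<^esub> h = x.
                        u g * v h * \<alpha> (g, h)),
      one = (\<lambda>x. inverse (\<alpha> (\<one>\<^bsub>G\<^esub>, \<one>\<^bsub>G\<^esub>)) * basis_vector \<one>\<^bsub>G\<^esub> x),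
      ring.zero = (\<lambda>x. 0),
      add = (\<lambda>u v x. u x + v x),
      module.smult = (\<lambda>c u x. c * u x)\<rparr>"

definition complex_algebra_iso ::
  "(complex, 'a, 'm) module_scheme \<Rightarrow> (complex, 'b, 'n) module_scheme \<Rightarrow> bool" where
  "complex_algebra_iso A B \<longleftrightarrow>
     (\<exists>\<phi> \<in> ring_iso A B.
        \<forall>c. \<forall>x \<in> carrier A. \<phi> (c \<odot>\<^bsub>A\<^esub> x) = c \<odot>\<^bsub>B\<^esub> \<phi> x)"

text \<open>An element of the quotient group is a coset, i.e. the set of cocycles in that class.  As
  the twisted group algebra only depends on the class up to isomorphism, quantifying over all
  representatives is the same as choosing one.\<close>

definition twisted_equiv ::
  "('a, 'm) monoid_scheme \<Rightarrow> ('b, 'n) monoid_scheme \<Rightarrow> bool" where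
  "twisted_equiv G H \<longleftrightarrow>
     (\<exists>\<psi> \<in> iso (second_cohomology G) (second_cohomology H).
        \<forall>C \<in> carrier (second_cohomology G). \<forall>\<alpha> \<in> C. \<forall>\<beta> \<in> \<psi> C.
          complex_algebra_iso (twisted_group_algebra G \<alpha>) (twisted_group_algebra H \<beta>))"


section \<open>Well-definedness\<close>

lemma cocycle_group_comm_group:
  fixes G (structure)
  assumes "group G"
  shows "comm_group (cocycle_group G)"
proof -
  interpret group G by fact
  show ?thesis
  proof (rule comm_groupI, goal_cases)
    case (1 \<alpha> \<beta>)
    then have c: "\<alpha> \<in> cocycles G" "\<beta> \<in> cocycles G" by (auto simp: cocycle_group_def)
    have "\<alpha> (g,h) * \<beta> (g,h) * (\<alpha> (g \<otimes> h,k) * \<beta> (g \<otimes> h,k)) =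
          \<alpha> (g,h \<otimes> k) * \<beta> (g,h \<otimes> k) * (\<alpha> (h,k) * \<beta> (h,k))"
      if "g \<in> carrier G" "h \<in> carrier G" "k \<in> carrier G" for g h k
    proof -
      have "\<alpha> (g, h) * \<alpha> (g \<otimes> h, k) = \<alpha> (g, h \<otimes> k) * \<alpha> (h, k)"
           "\<beta> (g, h) * \<beta> (g \<otimes> h, k) = \<beta> (g, h \<otimes> k) * \<beta> (h, k)"
        using c that by (auto simp: cocycles_def)
      then have "(\<alpha> (g,h) * \<alpha> (g \<otimes> h,k)) * (\<beta> (g,h) * \<beta> (g \<otimes> h,k)) =
          (\<alpha> (g,h \<otimes> k) * \<alpha> (h,k)) * (\<beta> (g,h \<otimes> k) * \<beta> (h,k))" by simp
      then show ?thesis by (simp only: mult_ac)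
    qed
    with c show ?case by (auto simp: cocycle_group_def cocycles_def)
  next
    case 2
    then show ?case by (auto simp: cocycle_group_def cocycles_def)
  next
    case (3 \<alpha> \<beta> \<gamma>)
    then show ?case by (auto simp: cocycle_group_def fun_eq_iff mult_ac)
  next
    case (4 \<alpha> \<beta>)
    then show ?case by (auto simp: cocycle_group_def fun_eq_iff mult_ac restrict_def)
  next
    case (5 \<alpha>)
    then have "\<alpha> \<in> extensional (carrier G \<times> carrier G)"
      by (auto simp: cocycle_group_def cocycles_def PiE_def)
    then show ?case by (auto simp: cocycle_group_def fun_eq_iff extensional_def)
  next
    case (6 \<alpha>)
    then have c: "\<alpha> \<in> cocycles G" by (auto simp: cocycle_group_def)
    let ?b = "\<lambda>x \<in> carrier G \<times> carrier G. inverse (\<alpha> x)"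
    have nz: "\<alpha> (g,h) \<noteq> 0" if "g \<in> carrier G" "h \<in> carrier G" for g h
      using c that by (auto simp: cocycles_def)
    have "inverse (\<alpha> (g,h)) * inverse (\<alpha> (g \<otimes> h,k)) = inverse (\<alpha> (g,h \<otimes> k)) * inverse (\<alpha> (h,k))"
      if "g \<in> carrier G" "h \<in> carrier G" "k \<in> carrier G" for g h k
    proof -
      have "\<alpha> (g, h) * \<alpha> (g \<otimes> h, k) = \<alpha> (g, h \<otimes> k) * \<alpha> (h, k)"
        using c that by (auto simp: cocycles_def)
      then show ?thesis by (metis inverse_mult_distrib)
    qed
    with c nz have "?b \<in> cocycles G" by (auto simp: cocycles_def)
    moreover have "?b \<otimes>\<^bsub>cocycle_group G\<^esub> \<alpha> = \<one>\<^bsub>cocycle_group G\<^esub>"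
      using nz by (auto simp: cocycle_group_def fun_eq_iff)
    ultimately show ?case by (intro bexI[of _ ?b]) (simp_all add: cocycle_group_def)
  qed
qed

lemma coboundaries_normal:
  fixes G (structure)
  assumes "group G"
  shows "coboundaries G \<lhd> cocycle_group G"
proof -
  interpret group G by fact
  interpret Z: comm_group "cocycle_group G" by (rule cocycle_group_comm_group) fact
  have sub: "coboundary G f \<in> cocycles G" if f: "f \<in> carrier G \<rightarrow> UNIV - {0}" for f
  proof -
    have "f x \<noteq> 0" if "x \<in> carrier G" for x using f that by auto
    then show ?thesis
      by (auto simp: cocycles_def coboundary_def field_simps m_assoc)
  qed
  have mult: "coboundary G f \<otimes>\<^bsub>cocycle_group G\<^esub> coboundary G f' = coboundary G (\<lambda>x. f x * f' x)"
    for f f' by (auto simp: cocycle_group_def coboundary_def fun_eq_iff)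
  have one: "coboundary G (\<lambda>_. 1) = \<one>\<^bsub>cocycle_group G\<^esub>"
    by (auto simp: cocycle_group_def coboundary_def fun_eq_iff)
  have "subgroup (coboundaries G) (cocycle_group G)"
  proof (rule Z.subgroupI)
    show "coboundaries G \<subseteq> carrier (cocycle_group G)"
      using sub by (auto simp: coboundaries_def cocycle_group_def)
    show "coboundaries G \<noteq> {}" proof -
      have "coboundary G (\<lambda>_. 1) \<in> coboundaries G"
        unfolding coboundaries_def by (rule imageI) auto
      then show ?thesis by blast
    qed
  next
    fix a assume "a \<in> coboundaries G"
    then obtain f where f: "f \<in> carrier G \<rightarrow> UNIV - {0}" "a = coboundary G f"
      by (auto simp: coboundaries_def)
    let ?f = "\<lambda>x. inverse (f x)"
    have f': "?f \<in> carrier G \<rightarrow> UNIV - {0}" using f by auto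
    have "coboundary G ?f \<otimes>\<^bsub>cocycle_group G\<^esub> a = coboundary G (\<lambda>_. 1)"
      unfolding f(2) mult using f(1) by (auto simp: coboundary_def fun_eq_iff Pi_iff)
    then have "inv\<^bsub>cocycle_group G\<^esub> a = coboundary G ?f"
      using sub[OF f(1)] sub[OF f'] f(2) unfolding one
      by (intro Z.inv_equality) (auto simp: cocycle_group_def)
    with f' show "inv\<^bsub>cocycle_group G\<^esub> a \<in> coboundaries G" by (auto simp: coboundaries_def)
  next
    fix a b assume "a \<in> coboundaries G" "b \<in> coboundaries G"
    then obtain f f' where "f \<in> carrier G \<rightarrow> UNIV - {0}" "a = coboundary G f"
      "f' \<in> carrier G \<rightarrow> UNIV - {0}" "b = coboundary G f'"
      by (auto simp: coboundaries_def)
    then show "a \<otimes>\<^bsub>cocycle_group G\<^esub> b \<in> coboundaries G"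
      by (auto simp: coboundaries_def mult intro!: imageI)
  qed
  then show ?thesis by (rule Z.subgroup_imp_normal)
qed

lemma second_cohomology_comm_group:
  assumes "group G"
  shows "comm_group (second_cohomology G)"
proof -
  interpret Z: comm_group "cocycle_group G" by (rule cocycle_group_comm_group) fact
  show ?thesis unfolding second_cohomology_def
    using coboundaries_normal[OF assms] by (intro Z.abelian_FactGroup) (simp add: normal_imp_subgroup)
qed

lemma basis_vector_mult:
  assumes "group G" "finite (carrier G)" "g \<in> carrier G" "h \<in> carrier G"
  shows "basis_vector g \<otimes>\<^bsub>twisted_group_algebra G \<alpha>\<^esub> basis_vector h =
         \<alpha> (g, h) \<odot>\<^bsub>twisted_group_algebra G \<alpha>\<^esub> basis_vector (g \<otimes>\<^bsub>G\<^esub> h)"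
proof
  fix x
  let ?S = "{(a, b). a \<in> carrier G \<and> b \<in> carrier G \<and> a \<otimes>\<^bsub>G\<^esub> b = x}"
  have fin: "finite ?S"
    by (rule finite_subset[of _ "carrier G \<times> carrier G"]) (use assms in auto)
  have "(basis_vector g \<otimes>\<^bsub>twisted_group_algebra G \<alpha>\<^esub> basis_vector h) x =
        (\<Sum>(a, b) \<in> ?S. basis_vector g a * basis_vector h b * \<alpha> (a, b))"
    by (simp add: twisted_group_algebra_def)
  also have "\<dots> = (\<Sum>(a, b) \<in> ?S \<inter> {(g, h)}. basis_vector g a * basis_vector h b * \<alpha> (a, b))"
    using fin by (intro sum.mono_neutral_right) (auto simp: basis_vector_def split: if_splits)
  also have "\<dots> = (\<alpha> (g, h) \<odot>\<^bsub>twisted_group_algebra G \<alpha>\<^esub> basis_vector (g \<otimes>\<^bsub>G\<^esub> h)) x"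
    using assms by (auto simp: twisted_group_algebra_def basis_vector_def)
  finally show "(basis_vector g \<otimes>\<^bsub>twisted_group_algebra G \<alpha>\<^esub> basis_vector h) x =
     (\<alpha> (g, h) \<odot>\<^bsub>twisted_group_algebra G \<alpha>\<^esub> basis_vector (g \<otimes>\<^bsub>G\<^esub> h)) x" .
qed

lemma twisted_group_algebra_ring:
  fixes G (structure)
  assumes "group G" "finite (carrier G)" "\<alpha> \<in> cocycles G"
  shows "ring (twisted_group_algebra G \<alpha>)"
proof -
  interpret group G by fact
  let ?A = "twisted_group_algebra G \<alpha>"
  let ?S = "\<lambda>x. {(a, b). a \<in> carrier G \<and> b \<in> carrier G \<and> a \<otimes> b = x}"
  have fin: "finite (?S x)" for x
    by (rule finite_subset[of _ "carrier G \<times> carrier G"]) (use assms in auto)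
  have nz: "\<alpha> (g,h) \<noteq> 0" if "g \<in> carrier G" "h \<in> carrier G" for g h
    using assms that by (auto simp: cocycles_def)
  have coc: "\<alpha> (g, h) * \<alpha> (g \<otimes> h, k) = \<alpha> (g, h \<otimes> k) * \<alpha> (h, k)"
    if "g \<in> carrier G" "h \<in> carrier G" "k \<in> carrier G" for g h k
    using assms that by (auto simp: cocycles_def)
  have coc': "\<alpha> (h, k) * \<alpha> (g, h \<otimes> k) = \<alpha> (g, h) * \<alpha> (g \<otimes> h, k)"
    if "g \<in> carrier G" "h \<in> carrier G" "k \<in> carrier G" for g h k
    using coc[OF that] by (simp add: mult.commute)
  have l1: "\<alpha> (\<one>, g) = \<alpha> (\<one>, \<one>)" if "g \<in> carrier G" for g
    using coc[of \<one> \<one> g] nz[of \<one> g] that by simp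
  have r1: "\<alpha> (g, \<one>) = \<alpha> (\<one>, \<one>)" if "g \<in> carrier G" for g
    using coc[of g \<one> \<one>] nz[of g \<one>] that by simp
  have mult: "(u \<otimes>\<^bsub>?A\<^esub> v) x = (\<Sum>(g, h)\<in>?S x. u g * v h * \<alpha> (g, h))" for u v x
    by (simp add: twisted_group_algebra_def)
  have one: "\<one>\<^bsub>?A\<^esub> x = (if x = \<one> then inverse (\<alpha> (\<one>, \<one>)) else 0)" for x
    by (simp add: twisted_group_algebra_def basis_vector_def)
  have carr: "u \<in> carrier ?A \<longleftrightarrow> (\<forall>x. x \<notin> carrier G \<longrightarrow> u x = 0)" for u
    by (simp add: twisted_group_algebra_def)
  have add: "(u \<oplus>\<^bsub>?A\<^esub> v) x = u x + v x" for u v x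
    by (simp add: twisted_group_algebra_def)
  show ?thesis
  proof (rule ringI)
    show "abelian_group ?A"
    proof (rule abelian_groupI)
      fix u assume "u \<in> carrier ?A"
      then show "\<exists>v\<in>carrier ?A. v \<oplus>\<^bsub>?A\<^esub> u = \<zero>\<^bsub>?A\<^esub>"
        by (intro bexI[of _ "\<lambda>x. - u x"]) (auto simp: twisted_group_algebra_def)
    qed (auto simp: twisted_group_algebra_def fun_eq_iff)
    show "Group.monoid ?A"
    proof (rule Group.monoidI)
      fix u v assume "u \<in> carrier ?A" "v \<in> carrier ?A"
      have "(u \<otimes>\<^bsub>?A\<^esub> v) x = 0" if "x \<notin> carrier G" for x
      proof -
        have empty: "?S x = {}" using that by auto
        show ?thesis unfolding mult empty by simp
      qed
      then show "u \<otimes>\<^bsub>?A\<^esub> v \<in> carrier ?A" unfolding carr by blast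
    next
      show "\<one>\<^bsub>?A\<^esub> \<in> carrier ?A" unfolding carr one by auto
    next
      fix u v w
      show "u \<otimes>\<^bsub>?A\<^esub> v \<otimes>\<^bsub>?A\<^esub> w = u \<otimes>\<^bsub>?A\<^esub> (v \<otimes>\<^bsub>?A\<^esub> w)"
      proof
        fix x
        have "(u \<otimes>\<^bsub>?A\<^esub> v \<otimes>\<^bsub>?A\<^esub> w) x =
          (\<Sum>p\<in>?S x. \<Sum>q\<in>?S (fst p). u (fst q) * v (snd q) * \<alpha> q * w (snd p) * \<alpha> p)"
          by (simp add: mult case_prod_unfold sum_distrib_right)
        also have "\<dots> = (\<Sum>(p, q)\<in>Sigma (?S x) (\<lambda>p. ?S (fst p)).
                u (fst q) * v (snd q) * \<alpha> q * w (snd p) * \<alpha> p)"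
          using fin by (intro sum.Sigma) auto
        also have "\<dots> = (\<Sum>(p, q)\<in>Sigma (?S x) (\<lambda>p. ?S (snd p)).
                u (fst p) * v (fst q) * \<alpha> q * w (snd q) * \<alpha> p)"
          by (rule sum.reindex_bij_witness[where
                i = "\<lambda>(p, q). ((fst p \<otimes> fst q, snd q), (fst p, fst q))" and
                j = "\<lambda>(p, q). ((fst q, snd q \<otimes> snd p), (snd q, snd p))"])
             (auto simp: m_assoc coc')
        also have "\<dots> = (\<Sum>p\<in>?S x. \<Sum>q\<in>?S (snd p). u (fst p) * v (fst q) * \<alpha> q * w (snd q) * \<alpha> p)"
          using fin by (intro sum.Sigma[symmetric]) auto
        also have "\<dots> = (u \<otimes>\<^bsub>?A\<^esub> (v \<otimes>\<^bsub>?A\<^esub> w)) x"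
          by (simp add: mult case_prod_unfold sum_distrib_left sum_distrib_right mult_ac)
        finally show "(u \<otimes>\<^bsub>?A\<^esub> v \<otimes>\<^bsub>?A\<^esub> w) x = (u \<otimes>\<^bsub>?A\<^esub> (v \<otimes>\<^bsub>?A\<^esub> w)) x" .
      qed
    next
      fix u assume u: "u \<in> carrier ?A"
      show "\<one>\<^bsub>?A\<^esub> \<otimes>\<^bsub>?A\<^esub> u = u"
      proof
        fix x
        have "(\<one>\<^bsub>?A\<^esub> \<otimes>\<^bsub>?A\<^esub> u) x = (\<Sum>(g, h)\<in>?S x \<inter> {(\<one>, x)}. \<one>\<^bsub>?A\<^esub> g * u h * \<alpha> (g, h))"
          unfolding mult using fin by (intro sum.mono_neutral_right) (auto simp: one split: if_splits)
        also have "\<dots> = u x" using u nz[of \<one> \<one>] l1[of x]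
          by (cases "x \<in> carrier G") (auto simp: one carr Int_insert_right)
        finally show "(\<one>\<^bsub>?A\<^esub> \<otimes>\<^bsub>?A\<^esub> u) x = u x" .
      qed
      show "u \<otimes>\<^bsub>?A\<^esub> \<one>\<^bsub>?A\<^esub> = u"
      proof
        fix x
        have "(u \<otimes>\<^bsub>?A\<^esub> \<one>\<^bsub>?A\<^esub>) x = (\<Sum>(g, h)\<in>?S x \<inter> {(x, \<one>)}. u g * \<one>\<^bsub>?A\<^esub> h * \<alpha> (g, h))"
          unfolding mult using fin by (intro sum.mono_neutral_right) (auto simp: one split: if_splits)
        also have "\<dots> = u x" using u nz[of \<one> \<one>] r1[of x]
          by (cases "x \<in> carrier G") (auto simp: one carr Int_insert_right)
        finally show "(u \<otimes>\<^bsub>?A\<^esub> \<one>\<^bsub>?A\<^esub>) x = u x" .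
      qed
    qed
  next
    fix u v w
    show "(u \<oplus>\<^bsub>?A\<^esub> v) \<otimes>\<^bsub>?A\<^esub> w = u \<otimes>\<^bsub>?A\<^esub> w \<oplus>\<^bsub>?A\<^esub> v \<otimes>\<^bsub>?A\<^esub> w"
      by (auto simp: fun_eq_iff mult add case_prod_unfold sum.distrib algebra_simps)
    show "w \<otimes>\<^bsub>?A\<^esub> (u \<oplus>\<^bsub>?A\<^esub> v) = w \<otimes>\<^bsub>?A\<^esub> u \<oplus>\<^bsub>?A\<^esub> w \<otimes>\<^bsub>?A\<^esub> v"
      by (auto simp: fun_eq_iff mult add case_prod_unfold sum.distrib algebra_simps)
  qed
qed

lemma twisted_group_algebra_smult_assoc:
  "(c \<odot>\<^bsub>twisted_group_algebra G \<alpha>\<^esub> u) \<otimes>\<^bsub>twisted_group_algebra G \<alpha>\<^esub> v =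
     c \<odot>\<^bsub>twisted_group_algebra G \<alpha>\<^esub> (u \<otimes>\<^bsub>twisted_group_algebra G \<alpha>\<^esub> v)"
  "u \<otimes>\<^bsub>twisted_group_algebra G \<alpha>\<^esub> (c \<odot>\<^bsub>twisted_group_algebra G \<alpha>\<^esub> v) =
     c \<odot>\<^bsub>twisted_group_algebra G \<alpha>\<^esub> (u \<otimes>\<^bsub>twisted_group_algebra G \<alpha>\<^esub> v)"
  by (auto simp: twisted_group_algebra_def fun_eq_iff case_prod_unfold sum_distrib_left mult_ac)

lemma twisted_group_algebra_cohomologous:
  fixes G (structure)
  assumes "group G" "f \<in> carrier G \<rightarrow> UNIV - {0}"
  shows "complex_algebra_iso
           (twisted_group_algebra G (coboundary G f \<otimes>\<^bsub>cocycle_group G\<^esub> \<alpha>))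
           (twisted_group_algebra G \<alpha>)"
proof -
  interpret group G by fact
  let ?b = "coboundary G f \<otimes>\<^bsub>cocycle_group G\<^esub> \<alpha>"
  let ?A = "twisted_group_algebra G ?b" and ?B = "twisted_group_algebra G \<alpha>"
  let ?\<phi> = "\<lambda>u x. u x * f x" and ?\<psi> = "\<lambda>u x. u x / f x"
  have nz: "f g \<noteq> 0" if "g \<in> carrier G" for g using assms(2) that by auto
  have b: "?b (g, h) = f g * f h / f (g \<otimes> h) * \<alpha> (g, h)"
    if "g \<in> carrier G" "h \<in> carrier G" for g h
    using that by (simp add: cocycle_group_def coboundary_def)
  have bij: "bij_betw ?\<phi> (carrier ?A) (carrier ?B)"
  proof (rule bij_betw_byWitness[where f' = ?\<psi>])
    have "u x * f x / f x = u x" "u x / f x * f x = u x"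
      if "\<forall>x. x \<notin> carrier G \<longrightarrow> u x = 0" for u x
      using that nz[of x] by (cases "x \<in> carrier G"; simp)+
    then show "\<forall>u\<in>carrier ?A. ?\<psi> (?\<phi> u) = u" "\<forall>u\<in>carrier ?B. ?\<phi> (?\<psi> u) = u"
      unfolding twisted_group_algebra_def fun_eq_iff by simp_all
  qed (auto simp: twisted_group_algebra_def)
  have hom: "?\<phi> \<in> ring_hom ?A ?B"
  proof (rule ring_hom_memI)
    fix u v
    show "?\<phi> (u \<otimes>\<^bsub>?A\<^esub> v) = ?\<phi> u \<otimes>\<^bsub>?B\<^esub> ?\<phi> v"
    proof
      fix x
      show "?\<phi> (u \<otimes>\<^bsub>?A\<^esub> v) x = (?\<phi> u \<otimes>\<^bsub>?B\<^esub> ?\<phi> v) x"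
        by (auto simp: twisted_group_algebra_def sum_distrib_right b nz intro!: sum.cong)
    qed
  next
    show "?\<phi> \<one>\<^bsub>?A\<^esub> = \<one>\<^bsub>?B\<^esub>"
      by (auto simp: twisted_group_algebra_def basis_vector_def fun_eq_iff b nz)
  qed (auto simp: twisted_group_algebra_def algebra_simps)
  from bij hom show ?thesis
    unfolding complex_algebra_iso_def ring_iso_def
    by (intro bexI[of _ ?\<phi>]) (auto simp: twisted_group_algebra_def mult_ac)
qed

end

theory Submission
  imports Defs
begin

text \<open>For \<open>n > 1\<close>, the pairing of the centre with an element \<open>g\<close> induced by a cocycle is a character of
  the centralizer of \<open>g\<close>, which is not abelian; hence the pairing is trivial and every cocycle is
  cohomologous to one inflated from the symplectic space \<open>G/Z\<close>.  A counting version of Witt's theorem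
  gives a subgroup \<open>R\<close> of \<open>G \<times> H\<close> that induces an isometry of the two symplectic spaces, and inflated
  cocycles are transported along it.  A character \<open>\<Lambda>\<close> of \<open>R\<close> that extends the quotient of the central
  characters of \<open>H\<close> and \<open>G\<close> shows that coboundaries correspond to coboundaries, and its powers identify
  the blocks of the twisted group algebras.

  For \<open>n = 1\<close>, the trivial class shows that \<open>K\<close> is nonabelian.  A pigeonhole argument gives
  noncommuting generators with \<open>x\<^sup>p = y\<^sup>p\<close>, where this common power is either trivial or can be taken
  to be the commutator.  Each case determines the group, and the Schur multiplier vanishes exactly in
  the second one.\<close>

section \<open>Characters of subgroups\<close>

text \<open>The bound n > 1 matters because a noncentral element of an extra-special group has a
  centralizer of index p, which is abelian exactly when the order is p^3. In that case the pairing
  with the centre can be nontrivial, and the Schur multiplier separates the groups. For n > 1 the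
  obstacle is that an isometry between G/Z and H/Z need not lift to a homomorphism: the form does
  not see p-th powers. Only a relation \<open>R\<close> survives, in which both components may be
  changed by independent central elements. The two components of a commutator in \<open>R\<close>,
  however, have the same value under the respective central characters, so the quotient of these
  characters is trivial on commutators and extends to a linear character of \<open>R\<close>. On the
  block of the j-th central character its j-th power makes up for the ambiguity of \<open>R\<close>.
  For n = 1 the choice of generators with equal p-th powers treats all primes alike: it avoids the
  formula for the p-th power of a product, which behaves differently for p = 2.\<close>

definition commutator :: "('a, 'm) monoid_scheme \<Rightarrow> 'a \<Rightarrow> 'a \<Rightarrow> 'a" where
  "commutator G a b = a \<otimes>\<^bsub>G\<^esub> b \<otimes>\<^bsub>G\<^esub> inv\<^bsub>G\<^esub> a \<otimes>\<^bsub>G\<^esub> inv\<^bsub>G\<^esub> b"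

text \<open>Values outside \<open>N\<close> are arbitrary, so the same function restricts to every
  smaller subgroup without change.\<close>

definition character_on :: "('a, 'm) monoid_scheme \<Rightarrow> 'a set \<Rightarrow> ('a \<Rightarrow> complex) \<Rightarrow> bool" where
  "character_on G N \<chi> \<longleftrightarrow>
     (\<forall>x\<in>N. \<chi> x \<noteq> 0) \<and> (\<forall>x\<in>N. \<forall>y\<in>N. \<chi> (x \<otimes>\<^bsub>G\<^esub> y) = \<chi> x * \<chi> y)"

lemma character_onI:
  "(\<And>x. x \<in> N \<Longrightarrow> \<chi> x \<noteq> 0) \<Longrightarrow> (\<And>x y. x \<in> N \<Longrightarrow> y \<in> N \<Longrightarrow> \<chi> (x \<otimes>\<^bsub>G\<^esub> y) = \<chi> x * \<chi> y) \<Longrightarrow>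
   character_on G N \<chi>"
  by (auto simp: character_on_def)

lemma character_on_mult:
  "character_on G N \<chi> \<Longrightarrow> x \<in> N \<Longrightarrow> y \<in> N \<Longrightarrow> \<chi> (x \<otimes>\<^bsub>G\<^esub> y) = \<chi> x * \<chi> y"
  by (auto simp: character_on_def)

lemma character_on_nonzero: "character_on G N \<chi> \<Longrightarrow> x \<in> N \<Longrightarrow> \<chi> x \<noteq> 0"
  by (auto simp: character_on_def)

lemma character_on_power: "character_on G N \<chi> \<Longrightarrow> character_on G N (\<lambda>x. \<chi> x ^ k)"
  by (auto simp: character_on_def power_mult_distrib)

lemma character_on_inverse: "character_on G N \<chi> \<Longrightarrow> character_on G N (\<lambda>x. inverse (\<chi> x))"
  by (auto simp: character_on_def)

lemma character_on_times:
  "character_on G N \<chi> \<Longrightarrow> character_on G N \<chi>' \<Longrightarrow> character_on G N (\<lambda>x. \<chi> x * \<chi>' x)"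
  by (auto simp: character_on_def)

context group
begin

lemma character_on_one:
  assumes "subgroup N G" "character_on G N \<chi>"
  shows "\<chi> \<one> = 1"
proof -
  have "\<one> \<in> N" using assms(1) by (rule subgroup.one_closed)
  then have "\<chi> \<one> = \<chi> \<one> * \<chi> \<one>" "\<chi> \<one> \<noteq> 0"
    using character_on_mult[OF assms(2), of \<one> \<one>] character_on_nonzero[OF assms(2)] by auto
  then show ?thesis by simp
qed

lemma character_on_inv:
  assumes "subgroup N G" "character_on G N \<chi>" "x \<in> N"
  shows "\<chi> (inv x) = inverse (\<chi> x)"
proof -
  have "inv x \<in> N" "x \<in> carrier G"
    using assms by (auto intro: subgroup.m_inv_closed subgroup.mem_carrier)
  then have "\<chi> x * \<chi> (inv x) = 1"
    using character_on_mult[OF assms(2), of x "inv x"] character_on_one[OF assms(1,2)] assms(3) by simp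
  then show ?thesis by (simp add: inverse_unique)
qed

lemma subgroup_nat_pow_closed:
  assumes "subgroup N G" "x \<in> N" shows "x [^] (k::nat) \<in> N"
  using assms by (induction k) (auto intro: subgroup.one_closed subgroup.m_closed)

lemma character_on_nat_pow:
  assumes "subgroup N G" "character_on G N \<chi>" "x \<in> N"
  shows "\<chi> (x [^] (k::nat)) = \<chi> x ^ k"
proof (induction k)
  case 0 then show ?case using character_on_one[OF assms(1,2)] by simp
next
  case (Suc k) then show ?case
    using character_on_mult[OF assms(2) subgroup_nat_pow_closed[OF assms(1,3)] assms(3), of k] by simp
qed

text \<open>Orthogonality: translating the sum by an element \<open>y\<close> with \<chi> y
  different from 1 multiplies it by that value.\<close>

lemma sum_character_on:
  assumes "subgroup N G" "finite N" "character_on G N \<chi>"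
  shows "(\<Sum>x\<in>N. \<chi> x) = (if \<forall>x\<in>N. \<chi> x = 1 then of_nat (card N) else 0)"
proof (cases "\<forall>x\<in>N. \<chi> x = 1")
  case False
  then obtain y where y: "y \<in> N" "\<chi> y \<noteq> 1" by blast
  have sub: "x \<in> carrier G" if "x \<in> N" for x using assms(1) that by (rule subgroup.mem_carrier)
  have "(\<Sum>x\<in>N. \<chi> x) = (\<Sum>x\<in>N. \<chi> (y \<otimes> x))"
    by (rule sum.reindex_bij_witness[where i = "\<lambda>x. y \<otimes> x" and j = "\<lambda>x. inv y \<otimes> x"])
       (use y sub assms(1) in \<open>auto simp: m_assoc[symmetric] subgroup.m_closed subgroup.m_inv_closed\<close>)
  also have "\<dots> = \<chi> y * (\<Sum>x\<in>N. \<chi> x)"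
    using y character_on_mult[OF assms(3)] by (simp add: sum_distrib_left)
  finally have "(\<Sum>x\<in>N. \<chi> x) = 0" using y by simp
  then show ?thesis using False by auto
qed simp

text \<open>Finiteness supplies the inverses, as powers with exponent
  \<open>order G - 1\<close>.\<close>

lemma finite_closed_subgroup:
  assumes "finite (carrier G)" "S \<subseteq> carrier G" "\<one> \<in> S" "\<And>x y. x \<in> S \<Longrightarrow> y \<in> S \<Longrightarrow> x \<otimes> y \<in> S"
  shows "subgroup S G"
proof (rule subgroupI)
  fix x assume x: "x \<in> S"
  then have xc: "x \<in> carrier G" using assms by auto
  have pow: "x [^] (k::nat) \<in> S" for k using x assms by (induction k) auto
  have "order G > 0" using assms(1) by (simp add: order_gt_0_iff_finite)
  then have "x [^] (order G - 1) \<otimes> x = x [^] order G" by (cases "order G") auto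
  then have "inv x = x [^] (order G - 1)"
    using pow_order_eq_1[OF xc] xc by (intro inv_equality) auto
  then show "inv x \<in> S" using pow by simp
qed (use assms in auto)

section \<open>Commutators and adjoining an element to a subgroup\<close>

lemma commutator_closed [simp]: "a \<in> carrier G \<Longrightarrow> b \<in> carrier G \<Longrightarrow> commutator G a b \<in> carrier G"
  by (simp add: commutator_def)

lemma commutator_swap:
  "a \<in> carrier G \<Longrightarrow> b \<in> carrier G \<Longrightarrow> a \<otimes> b = commutator G a b \<otimes> (b \<otimes> a)"
  unfolding commutator_def by (simp add: m_assoc inv_solve_left l_inv)
     (metis inv_closed l_one m_assoc m_closed l_inv r_one)

lemma commutator_eq_one_iff:
  assumes "a \<in> carrier G" "b \<in> carrier G"
  shows "commutator G a b = \<one> \<longleftrightarrow> a \<otimes> b = b \<otimes> a"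
  using commutator_swap[OF assms] assms
  by (metis commutator_closed l_one m_closed right_cancel one_closed)

lemma conj_eq_commutator:
  "a \<in> carrier G \<Longrightarrow> b \<in> carrier G \<Longrightarrow> a \<otimes> b \<otimes> inv a = commutator G a b \<otimes> b"
  by (simp add: commutator_def m_assoc)

text \<open>Natural exponents suffice in a finite group; the set is a subgroup as soon as the powers
  of \<open>x\<close> normalize \<open>N\<close>.\<close>

definition adjoin :: "'a set \<Rightarrow> 'a \<Rightarrow> 'a set" where
  "adjoin N x = {n \<otimes> x [^] i | n i. n \<in> N \<and> i \<in> (UNIV :: nat set)}"

lemma adjoinI: "n \<in> N \<Longrightarrow> n \<otimes> x [^] (i::nat) \<in> adjoin N x"
  by (auto simp: adjoin_def)

lemma adjoinE:
  assumes "g \<in> adjoin N x"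
  obtains n i where "n \<in> N" "g = n \<otimes> x [^] (i::nat)"
  using assms by (auto simp: adjoin_def)

lemma subset_adjoin: "N \<subseteq> carrier G \<Longrightarrow> N \<subseteq> adjoin N x"
  using adjoinI[of _ N x 0] by force

lemma mem_adjoin: "subgroup N G \<Longrightarrow> x \<in> carrier G \<Longrightarrow> x \<in> adjoin N x"
  using adjoinI[of \<one> N x 1] subgroup.one_closed[of N G] by simp

lemma adjoin_mult:
  assumes N: "subgroup N G" and x: "x \<in> carrier G" and mem: "n \<in> N" "m \<in> N"
  shows "(n \<otimes> x [^] (i::nat)) \<otimes> (m \<otimes> x [^] (j::nat)) =
         (n \<otimes> (commutator G (x [^] i) m \<otimes> m)) \<otimes> x [^] (i + j)"
proof -
  have [simp]: "n \<in> carrier G" "m \<in> carrier G" using mem N by (auto intro: subgroup.mem_carrier)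
  have "x [^] i \<otimes> m = commutator G (x [^] i) m \<otimes> m \<otimes> x [^] i"
    using x commutator_swap[of "x [^] i" m] by (simp add: m_assoc)
  then have "n \<otimes> (x [^] i \<otimes> m) \<otimes> x [^] j = n \<otimes> (commutator G (x [^] i) m \<otimes> m \<otimes> x [^] i) \<otimes> x [^] j"
    by simp
  then show ?thesis using x by (simp add: m_assoc nat_pow_mult)
qed

text \<open>Powers of \<open>x\<close> normalize \<open>N\<close>; the commutator form of this
  hypothesis is the one that central commutators satisfy at once.\<close>

lemma subgroup_adjoin:
  assumes fin: "finite (carrier G)" and N: "subgroup N G" and x: "x \<in> carrier G"
    and comm: "\<And>n i. n \<in> N \<Longrightarrow> commutator G (x [^] (i::nat)) n \<in> N"
  shows "subgroup (adjoin N x) G"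
proof (rule finite_closed_subgroup[OF fin])
  have sub: "N \<subseteq> carrier G" using N by (rule subgroup.subset)
  then show "adjoin N x \<subseteq> carrier G" using x by (auto simp: adjoin_def)
  show "\<one> \<in> adjoin N x" using subset_adjoin[OF sub] subgroup.one_closed[OF N] by blast
  fix a b assume "a \<in> adjoin N x" "b \<in> adjoin N x"
  then obtain n i m j where *: "n \<in> N" "a = n \<otimes> x [^] (i::nat)" "m \<in> N" "b = m \<otimes> x [^] (j::nat)"
    by (metis adjoinE)
  have "n \<otimes> (commutator G (x [^] i) m \<otimes> m) \<in> N" using * comm N by (meson subgroup.m_closed)
  then show "a \<otimes> b \<in> adjoin N x"
    unfolding *(2,4) adjoin_mult[OF N x *(1,3)] by (rule adjoinI)
qed

text \<open>An extension is determined by its value \<open>c\<close> at \<open>x\<close>. Two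
  obstructions have to vanish: \<chi> must kill the commutators created by reordering, and
  \<open>c\<close> must be compatible with \<chi> on those powers of \<open>x\<close> that lie in
  \<open>N\<close>.\<close>

lemma character_extend_step:
  assumes N: "subgroup N G" and x: "x \<in> carrier G" and \<chi>: "character_on G N \<chi>"
    and comm: "\<And>n i. n \<in> N \<Longrightarrow> commutator G (x [^] (i::nat)) n \<in> N"
    and triv: "\<And>n i. n \<in> N \<Longrightarrow> \<chi> (commutator G (x [^] (i::nat)) n) = 1"
    and c: "c \<noteq> 0" "\<And>k. x [^] (k::nat) \<in> N \<Longrightarrow> \<chi> (x [^] k) = c ^ k"
  obtains \<chi>' where "character_on G (adjoin N x) \<chi>'" "\<And>n i. n \<in> N \<Longrightarrow> \<chi>' (n \<otimes> x [^] (i::nat)) = \<chi> n * c ^ i"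
proof -
  have Nc: "n \<in> carrier G" if "n \<in> N" for n using N that by (rule subgroup.mem_carrier)
  define \<chi>' where "\<chi>' g = (THE v. \<exists>n\<in>N. \<exists>i::nat. g = n \<otimes> x [^] i \<and> v = \<chi> n * c ^ i)" for g
  \<comment> \<open>Well-definedness of the value. Exponents are natural numbers, so the smaller one
    is cancelled; the remaining power of \<open>x\<close> lies in \<open>N\<close>, where the
    compatibility of \<open>c\<close> applies.\<close>
  have le: "\<chi> n * c ^ i = \<chi> m * c ^ j"
    if "n \<in> N" "m \<in> N" "n \<otimes> x [^] i = m \<otimes> x [^] j" "i \<le> j" for n m and i j :: nat
  proof -
    obtain d where j: "j = d + i" using \<open>i \<le> j\<close> by (metis add.commute le_iff_add)
    have "n \<otimes> x [^] i = (m \<otimes> x [^] d) \<otimes> x [^] i"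
      using that x Nc unfolding j by (simp add: m_assoc nat_pow_mult)
    then have n: "n = m \<otimes> x [^] d" using that Nc x by simp
    then have "x [^] d = inv m \<otimes> n" using that Nc x by (simp add: m_assoc[symmetric])
    then have "x [^] d \<in> N" using that N by (simp add: subgroup.m_closed subgroup.m_inv_closed)
    then have "\<chi> n = \<chi> m * c ^ d" using c(2) character_on_mult[OF \<chi> that(2)] n by simp
    then show ?thesis unfolding j by (simp add: power_add)
  qed
  have val: "\<chi>' (n \<otimes> x [^] i) = \<chi> n * c ^ i" if "n \<in> N" for n and i :: nat
    unfolding \<chi>'_def
  proof (rule the_equality)
    show "\<exists>m\<in>N. \<exists>j::nat. n \<otimes> x [^] i = m \<otimes> x [^] j \<and> \<chi> n * c ^ i = \<chi> m * c ^ j" using that by blast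
    fix v assume "\<exists>m\<in>N. \<exists>j::nat. n \<otimes> x [^] i = m \<otimes> x [^] j \<and> v = \<chi> m * c ^ j"
    then obtain m j where "m \<in> N" "n \<otimes> x [^] i = m \<otimes> x [^] (j::nat)" "v = \<chi> m * c ^ j" by blast
    then show "v = \<chi> n * c ^ i" using le[of n m i j] le[of m n j i] that by (metis nat_le_linear)
  qed
  have "character_on G (adjoin N x) \<chi>'"
  proof (rule character_onI)
    fix g assume "g \<in> adjoin N x"
    then show "\<chi>' g \<noteq> 0" using val c(1) character_on_nonzero[OF \<chi>] by (auto elim!: adjoinE)
  next
    fix a b assume "a \<in> adjoin N x" "b \<in> adjoin N x"
    then obtain n i m j where *: "n \<in> N" "a = n \<otimes> x [^] (i::nat)" "m \<in> N" "b = m \<otimes> x [^] (j::nat)"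
      by (metis adjoinE)
    have k: "commutator G (x [^] i) m \<otimes> m \<in> N" using * comm N by (meson subgroup.m_closed)
    have "\<chi> (commutator G (x [^] i) m \<otimes> m) = \<chi> m"
      using character_on_mult[OF \<chi> comm[OF *(3)] *(3)] triv[OF *(3)] by simp
    then show "\<chi>' (a \<otimes> b) = \<chi>' a * \<chi>' b"
      unfolding *(2,4) adjoin_mult[OF N x *(1,3)]
      using * k subgroup.m_closed[OF N *(1) k] character_on_mult[OF \<chi> *(1) k] by (simp add: val power_add)
  qed
  then show ?thesis using val that by blast
qed

text \<open>Divisibility of the multiplicative group of the complex numbers, on which extending
  characters and splitting cocycles rest.\<close>

lemma complex_nth_root_exists:
  assumes "n > 0" obtains c :: complex where "c ^ n = a"
proof
  show "rcis (root n (cmod a)) (Arg a / n) ^ n = a"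
    using assms by (simp add: DeMoivre2 rcis_cmod_Arg)
qed

text \<open>Elements of \<open>S\<close> are adjoined one at a time. The hypothesis on commutators
  says that \<open>S\<close> is abelian modulo the kernel of \<chi>; it persists because each
  extension agrees with the previous character on \<open>N\<close>.\<close>

lemma character_extend:
  assumes fin: "finite (carrier G)" and S: "subgroup S G"
  shows "subgroup N G \<Longrightarrow> N \<subseteq> S \<Longrightarrow> character_on G N \<chi> \<Longrightarrow>
     (\<And>a b. a \<in> S \<Longrightarrow> b \<in> S \<Longrightarrow> commutator G a b \<in> N \<and> \<chi> (commutator G a b) = 1) \<Longrightarrow>
     \<exists>\<chi>'. character_on G S \<chi>' \<and> (\<forall>n\<in>N. \<chi>' n = \<chi> n)"
proof (induction "card S - card N" arbitrary: N \<chi> rule: less_induct)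
  case less
  note N = less.prems(1) and comm = less.prems(4)
  have Sc: "S \<subseteq> carrier G" and Nc: "N \<subseteq> carrier G"
    using S N by (auto intro: subgroup.subset[THEN subsetD])
  have finS: "finite S" using Sc fin finite_subset by blast
  show ?case
  proof (cases "N = S")
    case True then show ?thesis using less by blast
  next
    case False
    then obtain x where x: "x \<in> S" "x \<notin> N" using less by blast
    then have xc: "x \<in> carrier G" using Sc by blast
    have comm': "commutator G (x [^] (i::nat)) n \<in> N \<and> \<chi> (commutator G (x [^] i) n) = 1" if "n \<in> N" for n i
      using comm[of "x [^] i" n] that less.prems(2) subgroup_nat_pow_closed[OF S x(1)] by blast
    \<comment> \<open>The exponents k with \<open>x [^] k\<close> in \<open>N\<close> are the
      multiples of \<open>m\<close>, so any m-th root of \<chi> at \<open>x [^] m\<close> is a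
      compatible value at \<open>x\<close>.\<close>
    define m where "m = (LEAST k::nat. k > 0 \<and> x [^] k \<in> N)"
    have "order G > 0 \<and> x [^] order G \<in> N"
      using fin pow_order_eq_1[OF xc] subgroup.one_closed[OF N] by (simp add: order_gt_0_iff_finite)
    then have m: "m > 0" "x [^] m \<in> N" unfolding m_def by (metis (mono_tags, lifting) LeastI)+
    have mmin: "\<not> (k > 0 \<and> x [^] k \<in> N)" if "k < m" for k
      using not_less_Least[of k] that unfolding m_def by blast
    obtain c where c: "c ^ m = \<chi> (x [^] m)" using complex_nth_root_exists[OF m(1)] by blast
    have c0: "c \<noteq> 0" using character_on_nonzero[OF less.prems(3) m(2)] m(1) unfolding c[symmetric] by (metis power_0_left less_irrefl)
    have ck: "\<chi> (x [^] k) = c ^ k" if "x [^] k \<in> N" for k :: nat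
    proof -
      have k: "k = m * (k div m) + k mod m" by simp
      have e: "x [^] k = (x [^] m) [^] (k div m) \<otimes> x [^] (k mod m)"
        using xc by (simp add: nat_pow_pow nat_pow_mult)
      have mem: "(x [^] m) [^] (k div m) \<in> N" using subgroup_nat_pow_closed[OF N m(2)] .
      have "x [^] (k mod m) = inv ((x [^] m) [^] (k div m)) \<otimes> x [^] k"
        unfolding e using xc by (simp add: m_assoc[symmetric])
      then have "x [^] (k mod m) \<in> N"
        using mem that N by (simp add: subgroup.m_closed subgroup.m_inv_closed)
      then have "k mod m = 0" using mmin[of "k mod m"] m(1) by auto
      then have "\<chi> (x [^] k) = c ^ (m * (k div m))"
        unfolding e using xc m c character_on_nat_pow[OF N less.prems(3) m(2)]
        by (simp add: power_mult)
      then show ?thesis using \<open>k mod m = 0\<close> k by simp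
    qed
    obtain \<chi>' where \<chi>': "character_on G (adjoin N x) \<chi>'"
      "\<And>n i. n \<in> N \<Longrightarrow> \<chi>' (n \<otimes> x [^] (i::nat)) = \<chi> n * c ^ i"
      using character_extend_step[OF N xc less.prems(3) _ _ c0 ck] comm' by metis
    have ext: "\<chi>' n = \<chi> n" if "n \<in> N" for n using \<chi>'(2)[OF that, of 0] that Nc by auto
    have sub: "subgroup (adjoin N x) G" using subgroup_adjoin[OF fin N xc] comm' by blast
    have le: "adjoin N x \<subseteq> S"
    proof
      fix g assume "g \<in> adjoin N x"
      then obtain n i where "n \<in> N" "g = n \<otimes> x [^] (i::nat)" by (rule adjoinE)
      then show "g \<in> S" using less.prems(2) subgroup_nat_pow_closed[OF S x(1)] S
        by (simp add: subgroup.m_closed subsetD)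
    qed
    have "N \<subset> adjoin N x" using subset_adjoin[OF Nc] mem_adjoin[OF N xc] x by blast
    then have "card N < card (adjoin N x)" using finS le by (meson finite_subset psubset_card_mono)
    moreover have "card (adjoin N x) \<le> card S" using finS le by (rule card_mono)
    ultimately have dec: "card S - card (adjoin N x) < card S - card N" by linarith
    have cc: "commutator G a b \<in> adjoin N x \<and> \<chi>' (commutator G a b) = 1" if "a \<in> S" "b \<in> S" for a b
      using comm[OF that] ext subset_adjoin[OF Nc, of x] by auto
    obtain \<chi>'' where "character_on G S \<chi>''" "\<forall>n\<in>adjoin N x. \<chi>'' n = \<chi>' n"
      using less.hyps[OF dec sub le \<chi>'(1) cc] by blast
    then show ?thesis using ext subset_adjoin[OF Nc, of x] by (intro exI[of _ \<chi>'']) auto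
  qed
qed

end

text \<open>Two surjections with the same kernel identify their targets. It serves to compare two
  cohomology groups through a common group of cocycles.\<close>

lemma same_kernel_iso:
  assumes "group M" "group A" "group B" "\<pi> \<in> hom M A" "\<rho> \<in> hom M B"
    and "\<pi> ` carrier M = carrier A" "\<rho> ` carrier M = carrier B"
    and ker: "\<And>m. m \<in> carrier M \<Longrightarrow> \<pi> m = \<one>\<^bsub>A\<^esub> \<longleftrightarrow> \<rho> m = \<one>\<^bsub>B\<^esub>"
  obtains \<psi> where "\<psi> \<in> iso A B" "\<And>m. m \<in> carrier M \<Longrightarrow> \<psi> (\<pi> m) = \<rho> m"
proof -
  interpret M: group M by fact
  interpret A: group_hom M A \<pi> using assms by (auto simp: group_hom_def group_hom_axioms_def)
  interpret B: group_hom M B \<rho> using assms by (auto simp: group_hom_def group_hom_axioms_def)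
  have eq: "\<pi> m = \<pi> m' \<longleftrightarrow> \<rho> m = \<rho> m'" if "m \<in> carrier M" "m' \<in> carrier M" for m m'
  proof -
    have "\<pi> m = \<pi> m' \<longleftrightarrow> \<pi> (m \<otimes>\<^bsub>M\<^esub> inv\<^bsub>M\<^esub> m') = \<one>\<^bsub>A\<^esub>"
      using that by (simp, subst A.H.inv_solve_right') auto
    also have "\<dots> \<longleftrightarrow> \<rho> (m \<otimes>\<^bsub>M\<^esub> inv\<^bsub>M\<^esub> m') = \<one>\<^bsub>B\<^esub>" using ker[of "m \<otimes>\<^bsub>M\<^esub> inv\<^bsub>M\<^esub> m'"] that by simp
    also have "\<dots> \<longleftrightarrow> \<rho> m = \<rho> m'" using that by (simp, subst B.H.inv_solve_right') auto
    finally show ?thesis .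
  qed
  define \<psi> where "\<psi> a = \<rho> (SOME m. m \<in> carrier M \<and> \<pi> m = a)" for a
  have \<psi>: "\<psi> (\<pi> m) = \<rho> m" if "m \<in> carrier M" for m
  proof -
    have "\<exists>m'. m' \<in> carrier M \<and> \<pi> m' = \<pi> m" using that by blast
    then have "(SOME m'. m' \<in> carrier M \<and> \<pi> m' = \<pi> m) \<in> carrier M"
      "\<pi> (SOME m'. m' \<in> carrier M \<and> \<pi> m' = \<pi> m) = \<pi> m" by (metis (mono_tags, lifting) someI_ex)+
    then show ?thesis unfolding \<psi>_def using eq that by blast
  qed
  have "\<psi> \<in> hom A B"
  proof (rule homI)
    fix a b assume "a \<in> carrier A" "b \<in> carrier A"
    then obtain m m' where m: "m \<in> carrier M" "a = \<pi> m" "m' \<in> carrier M" "b = \<pi> m'"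
      using assms(6) by (metis imageE)
    then show "\<psi> a \<in> carrier B" using \<psi> by simp
    have "a \<otimes>\<^bsub>A\<^esub> b = \<pi> (m \<otimes>\<^bsub>M\<^esub> m')" using m by simp
    then show "\<psi> (a \<otimes>\<^bsub>A\<^esub> b) = \<psi> a \<otimes>\<^bsub>B\<^esub> \<psi> b"
      using m \<psi>[of m] \<psi>[of m'] \<psi>[of "m \<otimes>\<^bsub>M\<^esub> m'"] by simp
  qed
  moreover have "bij_betw \<psi> (carrier A) (carrier B)"
  proof (rule bij_betw_imageI)
    show "inj_on \<psi> (carrier A)"
      by (rule inj_onI) (use assms(6) \<psi> eq in \<open>metis (no_types, lifting) imageE\<close>)
    have "\<psi> ` carrier A = (\<lambda>m. \<psi> (\<pi> m)) ` carrier M" unfolding assms(6)[symmetric] by (simp add: image_image)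
    also have "\<dots> = carrier B" unfolding assms(7)[symmetric] using \<psi> by (intro image_cong) auto
    finally show "\<psi> ` carrier A = carrier B" .
  qed
  ultimately show ?thesis using that[of \<psi>] \<psi> by (simp add: iso_def)
qed

section \<open>Groups with central commutators\<close>

lemma complex_power_eq_one_iff_prime:
  fixes c :: complex
  assumes "Factorial_Ring.prime p" "c ^ p = 1" "c \<noteq> 1"
  shows "c ^ i = 1 \<longleftrightarrow> p dvd i"
proof
  assume i: "c ^ i = 1"
  show "p dvd i"
  proof (rule ccontr)
    assume "\<not> p dvd i"
    then have cop: "coprime i p" using assms(1) by (metis prime_imp_coprime coprime_commute)
    have "i \<noteq> 0" using \<open>\<not> p dvd i\<close> by (metis dvd_0_right)
    then obtain a b where "a * i = b * p + 1"
      using bezout_nat[of i p] cop by (metis coprime_imp_gcd_eq_1 mult.commute)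
    then have "(c ^ i) ^ a = (c ^ p) ^ b * c" by (metis power_add power_mult power_one_right mult.commute)
    then show False using i assms by simp
  qed
next
  assume "p dvd i"
  then show "c ^ i = 1" using assms(2) by (auto simp: power_mult)
qed

lemma primitive_root_exists:
  assumes "Factorial_Ring.prime p"
  obtains c :: complex where "c ^ p = 1" "c \<noteq> 1"
proof -
  have p: "p > 1" using assms by (rule prime_gt_1_nat)
  then have "card {z::complex. z ^ p = 1} = p" by (intro card_roots_unity_eq) simp
  then have "card {z::complex. z ^ p = 1} > card {1::complex}" using p by simp
  then have "\<not> {z::complex. z ^ p = 1} \<subseteq> {1}"
    using card_mono[of "{1::complex}" "{z. z ^ p = 1}"] by (metis finite.emptyI finite_insert not_le)
  then show ?thesis using that by blast
qed

lemma (in group) prime_pow_eq_one_iff: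
  assumes "Factorial_Ring.prime p" "x \<in> carrier G" "x [^] p = \<one>" "x \<noteq> \<one>"
  shows "x [^] (i::nat) = \<one> \<longleftrightarrow> p dvd i"
proof -
  have "ord x dvd p" using pow_eq_id[OF assms(2)] assms(3) by blast
  moreover have "ord x \<noteq> 1" using ord_eq_1[OF assms(2)] assms(4) by blast
  ultimately have "ord x = p" using assms(1) unfolding prime_nat_iff by blast
  then show ?thesis using pow_eq_id[OF assms(2)] by simp
qed

lemma (in group) subgroup_center: "subgroup (group_center G) G"
proof (rule subgroupI)
  fix a assume a: "a \<in> group_center G"
  have "inv a \<otimes> g = g \<otimes> inv a" if "g \<in> carrier G" for g
  proof -
    have "a \<otimes> inv g = inv g \<otimes> a" "a \<in> carrier G" using a that by (auto simp: group_center_def)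
    then have "inv (a \<otimes> inv g) = inv (inv g \<otimes> a)" by simp
    then show ?thesis using that \<open>a \<in> carrier G\<close> by (simp add: inv_mult_group)
  qed
  then show "inv a \<in> group_center G" using a by (auto simp: group_center_def)
next
  fix a b assume "a \<in> group_center G" "b \<in> group_center G"
  then have ab: "a \<in> carrier G" "b \<in> carrier G"
    "\<And>g. g \<in> carrier G \<Longrightarrow> a \<otimes> g = g \<otimes> a" "\<And>g. g \<in> carrier G \<Longrightarrow> b \<otimes> g = g \<otimes> b"
    unfolding group_center_def by blast+
  have "a \<otimes> b \<otimes> g = g \<otimes> (a \<otimes> b)" if g: "g \<in> carrier G" for g
    by (metis ab g m_assoc)
  then show "a \<otimes> b \<in> group_center G" using ab(1,2) by (simp add: group_center_def)
next
  have "\<one> \<in> group_center G" by (simp add: group_center_def)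
  then show "group_center G \<noteq> {}" by blast
qed (simp add: group_center_def)

lemma center_carrier: "z \<in> group_center G \<Longrightarrow> z \<in> carrier G"
  by (simp add: group_center_def)

lemma center_commute: "z \<in> group_center G \<Longrightarrow> g \<in> carrier G \<Longrightarrow> z \<otimes>\<^bsub>G\<^esub> g = g \<otimes>\<^bsub>G\<^esub> z"
  by (simp add: group_center_def)

lemma (in group) normal_center: "group_center G \<lhd> G"
proof (rule normal_invI[OF subgroup_center])
  fix x h assume x: "x \<in> carrier G" and h: "h \<in> group_center G"
  have "x \<otimes> h \<otimes> inv x = h"
    using center_carrier[OF h] center_commute[OF h x, symmetric] x by (simp add: m_assoc)
  then show "x \<otimes> h \<otimes> inv x \<in> group_center G" using h by simp
qed

text \<open>Common framework for extra-special groups and for the group \<open>K\<close> of order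
  \<open>p ^ 3\<close>, about which noncommutativity is the first thing known. Conditions on
  elements replace those on the derived subgroup and on the quotient.\<close>

locale central_commutator_group = group G for G (structure) +
  fixes p :: nat
  assumes prime_p: "Factorial_Ring.prime p"
    and finite_carrier: "finite (carrier G)"
    and card_center: "card (group_center G) = p"
    and commutator_in_center: "\<lbrakk>a \<in> carrier G; b \<in> carrier G\<rbrakk> \<Longrightarrow> commutator G a b \<in> group_center G"
    and pow_in_center: "a \<in> carrier G \<Longrightarrow> a [^] p \<in> group_center G"
begin

abbreviation "Z \<equiv> group_center G"

lemma p_gt_1: "p > 1" using prime_p by (rule prime_gt_1_nat)

lemma Z_subgroup: "subgroup Z G" by (rule subgroup_center)

lemma Z_carrier: "z \<in> Z \<Longrightarrow> z \<in> carrier G" by (simp add: group_center_def)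

lemma Z_comm: "z \<in> Z \<Longrightarrow> g \<in> carrier G \<Longrightarrow> z \<otimes> g = g \<otimes> z" by (simp add: group_center_def)

lemma Z_one: "\<one> \<in> Z" using Z_subgroup by (rule subgroup.one_closed)

lemma Z_mult: "z \<in> Z \<Longrightarrow> w \<in> Z \<Longrightarrow> z \<otimes> w \<in> Z" using Z_subgroup by (rule subgroup.m_closed)

lemma Z_inv: "z \<in> Z \<Longrightarrow> inv z \<in> Z" using Z_subgroup by (rule subgroup.m_inv_closed)

lemma finite_subgroup: "subgroup S G \<Longrightarrow> finite S"
  by (rule finite_subset[OF subgroup.subset finite_carrier])

lemma finite_Z: "finite Z" using Z_subgroup by (rule finite_subgroup)


lemma Z_ne_trivial: obtains z where "z \<in> Z" "z \<noteq> \<one>"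
proof -
  have "\<not> Z \<subseteq> {\<one>}" using card_center p_gt_1 card_mono[of "{\<one>}" Z]
    by (metis card_1_singleton_iff finite.emptyI finite_insert not_le One_nat_def)
  then show ?thesis using that by blast
qed

lemma Z_pow_p: assumes "z \<in> Z" shows "z [^] p = \<one>"
proof -
  interpret ZZ: group "G\<lparr>carrier := Z\<rparr>" using Z_subgroup by (rule subgroup.subgroup_is_group) unfold_locales
  have "z [^]\<^bsub>G\<lparr>carrier := Z\<rparr>\<^esub> p = \<one>"
    using ZZ.pow_order_eq_1[of z] assms card_center by (simp add: order_def)
  then show ?thesis by (simp add: nat_pow_consistent[symmetric])
qed

lemma Z_pow_eq_one_iff: "z \<in> Z \<Longrightarrow> z \<noteq> \<one> \<Longrightarrow> z [^] (i::nat) = \<one> \<longleftrightarrow> p dvd i"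
  using prime_pow_eq_one_iff[OF prime_p] Z_pow_p Z_carrier by blast

lemma Z_pow_eq_dvd:
  assumes "z \<in> Z" "z \<noteq> \<one>" "i \<le> j" "z [^] i = z [^] (j::nat)"
  shows "p dvd j - i"
proof -
  have zc: "z \<in> carrier G" using assms Z_carrier by blast
  have "z [^] i \<otimes> z [^] (j - i) = z [^] (i + (j - i))" using zc by (rule nat_pow_mult)
  then have "z [^] i \<otimes> z [^] (j - i) = z [^] i \<otimes> \<one>" using assms zc by simp
  then have "z [^] (j - i) = \<one>" using zc by simp
  then show ?thesis using Z_pow_eq_one_iff assms(1,2) by blast
qed

lemma Z_eq_powers:
  assumes "z \<in> Z" "z \<noteq> \<one>"
  shows "Z = (\<lambda>i::nat. z [^] i) ` {..<p}"
proof -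
  have zc: "z \<in> carrier G" using assms Z_carrier by blast
  have le: "i = j" if "i \<le> j" "j < p" "z [^] i = z [^] j" for i j :: nat
  proof -
    have "p dvd j - i" using Z_pow_eq_dvd[OF assms that(1,3)] .
    then show ?thesis using that by (metis dvd_imp_le le_antisym diff_is_0_eq less_imp_diff_less not_le not_gr_zero)
  qed
  have "inj_on (\<lambda>i::nat. z [^] i) {..<p}"
  proof (rule inj_onI)
    fix i j assume "i \<in> {..<p}" "j \<in> {..<p}" "z [^] i = z [^] j"
    then show "i = j" using le[of i j] le[of j i] by (metis lessThan_iff nat_le_linear)
  qed
  then have "card ((\<lambda>i::nat. z [^] i) ` {..<p}) = p" by (simp add: card_image)
  moreover have "(\<lambda>i::nat. z [^] i) ` {..<p} \<subseteq> Z"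
    using subgroup_nat_pow_closed[OF Z_subgroup assms(1)] by blast
  ultimately show ?thesis using card_subset_eq[OF finite_Z] card_center by metis
qed

lemma faithful_character_exists:
  "\<exists>\<chi>. character_on G Z \<chi> \<and> (\<forall>z\<in>Z. \<chi> z = 1 \<longrightarrow> z = \<one>)"
proof -
  obtain z where z: "z \<in> Z" "z \<noteq> \<one>" by (rule Z_ne_trivial)
  then have zc: "z \<in> carrier G" using Z_carrier by blast
  obtain c :: complex where c: "c ^ p = 1" "c \<noteq> 1" using primitive_root_exists[OF prime_p] .
  have c0: "c \<noteq> 0" using c(1) p_gt_1 by (metis power_0_left zero_neq_one less_irrefl not_one_less_zero)
  have pw: "z [^] (i::nat) \<in> carrier G" for i using zc by simp
  \<comment> \<open>The trivial character of the trivial subgroup is extended to the powers of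
    \<open>z\<close>; the root \<open>c\<close> is compatible because \<open>c\<close> and
    \<open>z\<close> both have order p.\<close>
  obtain \<chi> where \<chi>: "character_on G (adjoin {\<one>} z) \<chi>"
    "\<And>n i. n \<in> {\<one>} \<Longrightarrow> \<chi> (n \<otimes> z [^] (i::nat)) = 1 * c ^ i"
  proof (rule character_extend_step[OF triv_subgroup zc, of "\<lambda>_. 1" c])
    show "character_on G {\<one>} (\<lambda>_. 1)" by (rule character_onI) auto
    show "commutator G (z [^] (i::nat)) n \<in> {\<one>}" if "n \<in> {\<one>}" for n i
      using that pw by (simp add: commutator_eq_one_iff)
    show "1 = c ^ k" if "z [^] k \<in> {\<one>}" for k :: nat
    proof -
      have "p dvd k" using that Z_pow_eq_one_iff[OF z] by simp
      then show ?thesis using complex_power_eq_one_iff_prime[OF prime_p c] by simp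
    qed
  qed (use c0 in auto)
  have "adjoin {\<one>} z = Z"
  proof
    show "adjoin {\<one>} z \<subseteq> Z" using subgroup_nat_pow_closed[OF Z_subgroup z(1)] pw by (auto elim!: adjoinE)
    show "Z \<subseteq> adjoin {\<one>} z"
    proof
      fix w assume "w \<in> Z"
      then obtain i where "w = z [^] (i::nat)" using Z_eq_powers[OF z] by auto
      then have "w = \<one> \<otimes> z [^] i" using pw by simp
      then show "w \<in> adjoin {\<one>} z" using adjoinI[of \<one> "{\<one>}" z i] by simp
    qed
  qed
  moreover have "w = \<one>" if "w \<in> Z" "\<chi> w = 1" for w
  proof -
    have "w \<in> (\<lambda>i::nat. z [^] i) ` {..<p}" using that(1) Z_eq_powers[OF z] by metis
    then obtain i where i: "w = z [^] (i::nat)" by blast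
    have "c ^ i = 1" using \<chi>(2)[of \<one> i] that(2) l_one[OF pw[of i]] unfolding i by simp
    then have "p dvd i" using complex_power_eq_one_iff_prime[OF prime_p c] by simp
    then show ?thesis unfolding i using Z_pow_eq_one_iff[OF z] by simp
  qed
  ultimately show ?thesis using \<chi>(1) by auto
qed

text \<open>Identifies the centre with the p-th roots of unity, so that commutators become complex
  numbers and every character of the centre is a power of this one.\<close>

definition zchar :: "'a \<Rightarrow> complex" where
  "zchar = (SOME \<chi>. character_on G Z \<chi> \<and> (\<forall>z\<in>Z. \<chi> z = 1 \<longrightarrow> z = \<one>))"

lemma zchar_character: "character_on G Z zchar"
  and zchar_faithful: "z \<in> Z \<Longrightarrow> zchar z = 1 \<Longrightarrow> z = \<one>"
  using someI_ex[OF faithful_character_exists] unfolding zchar_def by blast+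

lemma zchar_eq_1_iff: "z \<in> Z \<Longrightarrow> zchar z = 1 \<longleftrightarrow> z = \<one>"
  using zchar_faithful character_on_one[OF Z_subgroup zchar_character] by auto

lemma zchar_pow_p: "z \<in> Z \<Longrightarrow> zchar z ^ p = 1"
  using character_on_nat_pow[OF Z_subgroup zchar_character, of z p] Z_pow_p
    character_on_one[OF Z_subgroup zchar_character] by simp

lemma inj_on_zchar_power:
  assumes w: "w \<in> Z" "w \<noteq> \<one>"
  shows "inj_on (\<lambda>j. zchar w ^ j) {..<p}"
proof (rule linorder_inj_onI)
  fix i j :: nat assume ij: "i < j" "i \<in> {..<p}" "j \<in> {..<p}"
  show "zchar w ^ i \<noteq> zchar w ^ j"
  proof
    assume "zchar w ^ i = zchar w ^ j"
    also have "\<dots> = zchar w ^ i * zchar w ^ (j - i)" using ij(1) by (simp flip: power_add)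
    finally have "zchar w ^ (j - i) = 1" using character_on_nonzero[OF zchar_character w(1)] by simp
    then have "p dvd j - i"
      using complex_power_eq_one_iff_prime[OF prime_p zchar_pow_p[OF w(1)]] zchar_faithful[OF w(1)] w(2) by blast
    then show False using ij by (auto dest!: dvd_imp_le)
  qed
qed auto

text \<open>For a generator \<open>w\<close> the powers \<open>zchar w ^ j\<close> with j < p are p
  distinct p-th roots of unity, hence all of them, and \<chi> w is one.\<close>

lemma character_on_Z_eq_power:
  assumes "character_on G Z \<chi>"
  obtains j where "\<And>z. z \<in> Z \<Longrightarrow> \<chi> z = zchar z ^ j"
proof -
  obtain w where w: "w \<in> Z" "w \<noteq> \<one>" by (rule Z_ne_trivial)
  note inj = inj_on_zchar_power[OF w]
  have "(\<lambda>j. zchar w ^ j) ` {..<p} = {c. c ^ p = 1}"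
  proof (rule card_subset_eq)
    show "finite {c::complex. c ^ p = 1}" using p_gt_1 by (intro finite_roots_unity) simp
    have "(zchar w ^ j) ^ p = 1" for j
      using zchar_pow_p[OF w(1)] by (metis power_mult mult.commute power_one)
    then show "(\<lambda>j. zchar w ^ j) ` {..<p} \<subseteq> {c. c ^ p = 1}" by blast
    show "card ((\<lambda>j. zchar w ^ j) ` {..<p}) = card {c::complex. c ^ p = 1}"
      using card_image[OF inj] card_roots_unity_eq[of p] p_gt_1 by simp
  qed
  moreover have "\<chi> w ^ p = 1"
    using character_on_nat_pow[OF Z_subgroup assms w(1), of p] Z_pow_p[OF w(1)]
      character_on_one[OF Z_subgroup assms] by simp
  ultimately obtain j where j: "\<chi> w = zchar w ^ j" by (metis (mono_tags, lifting) imageE mem_Collect_eq)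
  have "\<chi> z = zchar z ^ j" if z: "z \<in> Z" for z
  proof -
    have "z \<in> (\<lambda>i::nat. w [^] i) ` {..<p}" using z Z_eq_powers[OF w] by metis
    then obtain i where i: "z = w [^] (i::nat)" by blast
    have "\<chi> z = (zchar w ^ j) ^ i" "zchar z = zchar w ^ i"
      using character_on_nat_pow[OF Z_subgroup assms w(1)] j
        character_on_nat_pow[OF Z_subgroup zchar_character w(1)] unfolding i by simp_all
    then show ?thesis by (metis power_mult mult.commute)
  qed
  then show ?thesis using that by blast
qed

lemma sum_zchar_power:
  assumes "i < p" "j < p"
  shows "(\<Sum>z\<in>Z. zchar z ^ i * inverse (zchar z ^ j)) = (if i = j then of_nat p else 0)"
proof -
  have ch: "character_on G Z (\<lambda>z. zchar z ^ i * inverse (zchar z ^ j))"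
    using zchar_character by (intro character_on_times character_on_inverse character_on_power)
  have "i = j" if all: "\<forall>z\<in>Z. zchar z ^ i * inverse (zchar z ^ j) = 1"
  proof -
    obtain w where w: "w \<in> Z" "w \<noteq> \<one>" by (rule Z_ne_trivial)
    have w0: "zchar w \<noteq> 0" using character_on_nonzero[OF zchar_character w(1)] .
    have "zchar w ^ i * inverse (zchar w ^ j) = 1" using all w(1) by blast
    then have "zchar w ^ i = zchar w ^ j" using w0 by (simp add: field_simps)
    then show ?thesis using inj_on_zchar_power[OF w] assms by (simp add: inj_on_def)
  qed
  moreover have "\<forall>z\<in>Z. zchar z ^ i * inverse (zchar z ^ j) = 1" if "i = j"
    using character_on_nonzero[OF zchar_character] that by auto
  ultimately show ?thesis using sum_character_on[OF Z_subgroup finite_Z ch] card_center by auto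
qed

text \<open>Parseval's identity on the centre: \<open>A\<close> and \<open>B\<close> are coordinates
  with respect to the p central characters. It turns sums over the centre into products block by
  block, both for the multiplicativity of \<open>kern\<close> and for its inverse.\<close>

lemma sum_zchar_orthogonal:
  fixes A B :: "nat \<Rightarrow> complex"
  shows "(\<Sum>w\<in>Z. (\<Sum>j<p. A j * inverse (zchar w ^ j)) / of_nat p * ((\<Sum>i<p. B i * zchar w ^ i) / of_nat p)) =
    (\<Sum>j<p. A j * B j) / of_nat p"
proof -
  have p0: "of_nat p \<noteq> (0::complex)" using p_gt_1 by simp
  have "(\<Sum>w\<in>Z. (\<Sum>j<p. A j * inverse (zchar w ^ j)) / of_nat p * ((\<Sum>i<p. B i * zchar w ^ i) / of_nat p)) =
    (\<Sum>w\<in>Z. (\<Sum>j<p. \<Sum>i<p. A j * B i * (zchar w ^ i * inverse (zchar w ^ j))) / (of_nat p * of_nat p))"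
    unfolding times_divide_times_eq sum_product by (simp only: mult_ac)
  also have "\<dots> = (\<Sum>w\<in>Z. \<Sum>j<p. \<Sum>i<p. A j * B i * (zchar w ^ i * inverse (zchar w ^ j))) / (of_nat p * of_nat p)"
    by (rule sum_divide_distrib[symmetric])
  also have "(\<Sum>w\<in>Z. \<Sum>j<p. \<Sum>i<p. A j * B i * (zchar w ^ i * inverse (zchar w ^ j))) =
    (\<Sum>j<p. \<Sum>w\<in>Z. \<Sum>i<p. A j * B i * (zchar w ^ i * inverse (zchar w ^ j)))"
    by (rule sum.swap)
  also have "\<dots> = (\<Sum>j<p. \<Sum>i<p. \<Sum>w\<in>Z. A j * B i * (zchar w ^ i * inverse (zchar w ^ j)))"
    by (intro sum.cong refl sum.swap)
  also have "\<dots> = (\<Sum>j<p. \<Sum>i<p. if i = j then A j * B i * of_nat p else 0)"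
    by (intro sum.cong refl) (auto simp: sum_zchar_power simp flip: sum_distrib_left)
  also have "\<dots> = (\<Sum>j<p. A j * B j) * of_nat p"
    by (simp add: sum_distrib_right)
  finally show ?thesis using p0 by simp
qed

section \<open>The commutator form\<close>

lemma commutator_mult_left:
  assumes "a \<in> carrier G" "b \<in> carrier G" "c \<in> carrier G"
  shows "commutator G (a \<otimes> b) c = commutator G a c \<otimes> commutator G b c"
proof -
  have "a \<otimes> b \<otimes> c = a \<otimes> (commutator G b c \<otimes> (c \<otimes> b))"
    using commutator_swap[of b c] assms by (simp add: m_assoc)
  also have "\<dots> = (commutator G b c \<otimes> a) \<otimes> (c \<otimes> b)"
    using assms Z_comm[OF commutator_in_center, of b c a] by (simp add: m_assoc)
  also have "\<dots> = commutator G b c \<otimes> (a \<otimes> c) \<otimes> b" using assms by (simp add: m_assoc)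
  also have "\<dots> = commutator G b c \<otimes> (commutator G a c \<otimes> (c \<otimes> a)) \<otimes> b"
    using commutator_swap[of a c] assms by simp
  also have "\<dots> = (commutator G b c \<otimes> commutator G a c) \<otimes> (c \<otimes> (a \<otimes> b))"
    using assms by (simp add: m_assoc)
  also have "\<dots> = (commutator G a c \<otimes> commutator G b c) \<otimes> (c \<otimes> (a \<otimes> b))"
    using assms Z_comm[OF commutator_in_center, of b c "commutator G a c"] by simp
  finally have "commutator G (a \<otimes> b) c \<otimes> (c \<otimes> (a \<otimes> b)) = (commutator G a c \<otimes> commutator G b c) \<otimes> (c \<otimes> (a \<otimes> b))"
    using commutator_swap[of "a \<otimes> b" c] assms by simp
  then show ?thesis using assms by simp
qed

lemma commutator_inverse:
  "a \<in> carrier G \<Longrightarrow> b \<in> carrier G \<Longrightarrow> commutator G b a = inv (commutator G a b)"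
  by (simp add: commutator_def inv_mult_group m_assoc)

text \<open>The symplectic form on G/Z, written multiplicatively with values in the p-th roots of
  unity: it is bimultiplicative and alternating, and its radical is the centre.\<close>

definition om :: "'a \<Rightarrow> 'a \<Rightarrow> complex" where "om a b = zchar (commutator G a b)"

lemma om_mult_left:
  "a \<in> carrier G \<Longrightarrow> b \<in> carrier G \<Longrightarrow> c \<in> carrier G \<Longrightarrow> om (a \<otimes> b) c = om a c * om b c"
  using character_on_mult[OF zchar_character commutator_in_center commutator_in_center, of a c b c]
  by (simp add: om_def commutator_mult_left)

lemma om_swap: "a \<in> carrier G \<Longrightarrow> b \<in> carrier G \<Longrightarrow> om b a = inverse (om a b)"
  unfolding om_def
  using character_on_inv[OF Z_subgroup zchar_character commutator_in_center, of a b] commutator_inverse[of a b]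
  by simp

lemma om_mult_right:
  "a \<in> carrier G \<Longrightarrow> b \<in> carrier G \<Longrightarrow> c \<in> carrier G \<Longrightarrow> om a (b \<otimes> c) = om a b * om a c"
  using om_mult_left[of b c a] om_swap[of b a] om_swap[of c a] om_swap[of "b \<otimes> c" a]
  by (simp flip: inverse_mult_distrib)

lemma om_nonzero: "a \<in> carrier G \<Longrightarrow> b \<in> carrier G \<Longrightarrow> om a b \<noteq> 0"
  unfolding om_def using character_on_nonzero[OF zchar_character] commutator_in_center by blast

lemma om_eq_1_iff: "a \<in> carrier G \<Longrightarrow> b \<in> carrier G \<Longrightarrow> om a b = 1 \<longleftrightarrow> a \<otimes> b = b \<otimes> a"
  unfolding om_def using zchar_eq_1_iff commutator_in_center commutator_eq_one_iff by metis

lemma om_center: "z \<in> Z \<Longrightarrow> b \<in> carrier G \<Longrightarrow> om z b = 1"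
  using om_eq_1_iff Z_comm Z_carrier by blast

lemma mem_Z_iff_om: "a \<in> carrier G \<Longrightarrow> a \<in> Z \<longleftrightarrow> (\<forall>b\<in>carrier G. om a b = 1)"
  by (simp add: om_eq_1_iff group_center_def)

lemma om_character_right: "a \<in> carrier G \<Longrightarrow> character_on G (carrier G) (om a)"
  by (rule character_onI) (auto simp: om_mult_right om_nonzero)

lemma om_character_left: "a \<in> carrier G \<Longrightarrow> character_on G (carrier G) (\<lambda>b. om b a)"
  by (rule character_onI) (auto simp: om_mult_left om_nonzero)

text \<open>Both orders of summation of the double character sum of \<open>f r / om (\<pi> r) y\<close> can be
  evaluated; comparing them counts the solutions \<open>y\<close> without any linear algebra.\<close>

lemma card_representing:
  assumes L: "group L" "subgroup R L" "finite R"
    and \<pi>: "\<And>r. r \<in> R \<Longrightarrow> \<pi> r \<in> carrier G" "\<And>r s. r \<in> R \<Longrightarrow> s \<in> R \<Longrightarrow> \<pi> (r \<otimes>\<^bsub>L\<^esub> s) = \<pi> r \<otimes> \<pi> s"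
    and f: "character_on L R f" "\<And>r. r \<in> R \<Longrightarrow> \<pi> r \<in> Z \<Longrightarrow> f r = 1"
  shows "card R * card {y \<in> carrier G. \<forall>r\<in>R. om (\<pi> r) y = f r} =
         card {r \<in> R. \<pi> r \<in> Z} * card (carrier G)"
proof -
  let ?Y = "{y \<in> carrier G. \<forall>r\<in>R. om (\<pi> r) y = f r}" and ?N = "{r \<in> R. \<pi> r \<in> Z}"
  have inner1: "(\<Sum>r\<in>R. f r * inverse (om (\<pi> r) y)) = (if y \<in> ?Y then of_nat (card R) else 0)"
    if y: "y \<in> carrier G" for y
  proof -
    have "character_on L R (\<lambda>r. om (\<pi> r) y)"
      using \<pi> y by (intro character_onI) (auto simp: om_mult_left om_nonzero)
    then have "character_on L R (\<lambda>r. f r * inverse (om (\<pi> r) y))"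
      using f(1) by (intro character_on_times character_on_inverse)
    moreover have "(\<forall>r\<in>R. f r * inverse (om (\<pi> r) y) = 1) \<longleftrightarrow> y \<in> ?Y"
      using om_nonzero[OF \<pi>(1) y] y by (auto simp: field_simps)
    ultimately show ?thesis by (subst group.sum_character_on[OF L(1,2,3)]) auto
  qed
  have inner2: "(\<Sum>y\<in>carrier G. f r * inverse (om (\<pi> r) y)) = (if r \<in> ?N then of_nat (card (carrier G)) else 0)"
    if r: "r \<in> R" for r
  proof -
    have "(\<Sum>y\<in>carrier G. inverse (om (\<pi> r) y)) =
      (if \<forall>y\<in>carrier G. inverse (om (\<pi> r) y) = 1 then of_nat (card (carrier G)) else 0)"
      using om_character_right[OF \<pi>(1)[OF r]]
      by (intro sum_character_on subgroup_self finite_carrier character_on_inverse)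
    moreover have "(\<forall>y\<in>carrier G. inverse (om (\<pi> r) y) = 1) \<longleftrightarrow> r \<in> ?N"
      using mem_Z_iff_om[OF \<pi>(1)[OF r]] r by simp
    ultimately show ?thesis using f(2)[OF r] r by (auto simp flip: sum_distrib_left)
  qed
  have "of_nat (card ?Y * card R) = (\<Sum>y\<in>carrier G. if y \<in> ?Y then of_nat (card R) else (0::complex))"
    using finite_carrier by (simp flip: sum.inter_filter)
  also have "\<dots> = (\<Sum>y\<in>carrier G. \<Sum>r\<in>R. f r * inverse (om (\<pi> r) y))"
    using inner1 by (intro sum.cong) auto
  also have "\<dots> = (\<Sum>r\<in>R. \<Sum>y\<in>carrier G. f r * inverse (om (\<pi> r) y))" by (rule sum.swap)
  also have "\<dots> = (\<Sum>r\<in>R. if r \<in> ?N then of_nat (card (carrier G)) else 0)"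
    using inner2 by (intro sum.cong) auto
  also have "\<dots> = of_nat (card ?N * card (carrier G))"
    using L(3) by (simp flip: sum.inter_filter)
  finally have "card ?Y * card R = card ?N * card (carrier G)" by (simp only: of_nat_eq_iff)
  then show ?thesis by (simp only: mult.commute)
qed

end

section \<open>Isometries of commutator forms\<close>

lemma DirProd_nat_pow: "q [^]\<^bsub>G \<times>\<times> H\<^esub> (i::nat) = (fst q [^]\<^bsub>G\<^esub> i, snd q [^]\<^bsub>H\<^esub> i)"
  by (induction i) (auto simp: DirProd_def nat_pow_def split: prod.splits)

lemma DirProd_commutator:
  assumes "group G" "group H" "fst a \<in> carrier G" "snd a \<in> carrier H" "fst b \<in> carrier G" "snd b \<in> carrier H"
  shows "commutator (G \<times>\<times> H) a b = (commutator G (fst a) (fst b), commutator H (snd a) (snd b))"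
proof -
  have "inv\<^bsub>G \<times>\<times> H\<^esub> (fst a, snd a) = (inv\<^bsub>G\<^esub> fst a, inv\<^bsub>H\<^esub> snd a)"
    "inv\<^bsub>G \<times>\<times> H\<^esub> (fst b, snd b) = (inv\<^bsub>G\<^esub> fst b, inv\<^bsub>H\<^esub> snd b)"
    by (rule inv_DirProd[OF assms(1,2)]; fact)+
  then show ?thesis by (simp add: commutator_def DirProd_def split_beta)
qed

text \<open>By Bezout, an exponent i prime to p would put \<open>x\<close> into the subgroup
  generated by \<open>x [^] p\<close> and \<open>x [^] i\<close>.\<close>

lemma (in group) subgroup_prime_pow:
  assumes "subgroup A G" "Factorial_Ring.prime p" "x \<in> carrier G" "x \<notin> A"
    and "x [^] (p::nat) \<in> A" "x [^] (i::nat) \<in> A"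
  shows "p dvd i"
proof (rule ccontr)
  assume "\<not> p dvd i"
  then have "coprime i p" "i \<noteq> 0" using assms(2) by (metis prime_imp_coprime coprime_commute, metis dvd_0_right)
  then obtain a b where ab: "a * i = b * p + 1"
    using bezout_nat[of i p] by (metis coprime_imp_gcd_eq_1 mult.commute)
  have "(x [^] i) [^] a = x [^] (a * i)" using assms(3) by (simp add: nat_pow_pow mult.commute[of i])
  also have "\<dots> = x [^] (b * p) \<otimes> x" unfolding ab using assms(3) by simp
  also have "\<dots> = (x [^] p) [^] b \<otimes> x" using assms(3) by (simp add: nat_pow_pow mult.commute[of p])
  finally have "x = inv ((x [^] p) [^] b) \<otimes> (x [^] i) [^] a" using assms(3) by (simp add: m_assoc[symmetric])
  moreover have "(x [^] p) [^] b \<in> A" "(x [^] i) [^] a \<in> A"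
    using subgroup_nat_pow_closed assms by blast+
  ultimately show False using assms(1,4) by (metis subgroup.m_closed subgroup.m_inv_closed)
qed

context central_commutator_group
begin

lemma om_pow_left: "a \<in> carrier G \<Longrightarrow> b \<in> carrier G \<Longrightarrow> om (a [^] (i::nat)) b = om a b ^ i"
  using character_on_nat_pow[OF subgroup_self om_character_left] by simp

lemma om_pow_right: "a \<in> carrier G \<Longrightarrow> b \<in> carrier G \<Longrightarrow> om a (b [^] (i::nat)) = om a b ^ i"
  using character_on_nat_pow[OF subgroup_self om_character_right] by simp

lemma om_self: "a \<in> carrier G \<Longrightarrow> om a a = 1"
  by (simp add: om_eq_1_iff)

text \<open>Because \<open>om x x = 1\<close>, the form on the adjoined elements is determined by
  the exponents, the old values and the pairings with \<open>x\<close>. An isometry therefore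
  extends as soon as \<open>x\<close> and its partner have the same pairings with the old
  pairs.\<close>

lemma om_adjoin:
  assumes "a \<in> carrier G" "b \<in> carrier G" "x \<in> carrier G"
  shows "om (a \<otimes> x [^] (i::nat)) (b \<otimes> x [^] (j::nat)) = om a b * om a x ^ j * inverse (om b x) ^ i"
  using assms by (simp add: om_mult_left om_mult_right om_pow_left om_pow_right om_self om_swap[of b x])

lemma pow_in_center_dvd: "x \<in> carrier G \<Longrightarrow> p dvd i \<Longrightarrow> x [^] i \<in> Z"
  using subgroup_nat_pow_closed[OF Z_subgroup pow_in_center] by (auto simp: nat_pow_pow)

lemma Z_mult_right_iff:
  assumes "z \<in> Z" "a \<in> carrier G" shows "a \<otimes> z \<in> Z \<longleftrightarrow> a \<in> Z"
proof
  assume "a \<otimes> z \<in> Z"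
  then have "a \<otimes> z \<otimes> inv z \<in> Z" using assms Z_mult Z_inv by blast
  then show "a \<in> Z" using assms Z_carrier by (simp add: m_assoc)
qed (use assms Z_mult in auto)

lemma dvd_of_adjoin_center:
  assumes A: "subgroup A G" "Z \<subseteq> A" and a: "a \<in> A" and x: "x \<in> carrier G" "x \<notin> A"
    and "a \<otimes> x [^] (i::nat) \<in> Z"
  shows "p dvd i"
proof (rule subgroup_prime_pow[OF A(1) prime_p x])
  show "x [^] p \<in> A" using pow_in_center x A by blast
  have ac: "a \<in> carrier G" using A a by (blast intro: subgroup.mem_carrier)
  have "inv a \<otimes> (a \<otimes> x [^] i) \<in> A" using assms by (blast intro: subgroup.m_closed subgroup.m_inv_closed)
  then show "x [^] i \<in> A" using ac x by (simp add: m_assoc[symmetric])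
qed

end

text \<open>The graph of an isometry between subgroups of G/Z and H/Z, kept as its preimage in the
  direct product so that no quotients are formed. The last clause makes the relation well defined
  and injective modulo the centres.\<close>

definition partial_isometry :: "('a, 'm) monoid_scheme \<Rightarrow> ('b, 'n) monoid_scheme \<Rightarrow> ('a \<times> 'b) set \<Rightarrow> bool" where
  "partial_isometry G H R \<longleftrightarrow>
     subgroup R (G \<times>\<times> H) \<and> group_center G \<times> group_center H \<subseteq> R \<and>
     (\<forall>r\<in>R. \<forall>s\<in>R. central_commutator_group.om G (fst r) (fst s) = central_commutator_group.om H (snd r) (snd s)) \<and>
     (\<forall>r\<in>R. fst r \<in> group_center G \<longleftrightarrow> snd r \<in> group_center H)"

locale central_commutator_pair =
  G: central_commutator_group G p + H: central_commutator_group H p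
  for G :: "('a, 'm) monoid_scheme" and H :: "('b, 'n) monoid_scheme" and p +
  assumes card_eq: "card (carrier G) = card (carrier H)"
begin

abbreviation "L \<equiv> G \<times>\<times> H"

sublocale L: group L by (rule DirProd_group) unfold_locales

lemma finite_L: "finite (carrier L)"
  using G.finite_carrier H.finite_carrier by (simp add: DirProd_def)

lemma swap_pair: "central_commutator_pair H G p"
  by unfold_locales (simp add: card_eq)

lemma L_carrier: "r \<in> carrier L \<longleftrightarrow> fst r \<in> carrier G \<and> snd r \<in> carrier H"
  by (cases r) (simp add: DirProd_def)

lemma L_mult: "r \<otimes>\<^bsub>L\<^esub> s = (fst r \<otimes>\<^bsub>G\<^esub> fst s, snd r \<otimes>\<^bsub>H\<^esub> snd s)"
  by (cases r; cases s) (simp add: DirProd_def)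

lemma L_inv: "r \<in> carrier L \<Longrightarrow> inv\<^bsub>L\<^esub> r = (inv\<^bsub>G\<^esub> fst r, inv\<^bsub>H\<^esub> snd r)"
  using inv_DirProd[OF G.is_group H.is_group, of "fst r" "snd r"] by (auto simp: L_carrier)

lemma L_commutator: "r \<in> carrier L \<Longrightarrow> s \<in> carrier L \<Longrightarrow>
    commutator L r s = (commutator G (fst r) (fst s), commutator H (snd r) (snd s))"
  using DirProd_commutator[OF G.is_group H.is_group, of r s] unfolding L_carrier by blast

lemma L_commutator_in_center: "r \<in> carrier L \<Longrightarrow> s \<in> carrier L \<Longrightarrow> commutator L r s \<in> G.Z \<times> H.Z"
  using G.commutator_in_center H.commutator_in_center by (simp add: L_commutator mem_Times_iff)

context
  fixes R assumes R: "partial_isometry G H R"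
begin

lemma isometry_subgroup: "subgroup R L" using R by (simp add: partial_isometry_def)
lemma isometry_center: "z \<in> G.Z \<Longrightarrow> w \<in> H.Z \<Longrightarrow> (z, w) \<in> R" using R by (auto simp: partial_isometry_def)
lemma isometry_om: "r \<in> R \<Longrightarrow> s \<in> R \<Longrightarrow> G.om (fst r) (fst s) = H.om (snd r) (snd s)"
  using R by (simp add: partial_isometry_def)
lemma isometry_center_iff: "r \<in> R \<Longrightarrow> fst r \<in> G.Z \<longleftrightarrow> snd r \<in> H.Z" using R by (simp add: partial_isometry_def)

lemma isometry_fst: "r \<in> R \<Longrightarrow> fst r \<in> carrier G" and isometry_snd: "r \<in> R \<Longrightarrow> snd r \<in> carrier H"
  using subgroup.mem_carrier[OF isometry_subgroup] L_carrier by blast+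

lemma isometry_mult: "r \<in> R \<Longrightarrow> s \<in> R \<Longrightarrow> (fst r \<otimes>\<^bsub>G\<^esub> fst s, snd r \<otimes>\<^bsub>H\<^esub> snd s) \<in> R"
  using subgroup.m_closed[OF isometry_subgroup] L_mult by metis

lemma isometry_inv: "r \<in> R \<Longrightarrow> (inv\<^bsub>G\<^esub> fst r, inv\<^bsub>H\<^esub> snd r) \<in> R"
  using subgroup.m_inv_closed[OF isometry_subgroup] L_inv subgroup.mem_carrier[OF isometry_subgroup] by metis

lemma isometry_finite: "finite R"
  by (rule finite_subset[OF subgroup.subset[OF isometry_subgroup] finite_L])

lemma isometry_card_pos: "card R > 0"
  using isometry_finite subgroup.one_closed[OF isometry_subgroup] by (auto simp: card_gt_0_iff)

lemma isometry_fst_subgroup: "subgroup (fst ` R) G"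
proof (rule G.subgroupI)
  show "fst ` R \<subseteq> carrier G" using isometry_fst by blast
  show "fst ` R \<noteq> {}" using subgroup.one_closed[OF isometry_subgroup] by blast
next
  fix a assume "a \<in> fst ` R"
  then show "inv\<^bsub>G\<^esub> a \<in> fst ` R" using isometry_inv by force
next
  fix a b assume "a \<in> fst ` R" "b \<in> fst ` R"
  then show "a \<otimes>\<^bsub>G\<^esub> b \<in> fst ` R" using isometry_mult by force
qed

lemma isometry_fst_center: "G.Z \<subseteq> fst ` R"
  using isometry_center H.Z_one by force

text \<open>The quotient of the two pairs has trivial first component, which is central, so its
  second component is central too.\<close>

lemma isometry_same_fst:
  assumes "r \<in> R" "s \<in> R" "fst r = fst s"
  shows "\<exists>w\<in>H.Z. snd s = snd r \<otimes>\<^bsub>H\<^esub> w"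
proof -
  let ?w = "inv\<^bsub>H\<^esub> snd r \<otimes>\<^bsub>H\<^esub> snd s"
  have "(inv\<^bsub>G\<^esub> fst r \<otimes>\<^bsub>G\<^esub> fst s, ?w) \<in> R" using isometry_mult[OF isometry_inv[OF assms(1)] assms(2)] by simp
  then have "(\<one>\<^bsub>G\<^esub>, ?w) \<in> R" using assms(3) isometry_fst[OF assms(2)] by simp
  then have "?w \<in> H.Z" using isometry_center_iff G.Z_one by fastforce
  moreover have "snd s = snd r \<otimes>\<^bsub>H\<^esub> ?w" using isometry_snd assms by (simp add: H.m_assoc[symmetric])
  ultimately show ?thesis by blast
qed

text \<open>Every fibre of the first projection on \<open>S\<close> is a coset of the centre of
  \<open>H\<close>. Together with its mirror image this compares cardinalities in \<open>G\<close>
  and \<open>H\<close> through \<open>S\<close>.\<close>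

lemma isometry_card_fst:
  assumes S: "S \<subseteq> R" "\<And>r w. r \<in> S \<Longrightarrow> w \<in> H.Z \<Longrightarrow> (fst r, snd r \<otimes>\<^bsub>H\<^esub> w) \<in> S"
  shows "card S = p * card (fst ` S)"
proof -
  have fin: "finite S" using S(1) isometry_finite finite_subset by blast
  have fib: "card {r \<in> S. fst r = x} = p" if "x \<in> fst ` S" for x
  proof -
    from that obtain r where r: "r \<in> S" "fst r = x" by blast
    have "{s \<in> S. fst s = x} = (\<lambda>w. (x, snd r \<otimes>\<^bsub>H\<^esub> w)) ` H.Z"
    proof (intro equalityI subsetI)
      fix s assume s: "s \<in> {s \<in> S. fst s = x}"
      then obtain w where "w \<in> H.Z" "snd s = snd r \<otimes>\<^bsub>H\<^esub> w"
        using isometry_same_fst[of r s] r S(1) by blast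
      then show "s \<in> (\<lambda>w. (x, snd r \<otimes>\<^bsub>H\<^esub> w)) ` H.Z" using s by (metis (mono_tags, lifting) image_eqI mem_Collect_eq prod.collapse)
    next
      fix s assume "s \<in> (\<lambda>w. (x, snd r \<otimes>\<^bsub>H\<^esub> w)) ` H.Z"
      then show "s \<in> {s \<in> S. fst s = x}" using S(2)[OF r(1)] r(2) by auto
    qed
    moreover have "inj_on (\<lambda>w. (x, snd r \<otimes>\<^bsub>H\<^esub> w)) H.Z"
    proof (rule inj_onI)
      fix v w assume "v \<in> H.Z" "w \<in> H.Z" "(x, snd r \<otimes>\<^bsub>H\<^esub> v) = (x, snd r \<otimes>\<^bsub>H\<^esub> w)"
      moreover have "snd r \<in> carrier H" using r(1) S(1) isometry_snd by blast
      ultimately show "v = w" using H.Z_carrier by simp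
    qed
    ultimately show ?thesis using H.card_center by (simp add: card_image)
  qed
  have "card S = (\<Sum>x\<in>fst ` S. card {r \<in> S. fst r = x})"
    using sum.image_gen[OF fin, of "\<lambda>_. 1::nat" fst] by simp
  also have "\<dots> = (\<Sum>x\<in>fst ` S. p)" using fib by (intro sum.cong) auto
  finally show ?thesis by simp
qed

end

lemma partial_isometry_swap:
  assumes R: "partial_isometry G H R" shows "partial_isometry H G (prod.swap ` R)"
proof -
  interpret sw: central_commutator_pair H G p by (rule swap_pair)
  have "subgroup (prod.swap ` R) (H \<times>\<times> G)"
  proof (rule sw.L.subgroupI)
    show "prod.swap ` R \<subseteq> carrier (H \<times>\<times> G)"
      using isometry_fst[OF R] isometry_snd[OF R] by (auto simp: sw.L_carrier)
    show "prod.swap ` R \<noteq> {}" using subgroup.one_closed[OF isometry_subgroup[OF R]] by blast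
  next
    fix a assume "a \<in> prod.swap ` R"
    then obtain r where r: "r \<in> R" "a = prod.swap r" by blast
    have "inv\<^bsub>H \<times>\<times> G\<^esub> a = prod.swap (inv\<^bsub>G\<^esub> fst r, inv\<^bsub>H\<^esub> snd r)"
      using r isometry_fst[OF R] isometry_snd[OF R] by (simp add: sw.L_inv mem_Times_iff)
    then show "inv\<^bsub>H \<times>\<times> G\<^esub> a \<in> prod.swap ` R" using isometry_inv[OF R r(1)] by blast
  next
    fix a b assume "a \<in> prod.swap ` R" "b \<in> prod.swap ` R"
    then obtain r s where r: "r \<in> R" "a = prod.swap r" "s \<in> R" "b = prod.swap s" by blast
    have "a \<otimes>\<^bsub>H \<times>\<times> G\<^esub> b = prod.swap (fst r \<otimes>\<^bsub>G\<^esub> fst s, snd r \<otimes>\<^bsub>H\<^esub> snd s)"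
      using r by (simp add: sw.L_mult)
    then show "a \<otimes>\<^bsub>H \<times>\<times> G\<^esub> b \<in> prod.swap ` R" using isometry_mult[OF R r(1,3)] by blast
  qed
  then show ?thesis
    unfolding partial_isometry_def using isometry_om[OF R] isometry_center[OF R] isometry_center_iff[OF R] by force
qed

lemma isometry_card_snd:
  assumes R: "partial_isometry G H R"
    and S: "S \<subseteq> R" "\<And>r w. r \<in> S \<Longrightarrow> w \<in> G.Z \<Longrightarrow> (fst r \<otimes>\<^bsub>G\<^esub> w, snd r) \<in> S"
  shows "card S = p * card (snd ` S)"
proof -
  interpret sw: central_commutator_pair H G p by (rule swap_pair)
  have "card (prod.swap ` S) = p * card (fst ` prod.swap ` S)"
  proof (rule sw.isometry_card_fst[OF partial_isometry_swap[OF R]])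
    show "prod.swap ` S \<subseteq> prod.swap ` R" using S(1) by blast
    fix r w assume "r \<in> prod.swap ` S" "w \<in> G.Z"
    then obtain s where s: "s \<in> S" "r = prod.swap s" by blast
    show "(fst r, snd r \<otimes>\<^bsub>G\<^esub> w) \<in> prod.swap ` S" using S(2)[OF s(1) \<open>w \<in> G.Z\<close>] unfolding s(2) by force
  qed
  moreover have "card (prod.swap ` S) = card S" by (rule card_image) auto
  moreover have "fst ` prod.swap ` S = snd ` S" by (simp add: image_image)
  ultimately show ?thesis by simp
qed

text \<open>The extension step of Witt's theorem, by counting. A partner \<open>y\<close> with the
  right pairings is needed outside the second projection of \<open>R\<close>. Equally many elements
  on both sides have these pairings, equally many of them are already matched by \<open>R\<close>,
  and on the side of \<open>G\<close> the element \<open>x\<close> is unmatched.\<close>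

lemma partial_isometry_extend:
  assumes R: "partial_isometry G H R" and x: "x \<in> carrier G" "x \<notin> fst ` R"
  shows "\<exists>R'. partial_isometry G H R' \<and> R \<subset> R'"
proof -
  interpret sw: central_commutator_pair H G p by (rule swap_pair)
  note Rsw = partial_isometry_swap[OF R]
  define XG where "XG = {x' \<in> carrier G. \<forall>r\<in>R. G.om (fst r) x' = G.om (fst r) x}"
  define YH where "YH = {y \<in> carrier H. \<forall>r\<in>R. H.om (snd r) y = G.om (fst r) x}"
  have f: "character_on L R (\<lambda>r. G.om (fst r) x)"
    using isometry_fst[OF R] x by (intro character_onI) (auto simp: L_mult G.om_mult_left G.om_nonzero)
  \<comment> \<open>Both counts use the same character of \<open>R\<close>; it is trivial on pairs
    with central components, as \<open>card_representing\<close> requires.\<close>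
  have "card R * card XG = card {r \<in> R. fst r \<in> G.Z} * card (carrier G)"
    unfolding XG_def
    by (rule G.card_representing[OF L.is_group isometry_subgroup[OF R] isometry_finite[OF R] _ _ f])
       (use isometry_fst[OF R] x in \<open>auto simp: L_mult G.om_center\<close>)
  moreover have "card R * card YH = card {r \<in> R. snd r \<in> H.Z} * card (carrier H)"
    unfolding YH_def
    by (rule H.card_representing[OF L.is_group isometry_subgroup[OF R] isometry_finite[OF R] _ _ f])
       (use isometry_snd[OF R] isometry_center_iff[OF R] x in \<open>auto simp: L_mult G.om_center\<close>)
  moreover have "{r \<in> R. fst r \<in> G.Z} = {r \<in> R. snd r \<in> H.Z}" using isometry_center_iff[OF R] by blast
  ultimately have "card R * card XG = card R * card YH" using card_eq by simp
  then have cXY: "card XG = card YH" using isometry_card_pos[OF R] by simp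
  \<comment> \<open>On pairs in \<open>R\<close> the two membership conditions coincide, so
    \<open>S\<close> projects onto the matched parts of \<open>XG\<close> and of \<open>YH\<close>,
    with fibres of p elements in both directions.\<close>
  define S where "S = {r \<in> R. fst r \<in> XG}"
  have S2: "S = {r \<in> R. snd r \<in> YH}"
    unfolding S_def XG_def YH_def using isometry_om[OF R] isometry_fst[OF R] isometry_snd[OF R] by auto
  have "card S = p * card (fst ` S)"
  proof (rule isometry_card_fst[OF R])
    show "S \<subseteq> R" by (auto simp: S_def)
    fix r w assume "r \<in> S" "w \<in> H.Z"
    then show "(fst r, snd r \<otimes>\<^bsub>H\<^esub> w) \<in> S"
      using isometry_mult[OF R, of r "(\<one>\<^bsub>G\<^esub>, w)"] isometry_center[OF R G.Z_one] isometry_fst[OF R] by (simp add: S_def)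
  qed
  moreover have "card S = p * card (snd ` S)"
  proof (rule isometry_card_snd[OF R])
    show "S \<subseteq> R" by (auto simp: S_def)
    fix r w assume "r \<in> S" "w \<in> G.Z"
    then show "(fst r \<otimes>\<^bsub>G\<^esub> w, snd r) \<in> S"
      using isometry_mult[OF R, of r "(w, \<one>\<^bsub>H\<^esub>)"] isometry_center[OF R _ H.Z_one] isometry_snd[OF R] by (simp add: S2)
  qed
  ultimately have "card (fst ` S) = card (snd ` S)" using G.p_gt_1 by simp
  moreover have "fst ` S = XG \<inter> fst ` R" by (auto simp: S_def)
  moreover have "snd ` S = YH \<inter> snd ` R" by (auto simp: S2)
  ultimately have eq: "card (XG \<inter> fst ` R) = card (YH \<inter> snd ` R)" by simp
  have "x \<in> XG" using x by (simp add: XG_def)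
  then have "XG \<inter> fst ` R \<subset> XG" using x by blast
  moreover have "finite XG" unfolding XG_def using G.finite_carrier by simp
  ultimately have "card (XG \<inter> fst ` R) < card XG" by (rule psubset_card_mono[rotated])
  then have "YH \<inter> snd ` R \<noteq> YH" using eq cXY by auto
  then obtain y where y: "y \<in> YH" "y \<notin> snd ` R" by blast
  then have yc: "y \<in> carrier H" and yom: "\<And>r. r \<in> R \<Longrightarrow> H.om (snd r) y = G.om (fst r) x"
    by (auto simp: YH_def)
  define R' where "R' = L.adjoin R (x, y)"
  have qc: "(x, y) \<in> carrier L" using x yc by (simp add: L_carrier)
  have subR: "R \<subseteq> carrier L" by (rule subgroup.subset[OF isometry_subgroup[OF R]])
  have RR': "R \<subseteq> R'" unfolding R'_def by (rule L.subset_adjoin[OF subR])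
  have form: "\<exists>r\<in>R. \<exists>i::nat. s = (fst r \<otimes>\<^bsub>G\<^esub> x [^]\<^bsub>G\<^esub> i, snd r \<otimes>\<^bsub>H\<^esub> y [^]\<^bsub>H\<^esub> i)" if "s \<in> R'" for s
  proof -
    from that obtain r i where "r \<in> R" "s = r \<otimes>\<^bsub>L\<^esub> (x, y) [^]\<^bsub>L\<^esub> (i::nat)"
      unfolding R'_def by (rule L.adjoinE)
    then show ?thesis by (metis L_mult DirProd_nat_pow fst_conv snd_conv)
  qed
  have "partial_isometry G H R'"
    unfolding partial_isometry_def
  proof (intro conjI ballI)
    show "subgroup R' L" unfolding R'_def
    proof (rule L.subgroup_adjoin[OF finite_L isometry_subgroup[OF R] qc])
      fix r and i :: nat assume "r \<in> R"
      then have "commutator L ((x, y) [^]\<^bsub>L\<^esub> i) r \<in> G.Z \<times> H.Z"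
        using L.nat_pow_closed[OF qc] subR by (intro L_commutator_in_center) blast+
      then show "commutator L ((x, y) [^]\<^bsub>L\<^esub> i) r \<in> R" using isometry_center[OF R] by auto
    qed
    show "G.Z \<times> H.Z \<subseteq> R'" using isometry_center[OF R] RR' by auto
  next
    fix s t assume "s \<in> R'" "t \<in> R'"
    then obtain r i r' j where *: "r \<in> R" "r' \<in> R"
      "s = (fst r \<otimes>\<^bsub>G\<^esub> x [^]\<^bsub>G\<^esub> i, snd r \<otimes>\<^bsub>H\<^esub> y [^]\<^bsub>H\<^esub> (i::nat))"
      "t = (fst r' \<otimes>\<^bsub>G\<^esub> x [^]\<^bsub>G\<^esub> j, snd r' \<otimes>\<^bsub>H\<^esub> y [^]\<^bsub>H\<^esub> (j::nat))"
      using form by meson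
    then show "G.om (fst s) (fst t) = H.om (snd s) (snd t)"
      using G.om_adjoin[of "fst r" "fst r'" x i j] H.om_adjoin[of "snd r" "snd r'" y i j]
        isometry_om[OF R *(1,2)] yom isometry_fst[OF R] isometry_snd[OF R] x yc by simp
  next
    fix s assume "s \<in> R'"
    then obtain r i where *: "r \<in> R" "s = (fst r \<otimes>\<^bsub>G\<^esub> x [^]\<^bsub>G\<^esub> i, snd r \<otimes>\<^bsub>H\<^esub> y [^]\<^bsub>H\<^esub> (i::nat))"
      using form by meson
    have snd_sub: "subgroup (snd ` R) H" "H.Z \<subseteq> snd ` R"
      using sw.isometry_fst_subgroup[OF Rsw] sw.isometry_fst_center[OF Rsw] by (simp_all add: image_image)
    \<comment> \<open>A central component on either side forces p to divide i, since
      \<open>x\<close> and \<open>y\<close> lie outside the projections of \<open>R\<close>. Then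
      the i-th powers of \<open>x\<close> and \<open>y\<close> are central, and only the pair from
      \<open>R\<close> decides.\<close>
    have "p dvd i" if "fst s \<in> G.Z"
      using G.dvd_of_adjoin_center[OF isometry_fst_subgroup[OF R] isometry_fst_center[OF R] _ x, of "fst r" i] that * by auto
    moreover have "p dvd i" if "snd s \<in> H.Z"
      using H.dvd_of_adjoin_center[OF snd_sub _ yc y(2), of "snd r" i] that * by auto
    moreover have "fst s \<in> G.Z \<longleftrightarrow> snd s \<in> H.Z" if "p dvd i"
      using G.Z_mult_right_iff[OF G.pow_in_center_dvd[OF x(1) that] isometry_fst[OF R *(1)]]
        H.Z_mult_right_iff[OF H.pow_in_center_dvd[OF yc that] isometry_snd[OF R *(1)]]
        isometry_center_iff[OF R *(1)] * by simp
    ultimately show "fst s \<in> G.Z \<longleftrightarrow> snd s \<in> H.Z" by blast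
  qed
  moreover have "(x, y) \<in> R'" unfolding R'_def using L.mem_adjoin[OF isometry_subgroup[OF R] qc] .
  moreover have "(x, y) \<notin> R" using x by force
  ultimately show ?thesis using RR' by blast
qed

text \<open>A relation of maximal size has full first projection by the extension step; the product
  of the centres provides a start. Since both projections have fibres of p elements, the second
  projection is full as well.\<close>

lemma isometry_exists:
  obtains R where "partial_isometry G H R" "fst ` R = carrier G" "snd ` R = carrier H"
proof -
  have "partial_isometry G H (G.Z \<times> H.Z)"
    unfolding partial_isometry_def
    using DirProd_subgroups[OF G.is_group G.Z_subgroup H.is_group H.Z_subgroup]
    by (auto simp: G.om_center H.om_center G.Z_carrier H.Z_carrier)
  moreover have "\<forall>R. partial_isometry G H R \<longrightarrow> card R < Suc (card (carrier L))"
    using card_mono[OF finite_L] subgroup.subset[OF isometry_subgroup] by (simp add: less_Suc_eq_le)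
  ultimately obtain R where R: "partial_isometry G H R" "\<And>R'. partial_isometry G H R' \<Longrightarrow> card R' \<le> card R"
    using ex_has_greatest_nat[of "partial_isometry G H" _ card] by metis
  have "carrier G \<subseteq> fst ` R"
  proof
    fix x assume "x \<in> carrier G"
    show "x \<in> fst ` R"
    proof (rule ccontr)
      assume "x \<notin> fst ` R"
      then obtain R' where R': "partial_isometry G H R'" "R \<subset> R'"
        using partial_isometry_extend[OF R(1) \<open>x \<in> carrier G\<close>] by blast
      then have "card R < card R'" using isometry_finite[OF R'(1)] by (simp add: psubset_card_mono)
      then show False using R(2)[OF R'(1)] by simp
    qed
  qed
  then have G: "fst ` R = carrier G" using isometry_fst[OF R(1)] by blast
  have "card R = p * card (fst ` R)"
  proof (rule isometry_card_fst[OF R(1) subset_refl])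
    fix r w assume "r \<in> R" "w \<in> H.Z"
    then show "(fst r, snd r \<otimes>\<^bsub>H\<^esub> w) \<in> R"
      using isometry_mult[OF R(1), of r "(\<one>\<^bsub>G\<^esub>, w)"] isometry_center[OF R(1) G.Z_one] isometry_fst[OF R(1)] by simp
  qed
  moreover have "card R = p * card (snd ` R)"
  proof (rule isometry_card_snd[OF R(1) subset_refl])
    fix r w assume "r \<in> R" "w \<in> G.Z"
    then show "(fst r \<otimes>\<^bsub>G\<^esub> w, snd r) \<in> R"
      using isometry_mult[OF R(1), of r "(w, \<one>\<^bsub>H\<^esub>)"] isometry_center[OF R(1) _ H.Z_one] isometry_snd[OF R(1)] by simp
  qed
  ultimately have "card (snd ` R) = card (carrier H)" using G.p_gt_1 G card_eq by simp
  moreover have "snd ` R \<subseteq> carrier H" using isometry_snd[OF R(1)] by blast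
  ultimately have "snd ` R = carrier H" using H.finite_carrier by (simp add: card_subset_eq)
  with R(1) G show ?thesis using that by blast
qed

text \<open>The central characters take the values \<open>om\<close> of the first and of the second
  components on a commutator in \<open>R\<close>. These agree by isometry, so the quotient character
  is trivial on commutators and \<open>character_extend\<close> applies.\<close>

lemma connecting_character_exists:
  assumes R: "partial_isometry G H R"
  obtains \<Lambda> where "character_on L R \<Lambda>"
    "\<And>z w. z \<in> G.Z \<Longrightarrow> w \<in> H.Z \<Longrightarrow> \<Lambda> (z, w) = inverse (G.zchar z) * H.zchar w"
proof -
  let ?\<chi> = "\<lambda>r. inverse (G.zchar (fst r)) * H.zchar (snd r)"
  have "\<exists>\<chi>'. character_on L R \<chi>' \<and> (\<forall>n\<in>G.Z \<times> H.Z. \<chi>' n = ?\<chi> n)"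
  proof (rule L.character_extend[OF finite_L isometry_subgroup[OF R]])
    show "subgroup (G.Z \<times> H.Z) L"
      using DirProd_subgroups[OF G.is_group G.Z_subgroup H.is_group H.Z_subgroup] .
    show "G.Z \<times> H.Z \<subseteq> R" using isometry_center[OF R] by auto
    show "character_on L (G.Z \<times> H.Z) ?\<chi>"
      by (rule character_onI)
         (auto simp: L_mult character_on_mult[OF G.zchar_character] character_on_mult[OF H.zchar_character]
           character_on_nonzero[OF G.zchar_character] character_on_nonzero[OF H.zchar_character])
    fix r s assume rs: "r \<in> R" "s \<in> R"
    then have c: "r \<in> carrier L" "s \<in> carrier L" using subgroup.mem_carrier[OF isometry_subgroup[OF R]] by blast+
    have "G.om (fst r) (fst s) \<noteq> 0" using c by (intro G.om_nonzero) (auto simp: mem_Times_iff)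
    then have "?\<chi> (commutator L r s) = 1"
      using isometry_om[OF R rs] c by (simp add: L_commutator G.om_def H.om_def)
    then show "commutator L r s \<in> G.Z \<times> H.Z \<and> ?\<chi> (commutator L r s) = 1"
      using L_commutator_in_center[OF c] by blast
  qed
  then show ?thesis using that by fastforce
qed

end

section \<open>Cocycles inflated from the central quotient\<close>

lemma cocycle_nonzero: "\<alpha> \<in> cocycles G \<Longrightarrow> g \<in> carrier G \<Longrightarrow> h \<in> carrier G \<Longrightarrow> \<alpha> (g, h) \<noteq> 0"
  by (auto simp: cocycles_def PiE_def Pi_def)

lemma cocycle_eq:
  "\<alpha> \<in> cocycles G \<Longrightarrow> g \<in> carrier G \<Longrightarrow> h \<in> carrier G \<Longrightarrow> k \<in> carrier G \<Longrightarrow>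
   \<alpha> (g, h) * \<alpha> (g \<otimes>\<^bsub>G\<^esub> h, k) = \<alpha> (g, h \<otimes>\<^bsub>G\<^esub> k) * \<alpha> (h, k)"
  by (simp add: cocycles_def)

lemma cocycle_eqI:
  assumes "\<alpha> \<in> cocycles G" "\<beta> \<in> cocycles G"
    and "\<And>g h. g \<in> carrier G \<Longrightarrow> h \<in> carrier G \<Longrightarrow> \<alpha> (g, h) = \<beta> (g, h)"
  shows "\<alpha> = \<beta>"
  by (rule PiE_ext[of \<alpha> "carrier G \<times> carrier G" "\<lambda>_. UNIV - {0}" \<beta>])
     (use assms in \<open>auto simp: cocycles_def\<close>)

lemma cocyclesI:
  assumes "\<And>g h. g \<in> carrier G \<Longrightarrow> h \<in> carrier G \<Longrightarrow> a g h \<noteq> 0"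
    and "\<And>g h k. g \<in> carrier G \<Longrightarrow> h \<in> carrier G \<Longrightarrow> k \<in> carrier G \<Longrightarrow>
      a g h * a (g \<otimes>\<^bsub>G\<^esub> h) k = a g (h \<otimes>\<^bsub>G\<^esub> k) * a h k"
    and "group G"
  shows "(\<lambda>(g, h) \<in> carrier G \<times> carrier G. a g h) \<in> cocycles G"
proof -
  interpret group G by fact
  show ?thesis using assms(1,2) by (auto simp: cocycles_def)
qed

lemma coboundary_in_cocycles:
  assumes "group G" "f \<in> carrier G \<rightarrow> UNIV - {0}"
  shows "coboundary G f \<in> cocycles G"
  using normal_imp_subgroup[OF coboundaries_normal[OF assms(1)], THEN subgroup.subset] assms(2)
  by (auto simp: coboundaries_def cocycle_group_def)

lemma cocycle_group_mult:
  "g \<in> carrier G \<Longrightarrow> h \<in> carrier G \<Longrightarrow> (\<alpha> \<otimes>\<^bsub>cocycle_group G\<^esub> \<beta>) (g, h) = \<alpha> (g, h) * \<beta> (g, h)"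
  by (simp add: cocycle_group_def)

lemma coboundary_apply:
  "g \<in> carrier G \<Longrightarrow> h \<in> carrier G \<Longrightarrow> coboundary G f (g, h) = f g * f h / f (g \<otimes>\<^bsub>G\<^esub> h)"
  by (simp add: coboundary_def)

context group
begin

lemma cocycle_one_left: "\<alpha> \<in> cocycles G \<Longrightarrow> g \<in> carrier G \<Longrightarrow> \<alpha> (\<one>, g) = \<alpha> (\<one>, \<one>)"
  using cocycle_eq[of \<alpha> G \<one> \<one> g] cocycle_nonzero[of \<alpha> G \<one> g] by simp

lemma cocycle_one_right: "\<alpha> \<in> cocycles G \<Longrightarrow> g \<in> carrier G \<Longrightarrow> \<alpha> (g, \<one>) = \<alpha> (\<one>, \<one>)"
  using cocycle_eq[of \<alpha> G g \<one> \<one>] cocycle_nonzero[of \<alpha> G g \<one>] by simp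

text \<open>H^2 of a finite cyclic group with values in the nonzero complex numbers vanishes:
  \<open>P\<close> is the trivializing function in terms of exponents. When \<open>m\<close> is the
  order of \<open>x\<close>, periodicity makes it a function on the generated subgroup.\<close>

lemma cocycle_on_powers:
  assumes \<alpha>: "\<alpha> \<in> cocycles G" and x: "x \<in> carrier G" "x [^] (m::nat) = \<one>" "m > 0"
  obtains P :: "nat \<Rightarrow> complex" where "\<And>i. P i \<noteq> 0" "\<And>i. P (i + m) = P i"
    "\<And>i j. P (i + j) = P i * P j * \<alpha> (x [^] i, x [^] j)"
proof -
  let ?a = "\<alpha> (\<one>, \<one>)" and ?Q = "\<lambda>i::nat. \<Prod>k<i. \<alpha> (x [^] k, x)"
  have nz: "\<alpha> (x [^] (i::nat), x [^] (j::nat)) \<noteq> 0" "\<alpha> (x [^] i, x) \<noteq> 0" "?a \<noteq> 0" for i j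
    using cocycle_nonzero[OF \<alpha>] x by auto
  then have Q0: "?Q i \<noteq> 0" for i by simp
  \<comment> \<open>The m-th root spreads the defect of the product over m steps, so that the values
    of \<open>P\<close> at 0 and m agree. The factor \<open>inverse ?a\<close> in \<open>P\<close>
    accounts for cocycles that are not normalized.\<close>
  obtain d where d: "d ^ m = inverse (?Q m)" using complex_nth_root_exists[OF x(3)] .
  have "d \<noteq> 0" using d Q0[of m] x(3) by (metis inverse_zero_imp_zero power_0_left less_irrefl)
  define P where "P i = inverse ?a * d ^ i * ?Q i" for i
  have P0: "P 0 = inverse ?a" by (simp add: P_def)
  have PS: "P (Suc i) = P i * d * \<alpha> (x [^] i, x)" for i by (simp add: P_def)
  have add: "P (i + j) = P i * P j * \<alpha> (x [^] i, x [^] j)" for i j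
  proof (induction j)
    case 0
    then show ?case using nz(3) cocycle_one_right[OF \<alpha>, of "x [^] i"] x by (simp add: P0)
  next
    case (Suc j)
    have "x [^] i \<otimes> x [^] j = x [^] (i + j)" "x [^] j \<otimes> x = x [^] Suc j" using x by (simp_all add: nat_pow_mult)
    then have c: "\<alpha> (x [^] i, x [^] j) * \<alpha> (x [^] (i + j), x) = \<alpha> (x [^] i, x [^] Suc j) * \<alpha> (x [^] j, x)"
      using cocycle_eq[OF \<alpha>, of "x [^] i" "x [^] j" x] x by simp
    have "P (i + Suc j) = P i * P j * d * (\<alpha> (x [^] i, x [^] j) * \<alpha> (x [^] (i + j), x))"
      using PS[of "i + j"] Suc by simp
    also have "\<dots> = P i * (P j * d * \<alpha> (x [^] j, x)) * \<alpha> (x [^] i, x [^] Suc j)" unfolding c by (simp only: mult_ac)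
    finally show ?case unfolding PS .
  qed
  have "P m = inverse ?a" unfolding P_def d using Q0[of m] by simp
  then have "P (i + m) = P i" for i
    using add[of i m] x nz(3) cocycle_one_right[OF \<alpha>, of "x [^] i"] by simp
  moreover have "P i \<noteq> 0" for i using \<open>d \<noteq> 0\<close> Q0 nz(3) by (simp add: P_def)
  ultimately show ?thesis using add that by blast
qed

lemma subgroup_centralizer:
  assumes "g \<in> carrier G" shows "subgroup {b \<in> carrier G. b \<otimes> g = g \<otimes> b} G"
proof (rule subgroupI)
  fix a assume a: "a \<in> {b \<in> carrier G. b \<otimes> g = g \<otimes> b}"
  then have ac: "a \<in> carrier G" "a \<otimes> g = g \<otimes> a" by auto
  have "inv a \<otimes> g = inv a \<otimes> (g \<otimes> a) \<otimes> inv a" using ac(1) assms by (simp add: m_assoc)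
  also have "\<dots> = g \<otimes> inv a" unfolding ac(2)[symmetric] using ac(1) assms by (simp add: m_assoc[symmetric])
  finally have "inv a \<otimes> g = g \<otimes> inv a" .
  then show "inv a \<in> {b \<in> carrier G. b \<otimes> g = g \<otimes> b}" using a by simp
next
  fix a b assume ab: "a \<in> {b \<in> carrier G. b \<otimes> g = g \<otimes> b}" "b \<in> {b \<in> carrier G. b \<otimes> g = g \<otimes> b}"
  then have "a \<otimes> b \<otimes> g = g \<otimes> (a \<otimes> b)" using assms by (metis (mono_tags, lifting) m_assoc mem_Collect_eq)
  then show "a \<otimes> b \<in> {b \<in> carrier G. b \<otimes> g = g \<otimes> b}" using ab by simp
qed (use assms in auto)

text \<open>The quotient is the scalar commutator of the basis vectors of \<open>g\<close> and
  \<open>b\<close> in the twisted group algebra. Commutators with a fixed element are multiplicative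
  on the elements that commute with it up to scalars.\<close>

lemma cocycle_pairing_character:
  assumes \<alpha>: "\<alpha> \<in> cocycles G" and g: "g \<in> carrier G"
  shows "character_on G {b \<in> carrier G. b \<otimes> g = g \<otimes> b} (\<lambda>b. \<alpha> (g, b) / \<alpha> (b, g))"
proof (rule character_onI)
  fix b c assume "b \<in> {b \<in> carrier G. b \<otimes> g = g \<otimes> b}" "c \<in> {b \<in> carrier G. b \<otimes> g = g \<otimes> b}"
  then have b: "b \<in> carrier G" "b \<otimes> g = g \<otimes> b" and c: "c \<in> carrier G" "c \<otimes> g = g \<otimes> c" by auto
  note nz = cocycle_nonzero[OF \<alpha>]
  have 1: "\<alpha> (g, b) * \<alpha> (g \<otimes> b, c) = \<alpha> (g, b \<otimes> c) * \<alpha> (b, c)" using cocycle_eq[OF \<alpha> g b(1) c(1)] .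
  have 2: "\<alpha> (b, g) * \<alpha> (g \<otimes> b, c) = \<alpha> (b, g \<otimes> c) * \<alpha> (g, c)" using cocycle_eq[OF \<alpha> b(1) g c(1)] b by simp
  have 3: "\<alpha> (b, c) * \<alpha> (b \<otimes> c, g) = \<alpha> (b, g \<otimes> c) * \<alpha> (c, g)" using cocycle_eq[OF \<alpha> b(1) c(1) g] c by simp
  have "\<alpha> (g, b \<otimes> c) * \<alpha> (b, g) * \<alpha> (c, g) * \<alpha> (b, c) = (\<alpha> (g, b \<otimes> c) * \<alpha> (b, c)) * \<alpha> (b, g) * \<alpha> (c, g)"
    by (simp only: mult_ac)
  also have "\<dots> = \<alpha> (g, b) * (\<alpha> (b, g) * \<alpha> (g \<otimes> b, c)) * \<alpha> (c, g)" unfolding 1[symmetric] by (simp only: mult_ac)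
  also have "\<dots> = \<alpha> (g, b) * \<alpha> (g, c) * (\<alpha> (b, g \<otimes> c) * \<alpha> (c, g))" unfolding 2 by (simp only: mult_ac)
  also have "\<dots> = \<alpha> (b \<otimes> c, g) * \<alpha> (g, b) * \<alpha> (g, c) * \<alpha> (b, c)" unfolding 3[symmetric] by (simp only: mult_ac)
  finally have "\<alpha> (g, b \<otimes> c) * \<alpha> (b, g) * \<alpha> (c, g) = \<alpha> (b \<otimes> c, g) * \<alpha> (g, b) * \<alpha> (g, c)"
    using nz[OF b(1) c(1)] by simp
  then show "\<alpha> (g, b \<otimes> c) / \<alpha> (b \<otimes> c, g) = \<alpha> (g, b) / \<alpha> (b, g) * (\<alpha> (g, c) / \<alpha> (c, g))"
    using nz b c g by (simp add: frac_eq_eq mult_ac)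
qed (use cocycle_nonzero[OF \<alpha>] g in auto)

lemma character_on_commutator:
  assumes "subgroup N G" "character_on G N \<chi>" "a \<in> N" "b \<in> N"
  shows "\<chi> (commutator G a b) = 1"
proof -
  note cl = subgroup.m_closed[OF assms(1)] subgroup.m_inv_closed[OF assms(1)]
  have "\<chi> (commutator G a b) = \<chi> a * \<chi> b * inverse (\<chi> a) * inverse (\<chi> b)"
    unfolding commutator_def using assms cl
    by (simp add: character_on_mult[OF assms(2)] character_on_inv[OF assms(1,2)])
  then show ?thesis using character_on_nonzero[OF assms(2)] assms(3,4) by (simp add: field_simps)
qed

end

context central_commutator_group
begin

text \<open>Cocycles pulled back from G/Z: by \<open>inflated_left\<close> the normalization on
  central arguments already forces constancy on cosets.\<close>

definition inflated :: "('a \<times> 'a \<Rightarrow> complex) set" where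
  "inflated = {\<alpha> \<in> cocycles G. \<forall>z\<in>Z. \<forall>g\<in>carrier G. \<alpha> (z, g) = 1 \<and> \<alpha> (g, z) = 1}"

lemma inflated_cocycle: "\<alpha> \<in> inflated \<Longrightarrow> \<alpha> \<in> cocycles G" by (simp add: inflated_def)

lemma inflated_left:
  assumes "\<alpha> \<in> inflated" "g \<in> carrier G" "h \<in> carrier G" "z \<in> Z"
  shows "\<alpha> (g, h \<otimes> z) = \<alpha> (g, h)" "\<alpha> (g \<otimes> z, h) = \<alpha> (g, h)"
proof -
  have z: "z \<in> carrier G" using assms Z_carrier by blast
  have c: "\<alpha> \<in> cocycles G" using assms(1) by (rule inflated_cocycle)
  have t: "\<alpha> (z, k) = 1" "\<alpha> (k, z) = 1" if "k \<in> carrier G" for k using assms that by (auto simp: inflated_def)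
  show 1: "\<alpha> (g, h \<otimes> z) = \<alpha> (g, h)" using cocycle_eq[OF c assms(2,3) z] assms t by simp
  have "\<alpha> (g \<otimes> z, h) = \<alpha> (g, z \<otimes> h)" using cocycle_eq[OF c assms(2) z assms(3)] assms t by simp
  then show "\<alpha> (g \<otimes> z, h) = \<alpha> (g, h)" using 1 Z_comm[OF assms(4,3)] by simp
qed

text \<open>The centre is cyclic, so the restricted cocycle is a coboundary; periodicity turns the
  function of exponents into a function on the centre.\<close>

lemma cocycle_on_center:
  assumes \<alpha>: "\<alpha> \<in> cocycles G"
  obtains F where "\<And>z. z \<in> Z \<Longrightarrow> F z \<noteq> 0" "\<And>z w. z \<in> Z \<Longrightarrow> w \<in> Z \<Longrightarrow> F (z \<otimes> w) = F z * F w * \<alpha> (z, w)"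
proof -
  obtain x where x: "x \<in> Z" "x \<noteq> \<one>" by (rule Z_ne_trivial)
  have xc: "x \<in> carrier G" using x Z_carrier by blast
  have "p > 0" using p_gt_1 by simp
  then obtain P where P: "\<And>i. P i \<noteq> 0" "\<And>i. P (i + p) = P i" "\<And>i j. P (i + j) = P i * P j * \<alpha> (x [^] i, x [^] j)"
    using cocycle_on_powers[OF \<alpha> xc Z_pow_p[OF x(1)]] by blast
  have per: "P (i + p * k) = P i" for i k
  proof (induction k)
    case (Suc k)
    have "P (i + p * Suc k) = P (i + p * k + p)" by (simp add: algebra_simps)
    then show ?case using Suc P(2) by simp
  qed simp
  have le: "P i = P j" if "i \<le> j" "x [^] i = x [^] j" for i j :: nat
  proof -
    have "p dvd j - i" using Z_pow_eq_dvd[OF x that] .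
    then obtain k where "j - i = p * k" by blast
    then have "j = i + p * k" using that by simp
    then show ?thesis using per by simp
  qed
  have eq: "P i = P j" if "x [^] i = x [^] j" for i j :: nat
    using le[of i j] le[of j i] that by (metis nat_le_linear)
  define F where "F z = P (SOME i. z = x [^] (i::nat))" for z
  have F: "F (x [^] i) = P i" for i :: nat
  proof -
    have "x [^] i = x [^] (SOME j. x [^] i = x [^] (j::nat))" by (rule someI[of _ i]) simp
    then show ?thesis unfolding F_def by (metis eq)
  qed
  have pw: "\<exists>i::nat. z = x [^] i" if "z \<in> Z" for z
  proof -
    have "z \<in> (\<lambda>i::nat. x [^] i) ` {..<p}" using that Z_eq_powers[OF x] by metis
    then show ?thesis by blast
  qed
  show ?thesis
  proof (rule that[of F])
    fix z assume "z \<in> Z"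
    obtain i where i: "z = x [^] (i::nat)" using pw[OF \<open>z \<in> Z\<close>] ..
    show "F z \<noteq> 0" unfolding i F by (rule P(1))
  next
    fix z w assume "z \<in> Z" "w \<in> Z"
    obtain i where i: "z = x [^] (i::nat)" using pw[OF \<open>z \<in> Z\<close>] ..
    obtain j where j: "w = x [^] (j::nat)" using pw[OF \<open>w \<in> Z\<close>] ..
    show "F (z \<otimes> w) = F z * F w * \<alpha> (z, w)" unfolding i j nat_pow_mult[OF xc] F by (rule P(3))
  qed
qed

text \<open>A trivialization on the centre is extended along coset representatives so that
  \<open>F_mult\<close> holds for every g and every central z. The coboundary of \<open>F\<close>
  then makes \<alpha> trivial at (g, z), and the symmetry hypothesis deals with (z, g).\<close>

lemma cohomologous_to_inflated:
  assumes \<alpha>: "\<alpha> \<in> cocycles G" and sym: "\<And>z g. z \<in> Z \<Longrightarrow> g \<in> carrier G \<Longrightarrow> \<alpha> (z, g) = \<alpha> (g, z)"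
  obtains f \<beta> where "f \<in> carrier G \<rightarrow> UNIV - {0}" "\<beta> \<in> inflated" "\<alpha> = coboundary G f \<otimes>\<^bsub>cocycle_group G\<^esub> \<beta>"
proof -
  obtain F0 where F0: "\<And>z. z \<in> Z \<Longrightarrow> F0 z \<noteq> 0" "\<And>z w. z \<in> Z \<Longrightarrow> w \<in> Z \<Longrightarrow> F0 (z \<otimes> w) = F0 z * F0 w * \<alpha> (z, w)"
    using cocycle_on_center[OF \<alpha>] by blast
  define rep where "rep g = (SOME t. t \<in> carrier G \<and> (\<exists>z\<in>Z. g = t \<otimes> z))" for g
  have rep: "rep g \<in> carrier G \<and> (\<exists>z\<in>Z. g = rep g \<otimes> z)" if "g \<in> carrier G" for g
  proof -
    have "\<exists>t. t \<in> carrier G \<and> (\<exists>z\<in>Z. g = t \<otimes> z)" using that Z_one by (metis r_one)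
    then show ?thesis unfolding rep_def by (rule someI_ex)
  qed
  have rep_mult: "rep (g \<otimes> z) = rep g" if "g \<in> carrier G" "z \<in> Z" for g z
  proof -
    have "(\<exists>w\<in>Z. g \<otimes> z = t \<otimes> w) \<longleftrightarrow> (\<exists>w\<in>Z. g = t \<otimes> w)" if t: "t \<in> carrier G" for t
    proof
      assume "\<exists>w\<in>Z. g \<otimes> z = t \<otimes> w"
      then obtain w where w: "w \<in> Z" "g \<otimes> z = t \<otimes> w" by blast
      have "g = t \<otimes> w \<otimes> inv z" using w \<open>g \<in> carrier G\<close> \<open>z \<in> Z\<close> Z_carrier by (simp add: m_assoc flip: w(2))
      then have "g = t \<otimes> (w \<otimes> inv z)" using w t \<open>z \<in> Z\<close> Z_carrier by (simp add: m_assoc)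
      then show "\<exists>w\<in>Z. g = t \<otimes> w" using w \<open>z \<in> Z\<close> Z_mult Z_inv by blast
    next
      assume "\<exists>w\<in>Z. g = t \<otimes> w"
      then obtain w where w: "w \<in> Z" "g = t \<otimes> w" by blast
      then have "g \<otimes> z = t \<otimes> (w \<otimes> z)" using t \<open>z \<in> Z\<close> Z_carrier by (simp add: m_assoc)
      then show "\<exists>w\<in>Z. g \<otimes> z = t \<otimes> w" using w \<open>z \<in> Z\<close> Z_mult by blast
    qed
    then show ?thesis unfolding rep_def by (metis (no_types, lifting))
  qed
  \<comment> \<open>Central elements keep the value of \<open>F0\<close>: the formula with a
    representative would differ there by a constant factor, and \<open>F_mult\<close> involves
    \<open>F z\<close> itself.\<close>
  define F where "F g = (if g \<in> Z then F0 g else F0 (inv (rep g) \<otimes> g) * \<alpha> (rep g, inv (rep g) \<otimes> g))" for g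
  have repZ: "inv (rep g) \<otimes> g \<in> Z" "rep g \<otimes> (inv (rep g) \<otimes> g) = g" "rep g \<in> carrier G" if g: "g \<in> carrier G" for g
  proof -
    obtain z where z: "z \<in> Z" "g = rep g \<otimes> z" "rep g \<in> carrier G" using rep[OF g] by blast
    have "inv (rep g) \<otimes> g = inv (rep g) \<otimes> (rep g \<otimes> z)"
      by (rule arg_cong[OF z(2)])
    also have "\<dots> = z" using z(3) Z_carrier[OF z(1)] by (simp add: m_assoc[symmetric])
    finally show "inv (rep g) \<otimes> g \<in> Z" using z(1) by simp
    show "rep g \<otimes> (inv (rep g) \<otimes> g) = g" using z(3) g by (simp add: m_assoc[symmetric])
    show "rep g \<in> carrier G" by (rule z(3))
  qed
  have F_nz: "F g \<noteq> 0" if "g \<in> carrier G" for g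
    using F0(1) cocycle_nonzero[OF \<alpha>] repZ[OF that] Z_carrier by (simp add: F_def)
  have F_mult: "F (g \<otimes> z) = F g * F z * \<alpha> (g, z)" if g: "g \<in> carrier G" and z: "z \<in> Z" for g z
  proof (cases "g \<in> Z")
    case True
    then show ?thesis using F0(2) z Z_mult by (simp add: F_def)
  next
    case False
    then have nz: "g \<otimes> z \<notin> Z" using Z_mult_right_iff[OF z g] by simp
    define t where "t = rep g"
    define w where "w = inv t \<otimes> g"
    have zc: "z \<in> carrier G" using z Z_carrier by blast
    have t: "t \<in> carrier G" "w \<in> Z" "t \<otimes> w = g" using repZ[OF g] by (simp_all add: t_def w_def)
    have wc: "w \<in> carrier G" using t Z_carrier by blast
    have "inv t \<otimes> (g \<otimes> z) = w \<otimes> z" unfolding w_def using t g zc by (simp add: m_assoc)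
    then have "F (g \<otimes> z) = F0 (w \<otimes> z) * \<alpha> (t, w \<otimes> z)"
      using nz rep_mult[OF g z] by (simp add: F_def flip: t_def)
    also have "\<dots> = F0 w * F0 z * (\<alpha> (t, w \<otimes> z) * \<alpha> (w, z))" using F0(2)[OF t(2) z] by simp
    also have "\<dots> = (F0 w * \<alpha> (t, w)) * F0 z * \<alpha> (g, z)"
      using cocycle_eq[OF \<alpha> t(1) wc zc] t(3) by simp
    finally show ?thesis using False z by (simp add: F_def flip: t_def w_def)
  qed
  define \<beta> where "\<beta> = coboundary G F \<otimes>\<^bsub>cocycle_group G\<^esub> \<alpha>"
  have Fp: "F \<in> carrier G \<rightarrow> UNIV - {0}" and Fi: "(\<lambda>g. inverse (F g)) \<in> carrier G \<rightarrow> UNIV - {0}"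
    using F_nz by auto
  interpret ZG: comm_group "cocycle_group G" by (rule cocycle_group_comm_group) unfold_locales
  have cg: "carrier (cocycle_group G) = cocycles G" by (simp add: cocycle_group_def)
  have \<beta>c: "\<beta> \<in> cocycles G"
    using ZG.m_closed[of "coboundary G F" \<alpha>] coboundary_in_cocycles[OF is_group Fp] \<alpha> by (simp add: cg \<beta>_def)
  have \<beta>: "\<beta> (g, h) = F g * F h / F (g \<otimes> h) * \<alpha> (g, h)" if "g \<in> carrier G" "h \<in> carrier G" for g h
    using that by (simp add: \<beta>_def cocycle_group_mult coboundary_apply)
  have "\<beta> (g, z) = 1" if "g \<in> carrier G" "z \<in> Z" for g z
    using \<beta>[of g z] F_mult[OF that] that Z_carrier[of z] F_nz cocycle_nonzero[OF \<alpha>] by simp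
  moreover have "\<beta> (z, g) = \<beta> (g, z)" if "g \<in> carrier G" "z \<in> Z" for g z
    using \<beta> that Z_carrier[of z] sym[OF that(2,1)] Z_comm[OF that(2,1)] by (simp add: mult_ac)
  ultimately have "\<beta> \<in> inflated" using \<beta>c by (simp add: inflated_def)
  moreover have "\<alpha> = coboundary G (\<lambda>g. inverse (F g)) \<otimes>\<^bsub>cocycle_group G\<^esub> \<beta>"
  proof (rule cocycle_eqI[OF \<alpha>])
    show "coboundary G (\<lambda>g. inverse (F g)) \<otimes>\<^bsub>cocycle_group G\<^esub> \<beta> \<in> cocycles G"
      using ZG.m_closed[of _ \<beta>] coboundary_in_cocycles[OF is_group Fi] \<beta>c by (simp add: cg)
    fix g h assume "g \<in> carrier G" "h \<in> carrier G"
    then show "\<alpha> (g, h) = (coboundary G (\<lambda>g. inverse (F g)) \<otimes>\<^bsub>cocycle_group G\<^esub> \<beta>) (g, h)"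
      using F_nz by (simp add: cocycle_group_mult coboundary_apply \<beta> field_simps)
  qed
  ultimately show ?thesis using that Fi by blast
qed

text \<open>The centralizer is the kernel of a character with at most p values; \<open>s\<close>
  picks an element for each value, and dividing by it lands in the kernel.\<close>

lemma card_le_p_card_centralizer:
  assumes g: "g \<in> carrier G"
  shows "card (carrier G) \<le> p * card {b \<in> carrier G. om g b = 1}"
proof -
  let ?C = "{b \<in> carrier G. om g b = 1}"
  define s where "s c = (SOME h. h \<in> carrier G \<and> om g h = c)" for c
  have s: "s (om g h) \<in> carrier G \<and> om g (s (om g h)) = om g h" if "h \<in> carrier G" for h
    unfolding s_def by (rule someI[of _ h]) (use that in simp)
  have "inj_on (\<lambda>h. (om g h, h \<otimes> inv (s (om g h)))) (carrier G)"
  proof (rule inj_onI)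
    fix h k assume hk: "h \<in> carrier G" "k \<in> carrier G"
      "(om g h, h \<otimes> inv (s (om g h))) = (om g k, k \<otimes> inv (s (om g k)))"
    then have "h \<otimes> inv (s (om g k)) = k \<otimes> inv (s (om g k))" by (metis Pair_inject)
    then show "h = k" using s[OF hk(2)] hk(1,2) by simp
  qed
  moreover have "(\<lambda>h. (om g h, h \<otimes> inv (s (om g h)))) ` carrier G \<subseteq> zchar ` Z \<times> ?C"
  proof (rule image_subsetI)
    fix h assume h: "h \<in> carrier G"
    have "om g (inv (s (om g h))) = inverse (om g h)"
      using character_on_inv[OF subgroup_self om_character_right[OF g]] s[OF h] by simp
    then have "om g (h \<otimes> inv (s (om g h))) = 1"
      using om_mult_right[OF g h] s[OF h] om_nonzero[OF g h] by simp
    then show "(om g h, h \<otimes> inv (s (om g h))) \<in> zchar ` Z \<times> ?C"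
      using s[OF h] h commutator_in_center[OF g h] by (simp add: om_def)
  qed
  moreover have "finite (zchar ` Z \<times> ?C)" using finite_Z finite_carrier by simp
  ultimately have "card (carrier G) \<le> card (zchar ` Z \<times> ?C)" by (rule card_inj_on_le)
  also have "\<dots> = card (zchar ` Z) * card ?C" by (rule card_cartesian_product)
  also have "\<dots> \<le> p * card ?C" using card_image_le[OF finite_Z, of zchar] card_center by simp
  finally show ?thesis .
qed

text \<open>If the centralizer C were abelian, it would lie in its own orthogonal complement, and
  \<open>card_representing\<close> would give card C ^ 2 \<le> p * card G. As card G \<le> p * card
  C, the order of the group would be at most p^3.\<close>

lemma centralizer_nonabelian:
  assumes big: "card (carrier G) > p ^ 3" and g: "g \<in> carrier G"
  obtains a b where "a \<in> carrier G" "b \<in> carrier G" "om g a = 1" "om g b = 1" "om a b \<noteq> 1"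
proof (rule ccontr)
  note witness = that
  assume no: "\<not> thesis"
  let ?C = "{b \<in> carrier G. om g b = 1}"
  have ab: "om a b = 1" if "a \<in> ?C" "b \<in> ?C" for a b using that witness no by blast
  have "?C = {b \<in> carrier G. b \<otimes> g = g \<otimes> b}" using om_eq_1_iff[OF g] by auto
  then have C: "subgroup ?C G" using subgroup_centralizer[OF g] by simp
  have "card ?C * card {y \<in> carrier G. \<forall>r\<in>?C. om r y = 1} = card {r \<in> ?C. r \<in> Z} * card (carrier G)"
    by (rule card_representing[OF is_group C finite_subgroup[OF C], where \<pi> = "\<lambda>r. r" and f = "\<lambda>_. 1"])
       (auto intro: character_onI)
  moreover have "card ?C \<le> card {y \<in> carrier G. \<forall>r\<in>?C. om r y = 1}"
    using ab finite_carrier by (intro card_mono) auto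
  moreover have "card {r \<in> ?C. r \<in> Z} \<le> p"
    unfolding card_center[symmetric] using finite_Z by (intro card_mono) auto
  ultimately have CC: "card ?C * card ?C \<le> p * card (carrier G)"
    using mult_le_mono2[of "card ?C" "card {y \<in> carrier G. \<forall>r\<in>?C. om r y = 1}" "card ?C"]
      mult_le_mono1[of "card {r \<in> ?C. r \<in> Z}" p "card (carrier G)"] by linarith
  have "card (carrier G) * card (carrier G) \<le> (p * card ?C) * (p * card ?C)"
    using card_le_p_card_centralizer[OF g] by (intro mult_le_mono)
  also have "\<dots> = p * p * (card ?C * card ?C)" by (simp only: mult_ac)
  also have "\<dots> \<le> p * p * (p * card (carrier G))" using CC by (rule mult_le_mono2)
  also have "\<dots> = p ^ 3 * card (carrier G)" by (simp add: power3_eq_cube)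
  finally have "card (carrier G) \<le> p ^ 3" using big by simp
  then show False using big by simp
qed

text \<open>The pairing of the centre with \<open>g\<close> is a character of the centralizer of \<open>g\<close>, so it vanishes on
  commutators of elements commuting with \<open>g\<close>.  Such commutators exhaust the centre, as the centralizer
  is not abelian.\<close>

lemma cocycle_center_symmetric:
  assumes big: "card (carrier G) > p ^ 3" and \<alpha>: "\<alpha> \<in> cocycles G" and z: "z \<in> Z" and g: "g \<in> carrier G"
  shows "\<alpha> (z, g) = \<alpha> (g, z)"
proof -
  let ?C = "{b \<in> carrier G. b \<otimes> g = g \<otimes> b}" and ?\<chi> = "\<lambda>b. \<alpha> (g, b) / \<alpha> (b, g)"
  note C = subgroup_centralizer[OF g] and \<chi> = cocycle_pairing_character[OF \<alpha> g]
  obtain a b where ab: "a \<in> carrier G" "b \<in> carrier G" "om g a = 1" "om g b = 1" "om a b \<noteq> 1"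
    using centralizer_nonabelian[OF big g] by blast
  then have "a \<in> ?C" "b \<in> ?C" using om_eq_1_iff[OF g] by auto
  define w where "w = commutator G a b"
  have w: "w \<in> Z" "w \<noteq> \<one>"
    using ab commutator_in_center[of a b] zchar_eq_1_iff[of w] by (auto simp: om_def w_def)
  have "?\<chi> w = 1" unfolding w_def by (rule character_on_commutator[OF C \<chi>]) fact+
  have "z \<in> (\<lambda>i::nat. w [^] i) ` {..<p}" using z Z_eq_powers[OF w] by metis
  then obtain i where i: "z = w [^] (i::nat)" by blast
  have "w \<in> ?C" using w Z_comm g Z_carrier by blast
  then have "?\<chi> z = ?\<chi> w ^ i" unfolding i by (rule character_on_nat_pow[OF C \<chi>])
  also have "\<dots> = 1" unfolding \<open>?\<chi> w = 1\<close> by simp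
  finally have "\<alpha> (g, z) / \<alpha> (z, g) = 1" .
  then show ?thesis using cocycle_nonzero[OF \<alpha> Z_carrier[OF z] g] by (simp add: field_simps)
qed

end

text \<open>The exponents -1 and 1 in \<open>\<Lambda>_center\<close> are chosen so that f g *
  \<Lambda> (g, h) ^ j does not change when g is multiplied by a central element, for every f that
  restricts to \<open>zchar ^ j\<close> on the centre and satisfies f (g z) = f g * f z for central
  z.\<close>

locale full_isometry = central_commutator_pair G H p
  for G :: "('a, 'm) monoid_scheme" and H :: "('b, 'n) monoid_scheme" and p +
  fixes R :: "('a \<times> 'b) set" and \<Lambda> :: "'a \<times> 'b \<Rightarrow> complex"
  assumes R: "partial_isometry G H R"
    and R_fst: "fst ` R = carrier G" and R_snd: "snd ` R = carrier H"
    and \<Lambda>: "character_on L R \<Lambda>"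
    and \<Lambda>_center: "z \<in> G.Z \<Longrightarrow> w \<in> H.Z \<Longrightarrow> \<Lambda> (z, w) = inverse (G.zchar z) * H.zchar w"
begin

section \<open>Transport of inflated cocycles along an isometry\<close>

lemma R_carrier: "(g, h) \<in> R \<Longrightarrow> g \<in> carrier G" "(g, h) \<in> R \<Longrightarrow> h \<in> carrier H"
  using isometry_fst[OF R] isometry_snd[OF R] by force+

lemma R_mult: "(g, h) \<in> R \<Longrightarrow> (g', h') \<in> R \<Longrightarrow> (g \<otimes>\<^bsub>G\<^esub> g', h \<otimes>\<^bsub>H\<^esub> h') \<in> R"
  using isometry_mult[OF R, of "(g, h)" "(g', h')"] by simp

lemma R_inv: "(g, h) \<in> R \<Longrightarrow> (inv\<^bsub>G\<^esub> g, inv\<^bsub>H\<^esub> h) \<in> R"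
  using isometry_inv[OF R, of "(g, h)"] by simp

lemma R_center: "z \<in> G.Z \<Longrightarrow> w \<in> H.Z \<Longrightarrow> (z, w) \<in> R"
  using isometry_center[OF R] .

lemma R_mult_center:
  assumes "(g, h) \<in> R" shows "z \<in> G.Z \<Longrightarrow> (g \<otimes>\<^bsub>G\<^esub> z, h) \<in> R" "w \<in> H.Z \<Longrightarrow> (g, h \<otimes>\<^bsub>H\<^esub> w) \<in> R"
  using R_mult[OF assms R_center[OF _ H.Z_one]] R_mult[OF assms R_center[OF G.Z_one]] R_carrier[OF assms]
  by (metis H.r_one, metis G.r_one)

lemma R_center_iff: "(g, h) \<in> R \<Longrightarrow> g \<in> G.Z \<longleftrightarrow> h \<in> H.Z"
  using isometry_center_iff[OF R, of "(g, h)"] by simp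

lemma \<Lambda>_mult: "(g, h) \<in> R \<Longrightarrow> (g', h') \<in> R \<Longrightarrow> \<Lambda> (g \<otimes>\<^bsub>G\<^esub> g', h \<otimes>\<^bsub>H\<^esub> h') = \<Lambda> (g, h) * \<Lambda> (g', h')"
  using character_on_mult[OF \<Lambda>, of "(g, h)" "(g', h')"] by (simp add: L_mult)

lemma \<Lambda>_nonzero: "(g, h) \<in> R \<Longrightarrow> \<Lambda> (g, h) \<noteq> 0"
  using character_on_nonzero[OF \<Lambda>] .

lemma G_zchar_nonzero: "z \<in> G.Z \<Longrightarrow> G.zchar z \<noteq> 0" using character_on_nonzero[OF G.zchar_character] .

lemma \<Lambda>_mult_center:
  assumes "(g, h) \<in> R"
  shows "z \<in> G.Z \<Longrightarrow> \<Lambda> (g \<otimes>\<^bsub>G\<^esub> z, h) = \<Lambda> (g, h) * inverse (G.zchar z)"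
    "w \<in> H.Z \<Longrightarrow> \<Lambda> (g, h \<otimes>\<^bsub>H\<^esub> w) = \<Lambda> (g, h) * H.zchar w"
proof -
  have 1: "G.zchar \<one>\<^bsub>G\<^esub> = 1" "H.zchar \<one>\<^bsub>H\<^esub> = 1"
    using G.character_on_one[OF G.Z_subgroup G.zchar_character] H.character_on_one[OF H.Z_subgroup H.zchar_character] .
  show "\<Lambda> (g \<otimes>\<^bsub>G\<^esub> z, h) = \<Lambda> (g, h) * inverse (G.zchar z)" if "z \<in> G.Z"
    using \<Lambda>_mult[OF assms R_center[OF that H.Z_one]] \<Lambda>_center[OF that H.Z_one] R_carrier[OF assms] 1 by simp
  show "\<Lambda> (g, h \<otimes>\<^bsub>H\<^esub> w) = \<Lambda> (g, h) * H.zchar w" if "w \<in> H.Z"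
    using \<Lambda>_mult[OF assms R_center[OF G.Z_one that]] \<Lambda>_center[OF G.Z_one that] R_carrier[OF assms] 1 by simp
qed

text \<open>Interchanging the groups inverts \<Lambda>. The inverse directions for
  \<open>transport\<close> and \<open>kern\<close> come from this symmetry.\<close>

lemma swap_full_isometry: "full_isometry H G p (prod.swap ` R) (\<lambda>r. inverse (\<Lambda> (prod.swap r)))"
proof -
  interpret sw: central_commutator_pair H G p by (rule swap_pair)
  show ?thesis
  proof
    show "partial_isometry H G (prod.swap ` R)" by (rule partial_isometry_swap[OF R])
    show "fst ` prod.swap ` R = carrier H" "snd ` prod.swap ` R = carrier G"
      using R_fst R_snd by (simp_all add: image_image)
    show "character_on sw.L (prod.swap ` R) (\<lambda>r. inverse (\<Lambda> (prod.swap r)))"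
      by (rule character_onI) (auto simp: sw.L_mult \<Lambda>_mult \<Lambda>_nonzero)
    show "inverse (\<Lambda> (prod.swap (w, z))) = inverse (H.zchar w) * G.zchar z" if "w \<in> H.Z" "z \<in> G.Z" for w z
      using \<Lambda>_center that by simp
  qed
qed

lemma same_snd:
  assumes "(g, h) \<in> R" "(g', h) \<in> R"
  obtains z where "z \<in> G.Z" "g' = g \<otimes>\<^bsub>G\<^esub> z"
proof -
  have gc: "g \<in> carrier G" "g' \<in> carrier G" "h \<in> carrier H" using assms R_carrier by blast+
  have "(inv\<^bsub>G\<^esub> g \<otimes>\<^bsub>G\<^esub> g', \<one>\<^bsub>H\<^esub>) \<in> R" using R_mult[OF R_inv[OF assms(1)] assms(2)] gc by simp
  then have "inv\<^bsub>G\<^esub> g \<otimes>\<^bsub>G\<^esub> g' \<in> G.Z" using R_center_iff H.Z_one by blast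
  moreover have "g' = g \<otimes>\<^bsub>G\<^esub> (inv\<^bsub>G\<^esub> g \<otimes>\<^bsub>G\<^esub> g')" using gc by (simp add: G.m_assoc[symmetric])
  ultimately show ?thesis by (rule that)
qed

text \<open>A choice of partner, unique only up to the centre; \<open>transport_eq\<close> shows
  that inflated cocycles do not notice it.\<close>

definition pre :: "'b \<Rightarrow> 'a" where "pre h = (SOME g. (g, h) \<in> R)"

lemma pre_R: "h \<in> carrier H \<Longrightarrow> (pre h, h) \<in> R"
  unfolding pre_def using R_snd by (metis (mono_tags, lifting) imageE prod.collapse someI_ex)

definition transport :: "('a \<times> 'a \<Rightarrow> complex) \<Rightarrow> 'b \<times> 'b \<Rightarrow> complex" where
  "transport \<alpha> = (\<lambda>(h, k) \<in> carrier H \<times> carrier H. \<alpha> (pre h, pre k))"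

lemma transport_eq:
  assumes "\<alpha> \<in> G.inflated" "(g, h) \<in> R" "(g', h') \<in> R"
  shows "transport \<alpha> (h, h') = \<alpha> (g, g')"
proof -
  note c = R_carrier[OF assms(2)] R_carrier[OF assms(3)]
  obtain z where z: "z \<in> G.Z" "pre h = g \<otimes>\<^bsub>G\<^esub> z" using same_snd[OF assms(2) pre_R[OF c(2)]] .
  obtain w where w: "w \<in> G.Z" "pre h' = g' \<otimes>\<^bsub>G\<^esub> w" using same_snd[OF assms(3) pre_R[OF c(4)]] .
  have "transport \<alpha> (h, h') = \<alpha> (g \<otimes>\<^bsub>G\<^esub> z, g' \<otimes>\<^bsub>G\<^esub> w)" using c z w by (simp add: transport_def)
  also have "\<dots> = \<alpha> (g, g' \<otimes>\<^bsub>G\<^esub> w)" using G.inflated_left(2)[OF assms(1) c(1) _ z(1)] c w G.Z_carrier by simp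
  also have "\<dots> = \<alpha> (g, g')" using G.inflated_left(1)[OF assms(1) c(1,3) w(1)] .
  finally show ?thesis .
qed

lemma transport_inflated:
  assumes "\<alpha> \<in> G.inflated" shows "transport \<alpha> \<in> H.inflated"
proof -
  have \<alpha>: "\<alpha> \<in> cocycles G" using assms by (rule G.inflated_cocycle)
  have "(\<lambda>(h, k) \<in> carrier H \<times> carrier H. transport \<alpha> (h, k)) \<in> cocycles H"
  proof (rule cocyclesI)
    fix g h assume "g \<in> carrier H" "h \<in> carrier H"
    then show "transport \<alpha> (g, h) \<noteq> 0"
      using transport_eq[OF assms pre_R pre_R] cocycle_nonzero[OF \<alpha>] R_carrier(1)[OF pre_R] by simp
  next
    fix g h k assume "g \<in> carrier H" "h \<in> carrier H" "k \<in> carrier H"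
    then have r: "(pre g, g) \<in> R" "(pre h, h) \<in> R" "(pre k, k) \<in> R" using pre_R by auto
    show "transport \<alpha> (g, h) * transport \<alpha> (g \<otimes>\<^bsub>H\<^esub> h, k) = transport \<alpha> (g, h \<otimes>\<^bsub>H\<^esub> k) * transport \<alpha> (h, k)"
      using transport_eq[OF assms r(1,2)] transport_eq[OF assms R_mult[OF r(1,2)] r(3)]
        transport_eq[OF assms r(1) R_mult[OF r(2,3)]] transport_eq[OF assms r(2,3)]
        cocycle_eq[OF \<alpha>, of "pre g" "pre h" "pre k"] R_carrier(1)[OF r(1)] R_carrier(1)[OF r(2)] R_carrier(1)[OF r(3)]
      by simp
  qed unfold_locales
  moreover have "(\<lambda>(h, k) \<in> carrier H \<times> carrier H. transport \<alpha> (h, k)) = transport \<alpha>"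
    by (auto simp: transport_def fun_eq_iff)
  moreover have "transport \<alpha> (w, h) = 1 \<and> transport \<alpha> (h, w) = 1" if "w \<in> H.Z" "h \<in> carrier H" for w h
    using transport_eq[OF assms R_center[OF G.Z_one that(1)] pre_R[OF that(2)]]
      transport_eq[OF assms pre_R[OF that(2)] R_center[OF G.Z_one that(1)]] assms G.Z_one
      R_carrier(1)[OF pre_R[OF that(2)]] by (simp add: G.inflated_def)
  ultimately show ?thesis by (simp add: H.inflated_def)
qed

lemma transport_mult:
  assumes "\<alpha> \<in> G.inflated" "\<beta> \<in> G.inflated"
  shows "transport (\<alpha> \<otimes>\<^bsub>cocycle_group G\<^esub> \<beta>) = transport \<alpha> \<otimes>\<^bsub>cocycle_group H\<^esub> transport \<beta>"
proof -
  have "pre h \<in> carrier G" if "h \<in> carrier H" for h using R_carrier(1)[OF pre_R[OF that]] .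
  then show ?thesis by (auto simp: transport_def cocycle_group_def fun_eq_iff)
qed

text \<open>A function with inflated coboundary need not be constant on cosets of the centre: it
  restricts to a character of the centre, hence to some \<open>zchar ^ j\<close>. Multiplication by
  \<Lambda> ^ j removes the dependence on the coset element without changing the coboundary, since
  \<Lambda> is multiplicative on \<open>R\<close>.\<close>

lemma transport_coboundary:
  assumes \<alpha>: "\<alpha> \<in> G.inflated" "\<alpha> \<in> coboundaries G"
  shows "transport \<alpha> \<in> coboundaries H"
proof -
  obtain f where f: "f \<in> carrier G \<rightarrow> UNIV - {0}" "\<alpha> = coboundary G f"
    using \<alpha>(2) by (auto simp: coboundaries_def)
  have nz: "f g \<noteq> 0" if "g \<in> carrier G" for g using f(1) that by auto
  have \<alpha>f: "\<alpha> (g, h) = f g * f h / f (g \<otimes>\<^bsub>G\<^esub> h)" if "g \<in> carrier G" "h \<in> carrier G" for g h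
    using that f(2) by (simp add: coboundary_apply)
  have fz: "f (g \<otimes>\<^bsub>G\<^esub> z) = f g * f z" if "g \<in> carrier G" "z \<in> G.Z" for g z
  proof -
    have "f g * f z / f (g \<otimes>\<^bsub>G\<^esub> z) = 1"
      using \<alpha>f[OF that(1) G.Z_carrier[OF that(2)]] \<alpha>(1) that by (simp add: G.inflated_def)
    then show ?thesis using nz that G.Z_carrier by (simp add: field_simps)
  qed
  have "character_on G G.Z f" using nz G.Z_carrier fz by (intro character_onI) auto
  then obtain j where j: "\<And>z. z \<in> G.Z \<Longrightarrow> f z = G.zchar z ^ j" using G.character_on_Z_eq_power by blast
  define f' where "f' h = f (pre h) * \<Lambda> (pre h, h) ^ j" for h
  have f': "f' h = f g * \<Lambda> (g, h) ^ j" if r: "(g, h) \<in> R" for g h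
  proof -
    obtain z where z: "z \<in> G.Z" "pre h = g \<otimes>\<^bsub>G\<^esub> z" using same_snd[OF r pre_R[OF R_carrier(2)[OF r]]] .
    show ?thesis unfolding f'_def z(2)
      using fz[OF R_carrier(1)[OF r] z(1)] j[OF z(1)] \<Lambda>_mult_center(1)[OF r z(1)] G_zchar_nonzero[OF z(1)]
      by (simp add: power_mult_distrib power_inverse)
  qed
  have f'_nz: "f' h \<noteq> 0" if "h \<in> carrier H" for h
    unfolding f'_def using nz R_carrier(1)[OF pre_R[OF that]] \<Lambda>_nonzero[OF pre_R[OF that]] by simp
  have "transport \<alpha> = coboundary H f'"
  proof (rule cocycle_eqI[where G = H])
    show "transport \<alpha> \<in> cocycles H" using transport_inflated[OF \<alpha>(1)] by (rule H.inflated_cocycle)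
    show "coboundary H f' \<in> cocycles H" using f'_nz by (intro coboundary_in_cocycles) (auto simp: H.is_group)
    fix h k assume hk: "h \<in> carrier H" "k \<in> carrier H"
    have r: "(pre h, h) \<in> R" "(pre k, k) \<in> R" using pre_R hk by auto
    have "coboundary H f' (h, k) = f (pre h) * f (pre k) / f (pre h \<otimes>\<^bsub>G\<^esub> pre k)"
      using f'[OF r(1)] f'[OF r(2)] f'[OF R_mult[OF r]] \<Lambda>_mult[OF r] hk \<Lambda>_nonzero[OF r(1)] \<Lambda>_nonzero[OF r(2)]
      by (simp add: coboundary_apply power_mult_distrib)
    then show "transport \<alpha> (h, k) = coboundary H f' (h, k)"
      using \<alpha>f[OF R_carrier(1)[OF r(1)] R_carrier(1)[OF r(2)]] transport_eq[OF \<alpha>(1) r] by simp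
  qed
  moreover have "f' \<in> carrier H \<rightarrow> UNIV - {0}" using f'_nz by auto
  ultimately show ?thesis by (auto simp: coboundaries_def)
qed

end

section \<open>The isomorphism of the second cohomology groups\<close>

context central_commutator_group
begin

lemma inflated_subgroup: "subgroup inflated (cocycle_group G)"
proof -
  interpret ZG: comm_group "cocycle_group G" by (rule cocycle_group_comm_group) unfold_locales
  have cg: "carrier (cocycle_group G) = cocycles G" by (simp add: cocycle_group_def)
  have one: "\<one>\<^bsub>cocycle_group G\<^esub> (g, h) = 1" if "g \<in> carrier G" "h \<in> carrier G" for g h
    using that by (simp add: cocycle_group_def)
  show ?thesis
  proof (rule ZG.subgroupI)
    show "inflated \<subseteq> carrier (cocycle_group G)" by (auto simp: cg inflated_def)
    have "\<one>\<^bsub>cocycle_group G\<^esub> \<in> inflated" using ZG.one_closed one Z_carrier by (simp add: inflated_def cg)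
    then show "inflated \<noteq> {}" by blast
  next
    fix \<alpha> assume \<alpha>: "\<alpha> \<in> inflated"
    then have c: "\<alpha> \<in> carrier (cocycle_group G)" by (simp add: cg inflated_def)
    let ?i = "inv\<^bsub>cocycle_group G\<^esub> \<alpha>"
    have i: "\<alpha> (g, h) * ?i (g, h) = 1" if "g \<in> carrier G" "h \<in> carrier G" for g h
      using ZG.r_inv[OF c] cocycle_group_mult[OF that, of \<alpha> ?i] one[OF that] by simp
    have "?i (z, g) = 1 \<and> ?i (g, z) = 1" if "z \<in> Z" "g \<in> carrier G" for z g
      using i[OF Z_carrier[OF that(1)] that(2)] i[OF that(2) Z_carrier[OF that(1)]] \<alpha> that
      by (simp add: inflated_def)
    then show "?i \<in> inflated" using ZG.inv_closed[OF c] by (simp add: inflated_def cg)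
  next
    fix \<alpha> \<beta> assume "\<alpha> \<in> inflated" "\<beta> \<in> inflated"
    then show "\<alpha> \<otimes>\<^bsub>cocycle_group G\<^esub> \<beta> \<in> inflated"
      using ZG.m_closed[of \<alpha> \<beta>] Z_carrier by (auto simp: inflated_def cg cocycle_group_mult)
  qed
qed

lemma class_eq_inflated:
  assumes big: "card (carrier G) > p ^ 3" and C: "C \<in> carrier (second_cohomology G)"
  obtains \<alpha> where "\<alpha> \<in> inflated" "C = coboundaries G #>\<^bsub>cocycle_group G\<^esub> \<alpha>"
proof -
  interpret ZG: comm_group "cocycle_group G" by (rule cocycle_group_comm_group) unfold_locales
  interpret B: normal "coboundaries G" "cocycle_group G" by (rule coboundaries_normal) unfold_locales
  obtain \<alpha> where \<alpha>: "\<alpha> \<in> carrier (cocycle_group G)" "C = coboundaries G #>\<^bsub>cocycle_group G\<^esub> \<alpha>"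
    using C by (auto simp: second_cohomology_def FactGroup_def RCOSETS_def)
  then have \<alpha>c: "\<alpha> \<in> cocycles G" by (simp add: cocycle_group_def)
  obtain f \<beta> where f: "f \<in> carrier G \<rightarrow> UNIV - {0}" and \<beta>: "\<beta> \<in> inflated"
    and eq: "\<alpha> = coboundary G f \<otimes>\<^bsub>cocycle_group G\<^esub> \<beta>"
    using cohomologous_to_inflated[OF \<alpha>c cocycle_center_symmetric[OF big \<alpha>c]] by blast
  have "\<beta> \<in> carrier (cocycle_group G)" using \<beta> by (simp add: inflated_def cocycle_group_def)
  moreover have "coboundary G f \<in> coboundaries G" using f by (auto simp: coboundaries_def)
  ultimately have "coboundaries G #>\<^bsub>cocycle_group G\<^esub> \<alpha> = coboundaries G #>\<^bsub>cocycle_group G\<^esub> \<beta>"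
    using ZG.coset_mult_assoc[of "coboundaries G" "coboundary G f" \<beta>] ZG.coset_join2[OF _ B.is_subgroup]
      B.mem_carrier B.subset eq by metis
  then show ?thesis using that[OF \<beta>] \<alpha>(2) by simp
qed

end

context full_isometry
begin

text \<open>Taking classes, directly or after transport, gives two surjections from the group of
  inflated cocycles. \<open>transport_coboundary\<close> in both directions shows that their kernels
  agree.\<close>

lemma second_cohomology_iso:
  assumes big: "card (carrier G) > p ^ 3"
  obtains \<psi> where "\<psi> \<in> iso (second_cohomology G) (second_cohomology H)"
    "\<And>\<alpha>. \<alpha> \<in> G.inflated \<Longrightarrow>
      \<psi> (coboundaries G #>\<^bsub>cocycle_group G\<^esub> \<alpha>) = coboundaries H #>\<^bsub>cocycle_group H\<^esub> transport \<alpha>"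
proof -
  interpret sw: full_isometry H G p "prod.swap ` R" "\<lambda>r. inverse (\<Lambda> (prod.swap r))"
    by (rule swap_full_isometry)
  interpret ZG: comm_group "cocycle_group G" by (rule cocycle_group_comm_group) unfold_locales
  interpret ZH: comm_group "cocycle_group H" by (rule cocycle_group_comm_group) unfold_locales
  interpret BG: normal "coboundaries G" "cocycle_group G" by (rule coboundaries_normal) unfold_locales
  interpret BH: normal "coboundaries H" "cocycle_group H" by (rule coboundaries_normal) unfold_locales
  let ?M = "cocycle_group G\<lparr>carrier := G.inflated\<rparr>"
  let ?\<pi> = "\<lambda>\<alpha>. coboundaries G #>\<^bsub>cocycle_group G\<^esub> \<alpha>"
  let ?\<rho> = "\<lambda>\<alpha>. coboundaries H #>\<^bsub>cocycle_group H\<^esub> transport \<alpha>"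
  have cG: "\<alpha> \<in> carrier (cocycle_group G)" if "\<alpha> \<in> G.inflated" for \<alpha>
    using that by (simp add: G.inflated_def cocycle_group_def)
  have cH: "\<beta> \<in> carrier (cocycle_group H)" if "\<beta> \<in> H.inflated" for \<beta>
    using that by (simp add: H.inflated_def cocycle_group_def)
  have roundtrip1: "transport (sw.transport \<beta>) = \<beta>" if \<beta>: "\<beta> \<in> H.inflated" for \<beta>
  proof (rule cocycle_eqI[where G = H])
    show "transport (sw.transport \<beta>) \<in> cocycles H"
      using transport_inflated[OF sw.transport_inflated[OF \<beta>]] by (rule H.inflated_cocycle)
    show "\<beta> \<in> cocycles H" using \<beta> by (rule H.inflated_cocycle)
    fix h k assume "h \<in> carrier H" "k \<in> carrier H"
    then have r: "(pre h, h) \<in> R" "(pre k, k) \<in> R" using pre_R by auto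
    then have r': "(h, pre h) \<in> prod.swap ` R" "(k, pre k) \<in> prod.swap ` R" by force+
    show "transport (sw.transport \<beta>) (h, k) = \<beta> (h, k)"
      using transport_eq[OF sw.transport_inflated[OF \<beta>] r] sw.transport_eq[OF \<beta> r'] by simp
  qed
  have roundtrip2: "sw.transport (transport \<alpha>) = \<alpha>" if \<alpha>: "\<alpha> \<in> G.inflated" for \<alpha>
  proof (rule cocycle_eqI[where G = G])
    show "sw.transport (transport \<alpha>) \<in> cocycles G"
      using sw.transport_inflated[OF transport_inflated[OF \<alpha>]] by (rule G.inflated_cocycle)
    show "\<alpha> \<in> cocycles G" using \<alpha> by (rule G.inflated_cocycle)
    fix g k assume "g \<in> carrier G" "k \<in> carrier G"
    then have r: "(sw.pre g, g) \<in> prod.swap ` R" "(sw.pre k, k) \<in> prod.swap ` R" using sw.pre_R by auto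
    then have r': "(g, sw.pre g) \<in> R" "(k, sw.pre k) \<in> R" by auto
    show "sw.transport (transport \<alpha>) (g, k) = \<alpha> (g, k)"
      using sw.transport_eq[OF transport_inflated[OF \<alpha>] r] transport_eq[OF \<alpha> r'] by simp
  qed
  have ker: "transport \<alpha> \<in> coboundaries H \<longleftrightarrow> \<alpha> \<in> coboundaries G" if "\<alpha> \<in> G.inflated" for \<alpha>
    using transport_coboundary[OF that] sw.transport_coboundary[OF transport_inflated[OF that]] roundtrip2[OF that] by metis
  have coset_one: "?\<pi> \<alpha> = coboundaries G \<longleftrightarrow> \<alpha> \<in> coboundaries G" if "\<alpha> \<in> G.inflated" for \<alpha>
    using ZG.coset_join1[OF _ cG[OF that] BG.is_subgroup] ZG.coset_join2[OF cG[OF that] BG.is_subgroup]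
      BG.subset by blast
  have coset_one': "?\<rho> \<alpha> = coboundaries H \<longleftrightarrow> transport \<alpha> \<in> coboundaries H" if "\<alpha> \<in> G.inflated" for \<alpha>
    using ZH.coset_join1[OF _ cH[OF transport_inflated[OF that]] BH.is_subgroup]
      ZH.coset_join2[OF cH[OF transport_inflated[OF that]] BH.is_subgroup] BH.subset by blast
  have bigH: "card (carrier H) > p ^ 3" using big card_eq by simp
  show ?thesis
  proof (rule same_kernel_iso[of ?M "second_cohomology G" "second_cohomology H" ?\<pi> ?\<rho>])
    show "group ?M" using G.inflated_subgroup by (rule subgroup.subgroup_is_group) unfold_locales
    show "group (second_cohomology G)" "group (second_cohomology H)"
      using BG.factorgroup_is_group BH.factorgroup_is_group by (simp_all add: second_cohomology_def)
    show "?\<pi> \<in> hom ?M (second_cohomology G)"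
      using cG BG.rcos_sum by (auto simp: hom_def second_cohomology_def FactGroup_def RCOSETS_def)
    show "?\<rho> \<in> hom ?M (second_cohomology H)"
      using cH transport_inflated transport_mult BH.rcos_sum
      by (auto simp: hom_def second_cohomology_def FactGroup_def RCOSETS_def)
    show "?\<pi> ` carrier ?M = carrier (second_cohomology G)"
    proof
      show "?\<pi> ` carrier ?M \<subseteq> carrier (second_cohomology G)"
        using cG by (auto simp: second_cohomology_def FactGroup_def RCOSETS_def)
      show "carrier (second_cohomology G) \<subseteq> ?\<pi> ` carrier ?M"
        using G.class_eq_inflated[OF big] by (metis (no_types, lifting) image_eqI partial_object.select_convs(1) partial_object.surjective partial_object.update_convs(1) subsetI)
    qed
    show "?\<rho> ` carrier ?M = carrier (second_cohomology H)"
    proof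
      show "?\<rho> ` carrier ?M \<subseteq> carrier (second_cohomology H)"
        using cH transport_inflated by (auto simp: second_cohomology_def FactGroup_def RCOSETS_def)
      show "carrier (second_cohomology H) \<subseteq> ?\<rho> ` carrier ?M"
      proof
        fix C assume "C \<in> carrier (second_cohomology H)"
        then obtain \<beta> where \<beta>: "\<beta> \<in> H.inflated" "C = coboundaries H #>\<^bsub>cocycle_group H\<^esub> \<beta>"
          using H.class_eq_inflated[OF bigH] by blast
        then have "C = ?\<rho> (sw.transport \<beta>)" using roundtrip1 by simp
        then show "C \<in> ?\<rho> ` carrier ?M" using sw.transport_inflated[OF \<beta>(1)] by simp
      qed
    qed
    show "?\<pi> \<alpha> = \<one>\<^bsub>second_cohomology G\<^esub> \<longleftrightarrow> ?\<rho> \<alpha> = \<one>\<^bsub>second_cohomology H\<^esub>" if "\<alpha> \<in> carrier ?M" for \<alpha>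
      using that coset_one coset_one' ker by (simp add: second_cohomology_def FactGroup_def)
  qed (use that in auto)
qed

end

section \<open>Isomorphisms of twisted group algebras\<close>

lemma (in central_commutator_group) sum_powers_zchar:
  assumes "z \<in> Z" shows "(\<Sum>j<p. zchar z ^ j) = (if z = \<one> then of_nat p else 0)"
proof (cases "z = \<one>")
  case True
  then show ?thesis using zchar_eq_1_iff[OF assms] by simp
next
  case False
  then have "zchar z \<noteq> 1" using zchar_eq_1_iff[OF assms] by simp
  then show ?thesis using False zchar_pow_p[OF assms] by (simp add: geometric_sum)
qed

context full_isometry
begin

text \<open>The kernel of the algebra isomorphism: on the block of the \<open>j\<close>-th power of the faithful central
  character, the basis vector of \<open>g\<close> corresponds to the basis vector of \<open>h\<close> divided by \<open>\<Lambda> (g, h) ^ j\<close>,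
  and averaging over the blocks gives the coefficients.\<close>

definition kern :: "'a \<Rightarrow> 'b \<Rightarrow> complex" where
  "kern g h = (if (g, h) \<in> R then (\<Sum>j<p. inverse (\<Lambda> (g, h)) ^ j) / of_nat p else 0)"

text \<open>The matrix inverse of \<open>kern\<close>: it is \<open>kern\<close> of the swapped
  isometry with the arguments exchanged.\<close>

definition kern' :: "'a \<Rightarrow> 'b \<Rightarrow> complex" where
  "kern' g h = (if (g, h) \<in> R then (\<Sum>j<p. \<Lambda> (g, h) ^ j) / of_nat p else 0)"

text \<open>The partners of \<open>g\<close> are the products of \<open>h\<close> with central
  elements, so this sum is a convolution over the centre; \<open>sum_zchar_orthogonal\<close>
  multiplies the two factors block by block.\<close>

lemma kern_sum_rows:
  assumes r: "(g, h) \<in> R" and s: "(g', h') \<in> R"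
  shows "(\<Sum>w\<in>H.Z. kern g (h \<otimes>\<^bsub>H\<^esub> w) * kern g' (h' \<otimes>\<^bsub>H\<^esub> inv\<^bsub>H\<^esub> w)) =
    (\<Sum>j<p. inverse (\<Lambda> (g, h) * \<Lambda> (g', h')) ^ j) / of_nat p"
proof -
  let ?a = "inverse (\<Lambda> (g, h))" and ?b = "inverse (\<Lambda> (g', h'))"
  have k1: "kern g (h \<otimes>\<^bsub>H\<^esub> w) = (\<Sum>j<p. ?a ^ j * inverse (H.zchar w ^ j)) / of_nat p" if "w \<in> H.Z" for w
    using R_mult_center(2)[OF r that] \<Lambda>_mult_center(2)[OF r that]
    by (simp add: kern_def power_mult_distrib power_inverse)
  have k2: "kern g' (h' \<otimes>\<^bsub>H\<^esub> inv\<^bsub>H\<^esub> w) = (\<Sum>i<p. ?b ^ i * H.zchar w ^ i) / of_nat p" if "w \<in> H.Z" for w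
    using R_mult_center(2)[OF s H.Z_inv[OF that]] \<Lambda>_mult_center(2)[OF s H.Z_inv[OF that]]
      H.character_on_inv[OF H.Z_subgroup H.zchar_character that]
    by (simp add: kern_def power_mult_distrib power_inverse)
  have "(\<Sum>w\<in>H.Z. kern g (h \<otimes>\<^bsub>H\<^esub> w) * kern g' (h' \<otimes>\<^bsub>H\<^esub> inv\<^bsub>H\<^esub> w)) =
    (\<Sum>w\<in>H.Z. (\<Sum>j<p. ?a ^ j * inverse (H.zchar w ^ j)) / of_nat p * ((\<Sum>i<p. ?b ^ i * H.zchar w ^ i) / of_nat p))"
    by (intro sum.cong refl) (simp only: k1 k2)
  also have "\<dots> = (\<Sum>j<p. ?a ^ j * ?b ^ j) / of_nat p" by (rule H.sum_zchar_orthogonal)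
  finally show ?thesis by (simp add: power_mult_distrib)
qed

text \<open>Multiplicativity on basis vectors, apart from the cocycle. Among the factorizations of
  \<open>k\<close> only those contribute that distribute a central element and its inverse over two
  fixed partners.\<close>

lemma kern_convolution:
  assumes g: "g \<in> carrier G" "g' \<in> carrier G"
  shows "(\<Sum>(h, h') | h \<in> carrier H \<and> h' \<in> carrier H \<and> h \<otimes>\<^bsub>H\<^esub> h' = k. kern g h * kern g' h') =
    kern (g \<otimes>\<^bsub>G\<^esub> g') k"
proof -
  let ?S = "{(h, h'). h \<in> carrier H \<and> h' \<in> carrier H \<and> h \<otimes>\<^bsub>H\<^esub> h' = k}"
  have fin: "finite ?S"
    by (rule finite_subset[of _ "carrier H \<times> carrier H"]) (use H.finite_carrier in auto)
  show ?thesis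
  proof (cases "(g \<otimes>\<^bsub>G\<^esub> g', k) \<in> R")
    case False
    then have "kern g h * kern g' h' = 0" if "(h, h') \<in> ?S" for h h'
      using R_mult[of g h g' h'] that by (auto simp: kern_def)
    then have "(\<Sum>(h, h')\<in>?S. kern g h * kern g' h') = 0" by (intro sum.neutral) auto
    then show ?thesis using False by (simp add: kern_def)
  next
    case True
    obtain h0 where h0: "(g, h0) \<in> R" using R_fst g(1) by force
    \<comment> \<open>The complementary factor of \<open>k\<close>; it is a partner of
      \<open>g'\<close> because \<open>R\<close> is a subgroup.\<close>
    define h1 where "h1 = inv\<^bsub>H\<^esub> h0 \<otimes>\<^bsub>H\<^esub> k"
    note c0 = R_carrier(2)[OF h0] and ck = R_carrier(2)[OF True]
    have "(inv\<^bsub>G\<^esub> g \<otimes>\<^bsub>G\<^esub> (g \<otimes>\<^bsub>G\<^esub> g'), h1) \<in> R" unfolding h1_def using R_mult[OF R_inv[OF h0] True] .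
    then have h1: "(g', h1) \<in> R" using g by (simp add: G.m_assoc[symmetric])
    note c1 = R_carrier(2)[OF h1]
    have k: "h0 \<otimes>\<^bsub>H\<^esub> h1 = k" unfolding h1_def using c0 ck by (simp add: H.m_assoc[symmetric])
    have inj: "inj_on (\<lambda>w. (h0 \<otimes>\<^bsub>H\<^esub> w, h1 \<otimes>\<^bsub>H\<^esub> inv\<^bsub>H\<^esub> w)) H.Z"
      by (rule inj_onI) (use c0 H.Z_carrier in auto)
    have prod: "(h0 \<otimes>\<^bsub>H\<^esub> w) \<otimes>\<^bsub>H\<^esub> (h1 \<otimes>\<^bsub>H\<^esub> inv\<^bsub>H\<^esub> w) = k" if w: "w \<in> H.Z" for w
    proof -
      have wc: "w \<in> carrier H" using w H.Z_carrier by blast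
      have "(h0 \<otimes>\<^bsub>H\<^esub> w) \<otimes>\<^bsub>H\<^esub> (h1 \<otimes>\<^bsub>H\<^esub> inv\<^bsub>H\<^esub> w) = h0 \<otimes>\<^bsub>H\<^esub> (w \<otimes>\<^bsub>H\<^esub> h1) \<otimes>\<^bsub>H\<^esub> inv\<^bsub>H\<^esub> w"
        using wc c0 c1 by (simp add: H.m_assoc)
      also have "\<dots> = (h0 \<otimes>\<^bsub>H\<^esub> h1) \<otimes>\<^bsub>H\<^esub> (w \<otimes>\<^bsub>H\<^esub> inv\<^bsub>H\<^esub> w)"
        unfolding H.Z_comm[OF w c1] using wc c0 c1 by (simp only: H.m_assoc H.m_closed H.inv_closed)
      finally show ?thesis using wc k ck by simp
    qed
    have sub: "(\<lambda>w. (h0 \<otimes>\<^bsub>H\<^esub> w, h1 \<otimes>\<^bsub>H\<^esub> inv\<^bsub>H\<^esub> w)) ` H.Z \<subseteq> ?S"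
      using prod c0 c1 H.Z_carrier by auto
    have out: "kern g h * kern g' h' = 0"
      if "(h, h') \<in> ?S" "(h, h') \<notin> (\<lambda>w. (h0 \<otimes>\<^bsub>H\<^esub> w, h1 \<otimes>\<^bsub>H\<^esub> inv\<^bsub>H\<^esub> w)) ` H.Z" for h h'
    proof (rule ccontr)
      assume "kern g h * kern g' h' \<noteq> 0"
      then have r: "(g, h) \<in> R" by (auto simp: kern_def split: if_splits)
      obtain w where w: "w \<in> H.Z" "h = h0 \<otimes>\<^bsub>H\<^esub> w"
        using isometry_same_fst[OF R h0 r] by auto
      have "h0 \<otimes>\<^bsub>H\<^esub> w \<otimes>\<^bsub>H\<^esub> h' = (h0 \<otimes>\<^bsub>H\<^esub> w) \<otimes>\<^bsub>H\<^esub> (h1 \<otimes>\<^bsub>H\<^esub> inv\<^bsub>H\<^esub> w)"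
        using that(1) prod[OF w(1)] w(2) by simp
      then have "h' = h1 \<otimes>\<^bsub>H\<^esub> inv\<^bsub>H\<^esub> w" using that(1) c0 c1 H.Z_carrier[OF w(1)] by simp
      then show False using that(2) w by blast
    qed
    have "(\<Sum>(h, h')\<in>?S. kern g h * kern g' h') =
      (\<Sum>(h, h')\<in>(\<lambda>w. (h0 \<otimes>\<^bsub>H\<^esub> w, h1 \<otimes>\<^bsub>H\<^esub> inv\<^bsub>H\<^esub> w)) ` H.Z. kern g h * kern g' h')"
    proof (rule sum.mono_neutral_right[OF fin sub], rule ballI)
      fix x assume x: "x \<in> ?S - (\<lambda>w. (h0 \<otimes>\<^bsub>H\<^esub> w, h1 \<otimes>\<^bsub>H\<^esub> inv\<^bsub>H\<^esub> w)) ` H.Z"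
      obtain h h' where e: "x = (h, h')" by (cases x)
      show "(case x of (h, h') \<Rightarrow> kern g h * kern g' h') = 0"
        unfolding e case_prod_conv using x unfolding Diff_iff e by (elim conjE) (rule out)
    qed
    also have "\<dots> = (\<Sum>w\<in>H.Z. kern g (h0 \<otimes>\<^bsub>H\<^esub> w) * kern g' (h1 \<otimes>\<^bsub>H\<^esub> inv\<^bsub>H\<^esub> w))"
      by (subst sum.reindex[OF inj]) (simp add: o_def)
    also have "\<dots> = kern (g \<otimes>\<^bsub>G\<^esub> g') k"
      unfolding kern_sum_rows[OF h0 h1] using \<Lambda>_mult[OF h0 h1] True k by (simp add: kern_def)
    finally show ?thesis .
  qed
qed

text \<open>Elements of different cosets of the centre have no common partner. If g' = g z with z
  central, Parseval leaves the average of the powers of the inverse of \<open>zchar z\<close>, which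
  vanishes unless z is trivial.\<close>

lemma kern_inverse:
  assumes g: "g \<in> carrier G" "g' \<in> carrier G"
  shows "(\<Sum>h\<in>carrier H. kern g h * kern' g' h) = (if g = g' then 1 else 0)"
proof (cases "\<exists>h. (g, h) \<in> R \<and> (g', h) \<in> R")
  case False
  then have "kern g h * kern' g' h = 0" for h by (auto simp: kern_def kern'_def)
  then have "(\<Sum>h\<in>carrier H. kern g h * kern' g' h) = 0" by (intro sum.neutral ballI)
  moreover have "g \<noteq> g'" using False R_fst g(1) by force
  ultimately show ?thesis by simp
next
  case True
  then obtain h0 where h0: "(g, h0) \<in> R" "(g', h0) \<in> R" by blast
  obtain z where z: "z \<in> G.Z" "g' = g \<otimes>\<^bsub>G\<^esub> z" using same_snd[OF h0] .
  note c0 = R_carrier(2)[OF h0(1)]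
  have p0: "of_nat p \<noteq> (0::complex)" using G.p_gt_1 by simp
  let ?a = "\<Lambda> (g, h0)" and ?c = "inverse (G.zchar z)"
  have a0: "?a \<noteq> 0" using \<Lambda>_nonzero[OF h0(1)] .
  have k1: "kern g (h0 \<otimes>\<^bsub>H\<^esub> w) = (\<Sum>j<p. inverse ?a ^ j * inverse (H.zchar w ^ j)) / of_nat p" if "w \<in> H.Z" for w
    using R_mult_center(2)[OF h0(1) that] \<Lambda>_mult_center(2)[OF h0(1) that]
    by (simp add: kern_def power_mult_distrib power_inverse)
  have k2: "kern' g' (h0 \<otimes>\<^bsub>H\<^esub> w) = (\<Sum>i<p. ?a ^ i * ?c ^ i * H.zchar w ^ i) / of_nat p" if "w \<in> H.Z" for w
    using R_mult_center(2)[OF h0(2) that] \<Lambda>_mult_center(2)[OF h0(2) that] \<Lambda>_mult_center(1)[OF h0(1) z(1)]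
    by (simp add: kern'_def power_mult_distrib z(2))
  have inj: "inj_on (\<lambda>w. h0 \<otimes>\<^bsub>H\<^esub> w) H.Z" by (rule inj_onI) (use c0 H.Z_carrier in auto)
  have "(\<Sum>h\<in>carrier H. kern g h * kern' g' h) = (\<Sum>h\<in>(\<lambda>w. h0 \<otimes>\<^bsub>H\<^esub> w) ` H.Z. kern g h * kern' g' h)"
  proof (rule sum.mono_neutral_right[OF H.finite_carrier])
    show "(\<lambda>w. h0 \<otimes>\<^bsub>H\<^esub> w) ` H.Z \<subseteq> carrier H" using c0 H.Z_carrier by auto
    show "\<forall>h\<in>carrier H - (\<lambda>w. h0 \<otimes>\<^bsub>H\<^esub> w) ` H.Z. kern g h * kern' g' h = 0"
    proof
      fix h assume h: "h \<in> carrier H - (\<lambda>w. h0 \<otimes>\<^bsub>H\<^esub> w) ` H.Z"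
      have "(g, h) \<notin> R"
      proof
        assume "(g, h) \<in> R"
        then obtain w where "w \<in> H.Z" "h = h0 \<otimes>\<^bsub>H\<^esub> w" using isometry_same_fst[OF R h0(1), of "(g, h)"] by auto
        then show False using h by blast
      qed
      then show "kern g h * kern' g' h = 0" by (simp add: kern_def)
    qed
  qed
  also have "\<dots> = (\<Sum>w\<in>H.Z. kern g (h0 \<otimes>\<^bsub>H\<^esub> w) * kern' g' (h0 \<otimes>\<^bsub>H\<^esub> w))"
    by (subst sum.reindex[OF inj]) (simp add: o_def)
  also have "\<dots> =
    (\<Sum>w\<in>H.Z. (\<Sum>j<p. inverse ?a ^ j * inverse (H.zchar w ^ j)) / of_nat p * ((\<Sum>i<p. ?a ^ i * ?c ^ i * H.zchar w ^ i) / of_nat p))"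
    by (intro sum.cong refl) (simp only: k1 k2)
  also have "\<dots> = (\<Sum>j<p. inverse ?a ^ j * (?a ^ j * ?c ^ j)) / of_nat p" by (rule H.sum_zchar_orthogonal)
  also have "(\<Sum>j<p. inverse ?a ^ j * (?a ^ j * ?c ^ j)) = (\<Sum>j<p. ?c ^ j)"
  proof -
    have "inverse ?a ^ j * (?a ^ j * ?c ^ j) = ?c ^ j" for j
      using a0 by (simp only: power_inverse mult.assoc[symmetric] power_not_zero left_inverse mult_1 not_False_eq_True)
    then show ?thesis by (simp only:)
  qed
  also have "(\<Sum>j<p. ?c ^ j) = (\<Sum>j<p. G.zchar (inv\<^bsub>G\<^esub> z) ^ j)"
    using G.character_on_inv[OF G.Z_subgroup G.zchar_character z(1)] by simp
  also have "\<dots> = (if z = \<one>\<^bsub>G\<^esub> then of_nat p else 0)"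
    using G.sum_powers_zchar[OF G.Z_inv[OF z(1)]] G.inv_eq_1_iff[OF G.Z_carrier[OF z(1)]] by simp
  finally have "(\<Sum>h\<in>carrier H. kern g h * kern' g' h) = (if z = \<one>\<^bsub>G\<^esub> then 1 else 0)" using p0 by simp
  moreover have "g = g' \<longleftrightarrow> z = \<one>\<^bsub>G\<^esub>" using z g G.Z_carrier by auto
  ultimately show ?thesis by simp
qed

lemma kern_inverse':
  assumes h: "h \<in> carrier H" "h' \<in> carrier H"
  shows "(\<Sum>g\<in>carrier G. kern' g h * kern g h') = (if h = h' then 1 else 0)"
proof -
  interpret sw: full_isometry H G p "prod.swap ` R" "\<lambda>r. inverse (\<Lambda> (prod.swap r))"
    by (rule swap_full_isometry)
  have "sw.kern h g = kern' g h" "sw.kern' h g = kern g h" for g h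
    by (auto simp: sw.kern_def sw.kern'_def kern_def kern'_def)
  then show ?thesis using sw.kern_inverse[OF h] by simp
qed

text \<open>Wherever both kernel values are nonzero, the transported cocycle has the value of
  \<alpha>. The twist therefore passes through the sums, and multiplicativity reduces to
  \<open>kern_convolution\<close>.\<close>

lemma twisted_group_algebra_transport:
  assumes \<alpha>: "\<alpha> \<in> G.inflated"
  shows "complex_algebra_iso (twisted_group_algebra G \<alpha>) (twisted_group_algebra H (transport \<alpha>))"
proof -
  let ?A = "twisted_group_algebra G \<alpha>" and ?B = "twisted_group_algebra H (transport \<alpha>)"
  let ?\<phi> = "\<lambda>u h. \<Sum>g\<in>carrier G. u g * kern g h" and ?\<psi> = "\<lambda>v g. \<Sum>h\<in>carrier H. v h * kern' g h"
  let ?S = "\<lambda>x. {(a, b). a \<in> carrier G \<and> b \<in> carrier G \<and> a \<otimes>\<^bsub>G\<^esub> b = x}"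
  let ?T = "\<lambda>x. {(a, b). a \<in> carrier H \<and> b \<in> carrier H \<and> a \<otimes>\<^bsub>H\<^esub> b = x}"
  have finG: "finite (carrier G)" and finH: "finite (carrier H)" using G.finite_carrier H.finite_carrier .
  have finS: "finite (?S x)" for x
    by (rule finite_subset[of _ "carrier G \<times> carrier G"]) (use finG in auto)
  have out: "kern g h = 0" "kern' g h = 0" if "h \<notin> carrier H \<or> g \<notin> carrier G" for g h
    using that R_carrier[of g h] by (auto simp: kern_def kern'_def)
  have kk: "kern g h * kern g' h' * transport \<alpha> (h, h') = kern g h * kern g' h' * \<alpha> (g, g')" for g h g' h'
    using transport_eq[OF \<alpha>] by (auto simp: kern_def)
  have bij: "bij_betw ?\<phi> (carrier ?A) (carrier ?B)"
  proof (rule bij_betw_byWitness[where f' = ?\<psi>])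
    show "\<forall>u\<in>carrier ?A. ?\<psi> (?\<phi> u) = u"
    proof (intro ballI ext)
      fix u g' assume "u \<in> carrier ?A"
      then have u: "u g = 0" if "g \<notin> carrier G" for g using that by (simp add: twisted_group_algebra_def)
      show "?\<psi> (?\<phi> u) g' = u g'"
      proof (cases "g' \<in> carrier G")
        case True
        have "?\<psi> (?\<phi> u) g' = (\<Sum>h\<in>carrier H. \<Sum>g\<in>carrier G. u g * (kern g h * kern' g' h))"
          by (simp only: sum_distrib_right mult.assoc)
        also have "\<dots> = (\<Sum>g\<in>carrier G. \<Sum>h\<in>carrier H. u g * (kern g h * kern' g' h))" by (rule sum.swap)
        also have "\<dots> = (\<Sum>g\<in>carrier G. if g = g' then u g else 0)"
          by (intro sum.cong refl) (simp add: kern_inverse True flip: sum_distrib_left)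
        also have "\<dots> = u g'" using True finG by simp
        finally show ?thesis .
      qed (simp add: u out)
    qed
    show "\<forall>v\<in>carrier ?B. ?\<phi> (?\<psi> v) = v"
    proof (intro ballI ext)
      fix v h' assume "v \<in> carrier ?B"
      then have v: "v h = 0" if "h \<notin> carrier H" for h using that by (simp add: twisted_group_algebra_def)
      show "?\<phi> (?\<psi> v) h' = v h'"
      proof (cases "h' \<in> carrier H")
        case True
        have "?\<phi> (?\<psi> v) h' = (\<Sum>g\<in>carrier G. \<Sum>h\<in>carrier H. v h * (kern' g h * kern g h'))"
          by (simp only: sum_distrib_right mult.assoc)
        also have "\<dots> = (\<Sum>h\<in>carrier H. \<Sum>g\<in>carrier G. v h * (kern' g h * kern g h'))" by (rule sum.swap)
        also have "\<dots> = (\<Sum>h\<in>carrier H. if h = h' then v h else 0)"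
          by (intro sum.cong refl) (simp add: kern_inverse' True flip: sum_distrib_left)
        also have "\<dots> = v h'" using True finH by simp
        finally show ?thesis .
      qed (simp add: v out)
    qed
  qed (auto simp: twisted_group_algebra_def out)
  have hom: "?\<phi> \<in> ring_hom ?A ?B"
  proof (rule ring_hom_memI)
    fix u v
    show "?\<phi> (u \<otimes>\<^bsub>?A\<^esub> v) = ?\<phi> u \<otimes>\<^bsub>?B\<^esub> ?\<phi> v"
    proof
      fix k
      have "?\<phi> (u \<otimes>\<^bsub>?A\<^esub> v) k = (\<Sum>x\<in>carrier G. \<Sum>(g, g')\<in>?S x. u g * v g' * \<alpha> (g, g') * kern (g \<otimes>\<^bsub>G\<^esub> g') k)"
        by (auto simp: twisted_group_algebra_def sum_distrib_right intro!: sum.cong)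
      also have "\<dots> = (\<Sum>(g, g')\<in>carrier G \<times> carrier G. u g * v g' * \<alpha> (g, g') * kern (g \<otimes>\<^bsub>G\<^esub> g') k)"
      proof -
        have "{q \<in> carrier G \<times> carrier G. fst q \<otimes>\<^bsub>G\<^esub> snd q = x} = ?S x" for x by auto
        then show ?thesis
          using sum.group[of "carrier G \<times> carrier G" "carrier G" "\<lambda>q. fst q \<otimes>\<^bsub>G\<^esub> snd q"
            "\<lambda>(g, g'). u g * v g' * \<alpha> (g, g') * kern (g \<otimes>\<^bsub>G\<^esub> g') k"] finG
          by (simp add: image_subset_iff)
      qed
      also have "\<dots> = (\<Sum>(g, g')\<in>carrier G \<times> carrier G. \<Sum>(h, h')\<in>?T k. u g * v g' * (kern g h * kern g' h' * transport \<alpha> (h, h')))"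
      proof (intro sum.cong refl, clarify)
        fix g g' assume g: "g \<in> carrier G" "g' \<in> carrier G"
        show "u g * v g' * \<alpha> (g, g') * kern (g \<otimes>\<^bsub>G\<^esub> g') k =
          (\<Sum>(h, h')\<in>?T k. u g * v g' * (kern g h * kern g' h' * transport \<alpha> (h, h')))"
          unfolding kk kern_convolution[OF g, symmetric]
          by (simp add: sum_distrib_left case_prod_unfold mult_ac)
      qed
      also have "\<dots> = (\<Sum>(h, h')\<in>?T k. \<Sum>(g, g')\<in>carrier G \<times> carrier G. u g * v g' * (kern g h * kern g' h' * transport \<alpha> (h, h')))"
        unfolding case_prod_unfold by (rule sum.swap)
      also have "\<dots> = (\<Sum>(h, h')\<in>?T k. ?\<phi> u h * ?\<phi> v h' * transport \<alpha> (h, h'))"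
      proof (intro sum.cong refl, clarify)
        fix h h'
        show "(\<Sum>(g, g')\<in>carrier G \<times> carrier G. u g * v g' * (kern g h * kern g' h' * transport \<alpha> (h, h'))) =
          ?\<phi> u h * ?\<phi> v h' * transport \<alpha> (h, h')"
        proof -
          have eq: "?\<phi> u h * ?\<phi> v h' = (\<Sum>(g, g')\<in>carrier G \<times> carrier G. (u g * kern g h) * (v g' * kern g' h'))"
            by (simp only: sum_product sum.cartesian_product)
          show ?thesis unfolding eq unfolding sum_distrib_right by (simp only: case_prod_unfold mult_ac)
        qed
      qed
      finally show "?\<phi> (u \<otimes>\<^bsub>?A\<^esub> v) k = (?\<phi> u \<otimes>\<^bsub>?B\<^esub> ?\<phi> v) k"
        by (simp add: twisted_group_algebra_def)
    qed
  next
    fix u v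
    show "?\<phi> (u \<oplus>\<^bsub>?A\<^esub> v) = ?\<phi> u \<oplus>\<^bsub>?B\<^esub> ?\<phi> v"
      by (simp add: twisted_group_algebra_def fun_eq_iff sum.distrib algebra_simps)
  next
    have one: "\<alpha> (\<one>\<^bsub>G\<^esub>, \<one>\<^bsub>G\<^esub>) = 1" "transport \<alpha> (\<one>\<^bsub>H\<^esub>, \<one>\<^bsub>H\<^esub>) = 1"
      using \<alpha> transport_inflated[OF \<alpha>] G.Z_one H.Z_one by (auto simp: G.inflated_def H.inflated_def)
    show "?\<phi> \<one>\<^bsub>?A\<^esub> = \<one>\<^bsub>?B\<^esub>"
    proof
      fix h
      have "?\<phi> \<one>\<^bsub>?A\<^esub> h = (\<Sum>g\<in>carrier G. if g = \<one>\<^bsub>G\<^esub> then kern g h else 0)"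
        by (intro sum.cong refl) (auto simp: twisted_group_algebra_def basis_vector_def one)
      also have "\<dots> = kern \<one>\<^bsub>G\<^esub> h" using finG by simp
      \<comment> \<open>The partners of the identity are the central elements, and the average over
        the blocks vanishes on them except at the identity.\<close>
      also have "\<dots> = (if h = \<one>\<^bsub>H\<^esub> then 1 else 0)"
      proof (cases "h \<in> H.Z")
        case True
        have p0: "of_nat p \<noteq> (0::complex)" using G.p_gt_1 by simp
        have "\<Lambda> (\<one>\<^bsub>G\<^esub>, h) = H.zchar h"
          using \<Lambda>_center[OF G.Z_one True] G.zchar_eq_1_iff[OF G.Z_one] by simp
        moreover have "inverse (H.zchar h) = H.zchar (inv\<^bsub>H\<^esub> h)"
          using H.character_on_inv[OF H.Z_subgroup H.zchar_character True] by simp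
        moreover have "inv\<^bsub>H\<^esub> h = \<one>\<^bsub>H\<^esub> \<longleftrightarrow> h = \<one>\<^bsub>H\<^esub>"
          using H.inv_eq_1_iff[OF H.Z_carrier[OF True]] .
        ultimately show ?thesis
          using H.sum_powers_zchar[OF H.Z_inv[OF True]] R_center[OF G.Z_one True] p0 by (simp add: kern_def)
      next
        case False
        then have "(\<one>\<^bsub>G\<^esub>, h) \<notin> R" using R_center_iff G.Z_one by blast
        then show ?thesis using False H.Z_one by (auto simp: kern_def)
      qed
      also have "\<dots> = \<one>\<^bsub>?B\<^esub> h" by (simp add: twisted_group_algebra_def basis_vector_def one)
      finally show "?\<phi> \<one>\<^bsub>?A\<^esub> h = \<one>\<^bsub>?B\<^esub> h" .
    qed
  qed (auto simp: twisted_group_algebra_def out)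
  from bij hom show ?thesis
    unfolding complex_algebra_iso_def ring_iso_def
    by (intro bexI[of _ ?\<phi>]) (auto simp: twisted_group_algebra_def sum_distrib_left mult_ac)
qed

end

section \<open>Assembling the equivalence for n > 1\<close>

lemma complex_algebra_iso_trans:
  assumes "complex_algebra_iso A B" "complex_algebra_iso B C"
  shows "complex_algebra_iso A C"
proof -
  obtain f where f: "f \<in> ring_iso A B" "\<And>c x. x \<in> carrier A \<Longrightarrow> f (c \<odot>\<^bsub>A\<^esub> x) = c \<odot>\<^bsub>B\<^esub> f x"
    using assms(1) unfolding complex_algebra_iso_def by blast
  obtain g where g: "g \<in> ring_iso B C" "\<And>c x. x \<in> carrier B \<Longrightarrow> g (c \<odot>\<^bsub>B\<^esub> x) = c \<odot>\<^bsub>C\<^esub> g x"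
    using assms(2) unfolding complex_algebra_iso_def by blast
  have "g \<circ> f \<in> ring_iso A C" using f(1) g(1) by (rule ring_iso_set_trans)
  moreover have "(g \<circ> f) (c \<odot>\<^bsub>A\<^esub> x) = c \<odot>\<^bsub>C\<^esub> (g \<circ> f) x" if "x \<in> carrier A" for c x
    using f(2)[OF that] g(2)[OF ring_iso_memE(1)[OF f(1) that]] by simp
  ultimately show ?thesis unfolding complex_algebra_iso_def by blast
qed

lemma complex_algebra_iso_sym:
  assumes "ring A" "\<And>c x. x \<in> carrier A \<Longrightarrow> c \<odot>\<^bsub>A\<^esub> x \<in> carrier A" "complex_algebra_iso A B"
  shows "complex_algebra_iso B A"
proof -
  obtain f where f: "f \<in> ring_iso A B" "\<And>c x. x \<in> carrier A \<Longrightarrow> f (c \<odot>\<^bsub>A\<^esub> x) = c \<odot>\<^bsub>B\<^esub> f x"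
    using assms(3) unfolding complex_algebra_iso_def by blast
  have bij: "bij_betw f (carrier A) (carrier B)" using f(1) by (rule ring_iso_memE(5))
  let ?g = "inv_into (carrier A) f"
  have "?g \<in> ring_iso B A" using assms(1) f(1) by (rule ring_iso_set_sym)
  moreover have "?g (c \<odot>\<^bsub>B\<^esub> y) = c \<odot>\<^bsub>A\<^esub> ?g y" if y: "y \<in> carrier B" for c y
  proof -
    have x: "?g y \<in> carrier A" "f (?g y) = y"
      using bij y by (auto simp: bij_betw_def inv_into_into f_inv_into_f)
    then have "c \<odot>\<^bsub>B\<^esub> y = f (c \<odot>\<^bsub>A\<^esub> ?g y)" using f(2)[OF x(1)] by simp
    then show ?thesis using bij_betw_inv_into_left[OF bij assms(2)[OF x(1)]] by simp
  qed
  ultimately show ?thesis unfolding complex_algebra_iso_def by blast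
qed

lemma twisted_group_algebra_smult_closed: "u \<in> carrier (twisted_group_algebra G \<alpha>) \<Longrightarrow>
    c \<odot>\<^bsub>twisted_group_algebra G \<alpha>\<^esub> u \<in> carrier (twisted_group_algebra G \<alpha>)"
  by (simp add: twisted_group_algebra_def)

lemma same_class_algebra_iso:
  assumes "group G" "\<beta> \<in> coboundaries G #>\<^bsub>cocycle_group G\<^esub> \<alpha>"
  shows "complex_algebra_iso (twisted_group_algebra G \<beta>) (twisted_group_algebra G \<alpha>)"
proof -
  obtain f where "f \<in> carrier G \<rightarrow> UNIV - {0}" "\<beta> = coboundary G f \<otimes>\<^bsub>cocycle_group G\<^esub> \<alpha>"
    using assms(2) by (auto simp: coboundaries_def r_coset_def)
  then show ?thesis using twisted_group_algebra_cohomologous[OF assms(1)] by simp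
qed

text \<open>Arbitrary representatives on both sides are connected through an inflated one and its
  transport.\<close>

lemma (in full_isometry) twisted_equiv_isometric:
  assumes big: "card (carrier G) > p ^ 3"
  shows "twisted_equiv G H"
proof -
  obtain \<psi> where \<psi>: "\<psi> \<in> iso (second_cohomology G) (second_cohomology H)"
    "\<And>\<alpha>. \<alpha> \<in> G.inflated \<Longrightarrow>
      \<psi> (coboundaries G #>\<^bsub>cocycle_group G\<^esub> \<alpha>) = coboundaries H #>\<^bsub>cocycle_group H\<^esub> transport \<alpha>"
    using second_cohomology_iso[OF big] by blast
  have "complex_algebra_iso (twisted_group_algebra G \<alpha>) (twisted_group_algebra H \<beta>)"
    if C: "C \<in> carrier (second_cohomology G)" and \<alpha>: "\<alpha> \<in> C" and \<beta>: "\<beta> \<in> \<psi> C" for C \<alpha> \<beta>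
  proof -
    obtain \<alpha>0 where \<alpha>0: "\<alpha>0 \<in> G.inflated" "C = coboundaries G #>\<^bsub>cocycle_group G\<^esub> \<alpha>0"
      using G.class_eq_inflated[OF big C] .
    have "complex_algebra_iso (twisted_group_algebra G \<alpha>) (twisted_group_algebra G \<alpha>0)"
      using same_class_algebra_iso[OF G.is_group] \<alpha> \<alpha>0(2) by blast
    moreover have "complex_algebra_iso (twisted_group_algebra G \<alpha>0) (twisted_group_algebra H (transport \<alpha>0))"
      using \<alpha>0(1) by (rule twisted_group_algebra_transport)
    moreover have "complex_algebra_iso (twisted_group_algebra H (transport \<alpha>0)) (twisted_group_algebra H \<beta>)"
    proof (rule complex_algebra_iso_sym[OF _ twisted_group_algebra_smult_closed])
      have b: "\<beta> \<in> coboundaries H #>\<^bsub>cocycle_group H\<^esub> transport \<alpha>0" using \<beta> \<psi>(2)[OF \<alpha>0(1)] \<alpha>0(2) by simp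
      then show "complex_algebra_iso (twisted_group_algebra H \<beta>) (twisted_group_algebra H (transport \<alpha>0))"
        using same_class_algebra_iso[OF H.is_group] by blast
      have "\<beta> \<in> cocycles H"
      proof -
        interpret ZH: comm_group "cocycle_group H" by (rule cocycle_group_comm_group) unfold_locales
        have "coboundaries H \<subseteq> carrier (cocycle_group H)" "transport \<alpha>0 \<in> carrier (cocycle_group H)"
          using normal_imp_subgroup[OF coboundaries_normal[OF H.is_group], THEN subgroup.subset]
            transport_inflated[OF \<alpha>0(1)] by (auto simp: H.inflated_def cocycle_group_def)
        then have "\<beta> \<in> carrier (cocycle_group H)" using b ZH.r_coset_subset_G by blast
        then show ?thesis by (simp add: cocycle_group_def)
      qed
      then show "ring (twisted_group_algebra H \<beta>)"
        using twisted_group_algebra_ring[OF H.is_group H.finite_carrier] by blast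
    qed
    ultimately show ?thesis by (blast intro: complex_algebra_iso_trans)
  qed
  then show ?thesis unfolding twisted_equiv_def using \<psi>(1) by blast
qed

lemma extra_special_central_commutator_group:
  fixes G (structure)
  assumes p: "Factorial_Ring.prime p" and G: "extra_special p G"
  shows "central_commutator_group G p"
proof -
  interpret group G using G by (simp add: extra_special_def p_group_def)
  have sub: "subgroup (group_center G) G" by (rule subgroup_center)
  interpret N: normal "group_center G" G by (rule normal_center)
  show ?thesis
  proof
    show "Factorial_Ring.prime p" by (rule p)
    obtain k where "Coset.order G = p ^ k" using G by (auto simp: extra_special_def p_group_def)
    then show "finite (carrier G)" using p by (simp add: prime_gt_0_nat flip: order_gt_0_iff_finite)
    show "card (group_center G) = p" using G unfolding extra_special_def by blast
    fix a assume a: "a \<in> carrier G"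
    show "commutator G a b \<in> group_center G" if b: "b \<in> carrier G" for b
    proof -
      \<comment> \<open>The factors of \<open>commutator\<close> are in the order of the generators
        in \<open>derived_set\<close>.\<close>
      have "commutator G a b \<in> derived_set G (carrier G)" using a b unfolding commutator_def by blast
      then have "commutator G a b \<in> derived G (carrier G)" unfolding derived_def by (rule generate.incl)
      moreover have "derived G (carrier G) = group_center G" using G unfolding extra_special_def by simp
      ultimately show ?thesis by simp
    qed
    interpret Q: group_hom G "G Mod group_center G" "\<lambda>a. group_center G #> a"
      using N.factorgroup_is_group N.r_coset_hom_Mod by (simp add: group_hom_def group_hom_axioms_def is_group)
    have "group_center G #> a \<in> carrier (G Mod group_center G)" using a by simp
    then have "(group_center G #> a) [^]\<^bsub>G Mod group_center G\<^esub> p = \<one>\<^bsub>G Mod group_center G\<^esub>"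
      using G unfolding extra_special_def elementary_abelian_def by blast
    then have "group_center G #> (a [^] p) = group_center G"
      using Q.hom_nat_pow[OF a, of p] by (simp add: FactGroup_def)
    then show "a [^] p \<in> group_center G" using coset_join1[OF _ _ sub] a sub subgroup.subset by auto
  qed
qed

theorem twisted_equiv_extra_special:
  assumes p: "Factorial_Ring.prime p" and n: "n > 1"
    and G: "extra_special p G" "Coset.order G = p ^ (2 * n + 1)"
    and H: "extra_special p H" "Coset.order H = p ^ (2 * n + 1)"
  shows "twisted_equiv G H"
proof -
  interpret G: central_commutator_group G p by (rule extra_special_central_commutator_group[OF p G(1)])
  interpret H: central_commutator_group H p by (rule extra_special_central_commutator_group[OF p H(1)])
  interpret GH: central_commutator_pair G H p
    by unfold_locales (use G H in \<open>simp add: Coset.order_def\<close>)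
  obtain R where R: "partial_isometry G H R" "fst ` R = carrier G" "snd ` R = carrier H"
    using GH.isometry_exists .
  obtain \<Lambda> where \<Lambda>: "character_on (G \<times>\<times> H) R \<Lambda>"
    "\<And>z w. z \<in> G.Z \<Longrightarrow> w \<in> H.Z \<Longrightarrow> \<Lambda> (z, w) = inverse (G.zchar z) * H.zchar w"
    using GH.connecting_character_exists[OF R(1)] by blast
  interpret full_isometry G H p R \<Lambda>
    by unfold_locales (use R \<Lambda> in auto)
  \<comment> \<open>This is where n > 1 enters: centralizers are nonabelian once the order exceeds
    p^3.\<close>
  have "p ^ 3 < p ^ (2 * n + 1)" using G.p_gt_1 n by (intro power_strict_increasing) auto
  then show ?thesis using G(2) by (intro twisted_equiv_isometric) (simp add: Coset.order_def)
qed

section \<open>Nonabelian groups of order \<open>p\<^sup>3\<close>\<close>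

text \<open>Class equation: conjugacy classes have p-power size by the orbit-stabilizer theorem, and
  those of size one consist of the central elements.\<close>

lemma (in group) prime_dvd_card_center:
  assumes p: "Factorial_Ring.prime p" and ord: "Coset.order G = p ^ k" "k > 0"
  shows "p dvd card (group_center G)"
proof -
  define \<phi> where "\<phi> = (\<lambda>g. (\<lambda>h \<in> carrier G. g \<otimes> h \<otimes> inv g))"
  interpret A: group_action G "carrier G" \<phi> unfolding \<phi>_def by (rule action_by_conjugation)
  define Orb where "Orb = orbits G (carrier G) \<phi>"
  interpret P: partition "carrier G" Orb unfolding Orb_def by (rule A.orbit_partition)
  have fin: "finite (carrier G)" using ord(1) p by (simp add: prime_gt_0_nat flip: order_gt_0_iff_finite)
  have finO: "finite Orb" by (simp add: Orb_def orbits_def fin)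
  have sub: "b \<subseteq> carrier G" if "b \<in> Orb" for b using P.incl that by blast
  have cover: "\<Union>Orb = carrier G" by (rule P.partition_coverture)
  have orb: "orbit G \<phi> x = (\<lambda>g. g \<otimes> x \<otimes> inv g) ` carrier G" if "x \<in> carrier G" for x
    using that by (auto simp: orbit_def \<phi>_def)
  have dvd: "p dvd card b" if b: "b \<in> Orb" "card b \<noteq> 1" for b
  proof -
    obtain x where x: "x \<in> carrier G" "b = orbit G \<phi> x" using b(1) by (auto simp: Orb_def orbits_def)
    have "p ^ k = card b * card (stabilizer G \<phi> x)"
      using A.orbit_stabilizer_theorem[OF x(1)] unfolding x(2) ord(1) by (rule sym)
    then have "card b dvd p ^ k" by (rule dvdI)
    then obtain j where j: "card b = p ^ j" using p divides_primepow_nat by blast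
    then show ?thesis using b(2) by (cases j) auto
  qed
  have "card (\<Union>Orb) = (\<Sum>b\<in>Orb. card b)"
  proof (rule card_Union_disjoint)
    show "pairwise disjnt Orb"
    proof (rule pairwiseI)
      fix b c assume bc: "b \<in> Orb" "c \<in> Orb" "b \<noteq> c"
      show "disjnt b c" unfolding disjnt_iff
      proof (intro allI notI)
        fix x assume x: "x \<in> b \<and> x \<in> c"
        then have "x \<in> carrier G" using sub[OF bc(1)] by blast
        then show False using P.unique_class[of x] bc x by blast
      qed
    qed
    show "finite b" if "b \<in> Orb" for b by (rule finite_subset[OF sub[OF that] fin])
  qed
  then have "card (carrier G) = (\<Sum>b\<in>Orb. card b)" unfolding cover .
  also have "\<dots> = (\<Sum>b\<in>{b\<in>Orb. card b = 1}. card b) + (\<Sum>b\<in>{b\<in>Orb. card b \<noteq> 1}. card b)"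
  proof -
    have "{b\<in>Orb. card b = 1} \<union> {b\<in>Orb. card b \<noteq> 1} = Orb" by blast
    moreover have "sum card ({b\<in>Orb. card b = 1} \<union> {b\<in>Orb. card b \<noteq> 1}) =
      sum card {b\<in>Orb. card b = 1} + sum card {b\<in>Orb. card b \<noteq> 1}"
      by (rule sum.union_disjoint) (use finO in auto)
    ultimately show ?thesis by (simp only:)
  qed
  also have "(\<Sum>b\<in>{b\<in>Orb. card b = 1}. card b) = card {b\<in>Orb. card b = 1}" by simp
  also have "{b\<in>Orb. card b = 1} = (\<lambda>z. {z}) ` group_center G"
  proof (intro equalityI subsetI)
    fix b assume "b \<in> {b\<in>Orb. card b = 1}"
    then obtain x where x: "x \<in> carrier G" "b = orbit G \<phi> x" and c: "card b = 1" by (auto simp: Orb_def orbits_def)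
    have "\<one> \<otimes> x \<otimes> inv \<one> \<in> b" unfolding x(2) orb[OF x(1)] by blast
    then have "x \<in> b" using x by simp
    then have bx: "b = {x}" using c by (metis card_1_singletonE singletonD)
    have "x \<otimes> g = g \<otimes> x" if g: "g \<in> carrier G" for g
    proof -
      have "g \<otimes> x \<otimes> inv g \<in> b" unfolding x(2) orb[OF x(1)] using g by blast
      then have "g \<otimes> x \<otimes> inv g = x" using bx by simp
      then have "g \<otimes> x \<otimes> inv g \<otimes> g = x \<otimes> g" by simp
      then show ?thesis using g x by (simp add: m_assoc)
    qed
    then have "x \<in> group_center G" using x by (simp add: group_center_def)
    then show "b \<in> (\<lambda>z. {z}) ` group_center G" using bx by blast
  next
    fix b assume "b \<in> (\<lambda>z. {z}) ` group_center G"
    then obtain z where z: "z \<in> group_center G" "b = {z}" by blast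
    have zc: "z \<in> carrier G" using z by (simp add: group_center_def)
    have "g \<otimes> z \<otimes> inv g = z" if "g \<in> carrier G" for g
    proof -
      have "g \<otimes> z = z \<otimes> g" using z that by (simp add: group_center_def)
      then show ?thesis using zc that by (simp add: m_assoc)
    qed
    then have "orbit G \<phi> z = {z}" unfolding orb[OF zc] using one_closed by (simp add: image_constant_conv) blast
    then show "b \<in> {b\<in>Orb. card b = 1}" using zc z(2) by (auto simp: Orb_def orbits_def)
  qed
  also have "card ((\<lambda>z. {z}) ` group_center G) = card (group_center G)" by (rule card_image) simp
  finally have e: "card (carrier G) = card (group_center G) + (\<Sum>b\<in>{b\<in>Orb. card b \<noteq> 1}. card b)" .
  have d: "p dvd (\<Sum>b\<in>{b\<in>Orb. card b \<noteq> 1}. card b)"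
    by (rule dvd_sum) (use dvd in blast)
  have "p dvd card (carrier G)" using ord by (simp add: Coset.order_def)
  then show ?thesis unfolding e by (rule iffD1[OF dvd_add_left_iff[OF d]])
qed

lemma (in group) subgroup_card_dvd:
  "subgroup S G \<Longrightarrow> card S dvd Coset.order G"
  using lagrange[of S] by (metis dvd_triv_right)

lemma (in group) subgroup_adjoin_central:
  assumes "finite (carrier G)" "subgroup N G" "x \<in> carrier G" "\<And>n. n \<in> N \<Longrightarrow> n \<otimes> x = x \<otimes> n"
  shows "subgroup (adjoin N x) G"
proof (rule subgroup_adjoin[OF assms(1-3)])
  fix n and i :: nat assume n: "n \<in> N"
  then have nc: "n \<in> carrier G" using assms(2) by (blast intro: subgroup.mem_carrier)
  have "x \<in> {b \<in> carrier G. b \<otimes> n = n \<otimes> b}" using assms(3,4) n by simp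
  then have "x [^] i \<otimes> n = n \<otimes> x [^] i"
    using subgroup_nat_pow_closed[OF subgroup_centralizer[OF nc]] by blast
  then have "commutator G (x [^] i) n = \<one>" using nc assms(3) by (simp add: commutator_eq_one_iff)
  then show "commutator G (x [^] i) n \<in> N" using assms(2) by (simp add: subgroup.one_closed)
qed


text \<open>Any noncentral x would generate the group together with the centre, and would then
  commute with everything. The fact is applied both to a group of order p^3 and to its quotient by
  the centre.\<close>

lemma (in group) card_ne_prime_mult_card_center:
  assumes p: "Factorial_Ring.prime p" and fin: "finite (carrier G)"
  shows "card (carrier G) \<noteq> p * card (group_center G)"
proof
  assume e: "card (carrier G) = p * card (group_center G)"
  have p1: "p > 1" using p by (rule prime_gt_1_nat)
  have sub: "group_center G \<subseteq> carrier G" by (auto simp: group_center_def)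
  have finZ: "finite (group_center G)" using sub fin by (rule finite_subset)
  have Zpos: "card (group_center G) > 0"
    using finZ subgroup.one_closed[OF subgroup_center] by (auto simp: card_gt_0_iff)
  then have "card (group_center G) < card (carrier G)" using e p1 by simp
  then obtain x where x: "x \<in> carrier G" "x \<notin> group_center G" using sub by (metis less_irrefl subsetI subset_antisym)
  let ?A = "adjoin (group_center G) x"
  have A: "subgroup ?A G"
    by (rule subgroup_adjoin_central[OF fin subgroup_center x(1)]) (use x in \<open>auto simp: group_center_def\<close>)
  have Asub: "?A \<subseteq> carrier G" using A by (rule subgroup.subset)
  have "group_center G \<subset> ?A" using subset_adjoin[OF sub] mem_adjoin[OF subgroup_center x(1)] x(2) by blast
  then have lt: "card (group_center G) < card ?A" using finite_subset[OF Asub fin] by (simp add: psubset_card_mono)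
  have "subgroup (group_center G) (G\<lparr>carrier := ?A\<rparr>)"
    using subgroup_incl[OF subgroup_center A] subset_adjoin[OF sub] by blast
  then have "card (group_center G) dvd card ?A"
    using group.subgroup_card_dvd[OF subgroup.subgroup_is_group[OF A is_group]] by (simp add: Coset.order_def)
  then obtain k where k: "card ?A = card (group_center G) * k" by (rule dvdE)
  have "card ?A dvd card (carrier G)" using subgroup_card_dvd[OF A] by (simp add: Coset.order_def)
  then have "k dvd p" unfolding e k using Zpos by (simp add: mult.commute[of p])
  moreover have "k \<noteq> 1" using lt k by auto
  ultimately have "k = p" using p unfolding prime_nat_iff by blast
  then have "card ?A = card (carrier G)" using e k by simp
  then have all: "?A = carrier G" using Asub fin by (simp add: card_subset_eq)
  have "x \<otimes> g = g \<otimes> x" if "g \<in> carrier G" for g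
  proof -
    have "g \<in> ?A" using that all by simp
    then obtain n i where n: "n \<in> group_center G" "g = n \<otimes> x [^] (i::nat)" by (rule adjoinE)
    have nc: "n \<in> carrier G" "x \<otimes> n = n \<otimes> x"
      using center_carrier[OF n(1)] center_commute[OF n(1) x(1), symmetric] .
    have "x \<otimes> g = (x \<otimes> n) \<otimes> x [^] i" unfolding n(2) using nc(1) x(1) by (simp add: m_assoc)
    also have "\<dots> = n \<otimes> (x \<otimes> x [^] i)" unfolding nc(2) using nc(1) x(1) by (simp add: m_assoc)
    also have "x \<otimes> x [^] i = x [^] i \<otimes> x" using nat_pow_Suc2[OF x(1), of i] by simp
    also have "n \<otimes> (x [^] i \<otimes> x) = g \<otimes> x" unfolding n(2) using nc(1) x(1) by (simp add: m_assoc)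
    finally show ?thesis .
  qed
  then have "x \<in> group_center G" using x(1) by (simp add: group_center_def)
  then show False using x(2) by simp
qed

text \<open>Excluding centres of index p leaves order p for the centre and makes the quotient of
  order p^2 abelian, so commutators are central. If c^p were not central, the coset of c would
  generate the quotient, and c would commute with everything.\<close>

lemma nonabelian_order_p_cubed:
  fixes G (structure)
  assumes "group G" and p: "Factorial_Ring.prime p" and ord: "Coset.order G = p ^ 3"
    and nab: "a \<in> carrier G" "b \<in> carrier G" "a \<otimes> b \<noteq> b \<otimes> a"
  shows "central_commutator_group G p"
proof -
  interpret group G by fact
  let ?Z = "group_center G"
  have p1: "p > 1" using p by (rule prime_gt_1_nat)
  have ordc: "card (carrier G) = p ^ 3" using ord by (simp add: Coset.order_def)
  have fin: "finite (carrier G)" using ordc p1 by (metis card.infinite power_not_zero not_one_less_zero)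
  have sub: "?Z \<subseteq> carrier G" by (auto simp: group_center_def)
  interpret N: normal ?Z G by (rule normal_center)
  have "card ?Z dvd p ^ 3" using subgroup_card_dvd[OF subgroup_center] ord by simp
  then obtain j where j: "j \<le> 3" "card ?Z = p ^ j" using p divides_primepow_nat by blast
  have "p dvd card ?Z" using prime_dvd_card_center[OF p ord] by simp
  then have "j \<noteq> 0" using j p1 by (metis power_0 nat_dvd_1_iff_1 less_irrefl)
  moreover have "j \<noteq> 3"
  proof
    assume "j = 3"
    then have "?Z = carrier G" using sub fin ordc j by (intro card_subset_eq) auto
    then have "a \<in> ?Z" using nab(1) by blast
    then show False using nab(2,3) unfolding group_center_def by blast
  qed
  moreover have "j \<noteq> 2"
  proof
    assume "j = 2"
    then have "card (carrier G) = p * card ?Z" unfolding ordc j(2) by (simp add: power3_eq_cube power2_eq_square)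
    then show False using card_ne_prime_mult_card_center[OF p fin] by blast
  qed
  ultimately have "j = 1" using j(1) by linarith
  then have cZ: "card ?Z = p" using j by simp
  let ?Q = "G Mod ?Z"
  interpret Q: group ?Q by (rule N.factorgroup_is_group)
  interpret hQ: group_hom G ?Q "\<lambda>a. ?Z #> a"
    using N.r_coset_hom_Mod by unfold_locales
  have "card (rcosets ?Z) * card ?Z = p ^ 3" using lagrange[OF subgroup_center] ord by simp
  then have "card (rcosets ?Z) * p = p ^ 2 * p" using cZ by (simp add: power3_eq_cube power2_eq_square)
  then have cQ: "card (carrier ?Q) = p ^ 2" using p1 by (simp add: FactGroup_def)
  then have finQ: "finite (carrier ?Q)" using p1 by (metis card.infinite power_not_zero not_one_less_zero)
  have ordQ: "Coset.order ?Q = p ^ 2" using cQ by (simp add: Coset.order_def)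
  have subQ: "group_center ?Q \<subseteq> carrier ?Q" by (rule subgroup.subset[OF Q.subgroup_center])
  have "card (group_center ?Q) dvd p ^ 2" using Q.subgroup_card_dvd[OF Q.subgroup_center] unfolding ordQ .
  then obtain i where i: "i \<le> 2" "card (group_center ?Q) = p ^ i" using p divides_primepow_nat by blast
  have "p dvd card (group_center ?Q)" using Q.prime_dvd_card_center[OF p ordQ] by simp
  then have "i \<noteq> 0" using i p1 by (metis power_0 nat_dvd_1_iff_1 less_irrefl)
  moreover have "i \<noteq> 1"
  proof
    assume "i = 1"
    then have "card (carrier ?Q) = p * card (group_center ?Q)" unfolding cQ i(2) by (simp add: power2_eq_square)
    then show False using Q.card_ne_prime_mult_card_center[OF p finQ] by blast
  qed
  ultimately have "i = 2" using i(1) by linarith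
  then have ZQ: "group_center ?Q = carrier ?Q" using subQ finQ cQ i by (intro card_subset_eq) auto
  have Qcomm: "A \<otimes>\<^bsub>?Q\<^esub> B = B \<otimes>\<^bsub>?Q\<^esub> A" if "A \<in> carrier ?Q" "B \<in> carrier ?Q" for A B
  proof -
    have "A \<in> group_center ?Q" using that(1) ZQ by simp
    then show ?thesis using that(2) unfolding group_center_def by blast
  qed
  have coset_one: "c \<in> ?Z" if "c \<in> carrier G" "?Z #> c = \<one>\<^bsub>?Q\<^esub>" for c
    by (rule coset_join1[OF _ that(1) subgroup_center]) (use that(2) in \<open>simp add: FactGroup_def\<close>)
  have cl: "?Z #> c \<in> carrier ?Q" if "c \<in> carrier G" for c using hQ.hom_closed[OF that] .
  show ?thesis
  proof
    show "Factorial_Ring.prime p" "finite (carrier G)" "card ?Z = p" by fact+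
    fix c assume c: "c \<in> carrier G"
    show "commutator G c d \<in> ?Z" if d: "d \<in> carrier G" for d
    proof (rule coset_one)
      have "?Z #> commutator G c d = commutator ?Q (?Z #> c) (?Z #> d)"
        unfolding commutator_def using c d by (simp del: N.rcos_sum)
      also have "\<dots> = \<one>\<^bsub>?Q\<^esub>" using Q.commutator_eq_one_iff[OF cl[OF c] cl[OF d]] Qcomm[OF cl[OF c] cl[OF d]] by blast
      finally show "?Z #> commutator G c d = \<one>\<^bsub>?Q\<^esub>" .
    qed (use c d in simp)
    show "c [^] p \<in> ?Z"
    proof (rule ccontr)
      assume no: "c [^] p \<notin> ?Z"
      let ?c = "?Z #> c"
      have cc: "?c \<in> carrier ?Q" using cl[OF c] .
      have "?c [^]\<^bsub>?Q\<^esub> p \<noteq> \<one>\<^bsub>?Q\<^esub>"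
      proof
        assume "?c [^]\<^bsub>?Q\<^esub> p = \<one>\<^bsub>?Q\<^esub>"
        then have "?Z #> (c [^] p) = \<one>\<^bsub>?Q\<^esub>" using hQ.hom_nat_pow[OF c, of p] by (rule trans[rotated])
        then show False using no coset_one[OF nat_pow_closed[OF c]] by blast
      qed
      then have nd: "\<not> Q.ord ?c dvd p" using Q.pow_eq_id[OF cc] by blast
      have "Q.ord ?c dvd p ^ 2" using Q.ord_dvd_group_order[OF cc] unfolding ordQ .
      then obtain l where l: "l \<le> 2" "Q.ord ?c = p ^ l" using p divides_primepow_nat by blast
      have "l \<noteq> 0" "l \<noteq> 1" using nd unfolding l(2) by (metis power_0 one_dvd, metis power_one_right dvd_refl)
      then have "l = 2" using l(1) by linarith
      then have ordc2: "Q.ord ?c = p ^ 2" using l(2) by simp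
      have "carrier ?Q = (\<lambda>i::nat. ?c [^]\<^bsub>?Q\<^esub> i) ` {0..Q.ord ?c - 1}"
      proof (rule card_subset_eq[symmetric, OF finQ])
        show "(\<lambda>i::nat. ?c [^]\<^bsub>?Q\<^esub> i) ` {0..Q.ord ?c - 1} \<subseteq> carrier ?Q" using cc by auto
        have "card ((\<lambda>i::nat. ?c [^]\<^bsub>?Q\<^esub> i) ` {0..Q.ord ?c - 1}) = card {0..Q.ord ?c - 1}"
          by (rule card_image[OF Q.ord_inj[OF cc]])
        then show "card ((\<lambda>i::nat. ?c [^]\<^bsub>?Q\<^esub> i) ` {0..Q.ord ?c - 1}) = card (carrier ?Q)"
          using ordc2 cQ p1 by simp
      qed
      then have gen: "\<exists>i::nat. ?Z #> g = ?c [^]\<^bsub>?Q\<^esub> i" if "g \<in> carrier G" for g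
        using cl[OF that] by blast
      have "c \<otimes> g = g \<otimes> c" if g: "g \<in> carrier G" for g
      proof -
        obtain i where "?Z #> g = ?c [^]\<^bsub>?Q\<^esub> (i::nat)" using gen[OF g] ..
        then have "?Z #> g = ?Z #> (c [^] i)" using hQ.hom_nat_pow[OF c, of i] by simp
        moreover have "g \<in> ?Z #> g" using rcos_self[OF g subgroup_center] .
        ultimately obtain z where z: "z \<in> ?Z" "g = z \<otimes> c [^] i" by (auto simp: r_coset_def)
        have zc: "z \<in> carrier G" "z \<otimes> c = c \<otimes> z"
          using center_carrier[OF z(1)] center_commute[OF z(1) c] .
        have "c \<otimes> g = (c \<otimes> z) \<otimes> c [^] i" unfolding z(2) using zc(1) c by (simp add: m_assoc)
        also have "\<dots> = z \<otimes> (c \<otimes> c [^] i)" unfolding zc(2)[symmetric] using zc(1) c by (simp add: m_assoc)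
        also have "c \<otimes> c [^] i = c [^] i \<otimes> c" using nat_pow_Suc2[OF c, of i] by simp
        also have "z \<otimes> (c [^] i \<otimes> c) = g \<otimes> c" unfolding z(2) using zc(1) c by (simp add: m_assoc)
        finally show ?thesis .
      qed
      then have "c \<in> ?Z" using c unfolding group_center_def by blast
      then have "c [^] p \<in> ?Z" by (rule subgroup_nat_pow_closed[OF subgroup_center])
      then show False using no by blast
    qed
  qed
qed

section \<open>Generators of nonabelian groups of order p^3\<close>

context central_commutator_group
begin

text \<open>The centre and the two adjunctions form a strictly increasing chain of p-power orders
  that starts at p and is bounded by p^3, so the last one is the whole group.\<close>

lemma generated_by_noncommuting:
  assumes ord: "card (carrier G) = p ^ 3"
    and x: "x \<in> carrier G" and y: "y \<in> carrier G" and xy: "x \<otimes> y \<noteq> y \<otimes> x"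
  shows "adjoin (adjoin Z x) y = carrier G" "subgroup (adjoin Z x) G" "y \<notin> adjoin Z x"
proof -
  have Zx: "z \<otimes> x = x \<otimes> z" if "z \<in> Z" for z using Z_comm[OF that x] .
  show A: "subgroup (adjoin Z x) G"
    by (rule subgroup_adjoin_central[OF finite_carrier Z_subgroup x Zx])
  have comm_x: "a \<otimes> x = x \<otimes> a" if "a \<in> adjoin Z x" for a
  proof -
    obtain z i where z: "z \<in> Z" "a = z \<otimes> x [^] (i::nat)" using \<open>a \<in> adjoin Z x\<close> by (rule adjoinE)
    have "om a x = om z x * om (x [^] i) x" unfolding z(2) using z(1) Z_carrier x by (intro om_mult_left) auto
    also have "\<dots> = 1" using om_center[OF z(1) x] om_pow_left[OF x x] om_self[OF x] by simp
    finally show ?thesis using om_eq_1_iff[of a x] x subgroup.mem_carrier[OF A that] by simp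
  qed
  then show y': "y \<notin> adjoin Z x" using xy by metis
  have xZ: "x \<notin> Z" using xy Z_comm y by metis
  have ordA: "card (adjoin Z x) > p"
  proof -
    have "Z \<subset> adjoin Z x" using subset_adjoin[of Z x] mem_adjoin[OF Z_subgroup x] xZ Z_carrier by blast
    then show ?thesis using psubset_card_mono[OF finite_subgroup[OF A]] card_center by metis
  qed
  have B: "subgroup (adjoin (adjoin Z x) y) G"
  proof (rule subgroup_adjoin[OF finite_carrier A y])
    fix n and i :: nat assume "n \<in> adjoin Z x"
    then have "commutator G (y [^] i) n \<in> Z"
      using y subgroup.mem_carrier[OF A] by (intro commutator_in_center) auto
    then show "commutator G (y [^] i) n \<in> adjoin Z x" using subset_adjoin[of Z x] Z_carrier by blast
  qed
  have Asub: "adjoin Z x \<subseteq> carrier G" using A by (rule subgroup.subset)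
  have "adjoin Z x \<subset> adjoin (adjoin Z x) y"
    using subset_adjoin[OF Asub, of y] mem_adjoin[OF A y] y' by blast
  then have lt: "card (adjoin Z x) < card (adjoin (adjoin Z x) y)"
    by (rule psubset_card_mono[OF finite_subgroup[OF B]])
  have pow: "\<exists>j\<le>3. card S = p ^ j" if "subgroup S G" for S
    using subgroup_card_dvd[OF that] ord prime_p by (simp add: Coset.order_def divides_primepow_nat)
  obtain j where j: "card (adjoin Z x) = p ^ j" using pow[OF A] by blast
  obtain k where k: "k \<le> 3" "card (adjoin (adjoin Z x) y) = p ^ k" using pow[OF B] by blast
  have "j > 1" using ordA p_gt_1 unfolding j by (metis power_one_right power_less_imp_less_exp)
  moreover have "k > j" using lt p_gt_1 unfolding j k(2) by (metis power_less_imp_less_exp)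
  ultimately have "k = 3" using k(1) by linarith
  then have "card (adjoin (adjoin Z x) y) = card (carrier G)" using k ord by simp
  then show "adjoin (adjoin Z x) y = carrier G"
    using card_subset_eq[OF finite_carrier subgroup.subset[OF B]] by simp
qed

text \<open>The \<open>p + 1\<close> elements \<open>x\<close> and \<open>y x\<^sup>i\<close> with \<open>i < p\<close> are pairwise noncommuting, while their \<open>p\<close>-th
  powers lie in the centre, which has only \<open>p\<close> elements.\<close>

lemma noncommuting_same_power:
  assumes xy: "x0 \<in> carrier G" "y0 \<in> carrier G" "x0 \<otimes> y0 \<noteq> y0 \<otimes> x0"
  obtains x y where "x \<in> carrier G" "y \<in> carrier G" "x \<otimes> y \<noteq> y \<otimes> x" "x [^] p = y [^] p"
proof -
  define e where "e i = (if i < p then y0 \<otimes> x0 [^] i else x0)" for i :: nat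
  have ec: "e i \<in> carrier G" for i using xy by (simp add: e_def)
  have om0: "om y0 x0 \<noteq> 1" using xy om_eq_1_iff by metis
  have w: "commutator G y0 x0 \<in> Z" "commutator G y0 x0 \<noteq> \<one>"
    using commutator_in_center xy commutator_eq_one_iff by metis+
  have nc: "om (e i) (e j) \<noteq> 1" if ij: "i < j" "j \<le> p" for i j
  proof (cases "j < p")
    case True
    have "om (e i) (e j) = om y0 x0 ^ j * inverse (om y0 x0) ^ i"
      using ij True om_adjoin[OF xy(2,2,1), of i j] om_self[OF xy(2)] by (simp add: e_def)
    moreover have "om y0 x0 ^ i \<noteq> om y0 x0 ^ j"
      using inj_on_zchar_power[OF w] ij True unfolding om_def inj_on_def by auto
    moreover have "om y0 x0 ^ i = om y0 x0 ^ j" if "om y0 x0 ^ j * inverse (om y0 x0) ^ i = 1"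
      using that om_nonzero[OF xy(2,1)] by (simp add: power_inverse field_simps)
    ultimately show ?thesis by metis
  next
    case False
    then have "om (e i) (e j) = om y0 x0 * om (x0 [^] i) x0"
      using ij xy by (simp add: e_def om_mult_left)
    then show ?thesis using om0 om_pow_left[OF xy(1,1)] om_self[OF xy(1)] by simp
  qed
  have "(\<lambda>i. e i [^] p) ` {..p} \<subseteq> Z" using pow_in_center ec by blast
  then have "card ((\<lambda>i. e i [^] p) ` {..p}) \<le> p" using card_mono[OF finite_Z] card_center by metis
  then have "\<not> inj_on (\<lambda>i. e i [^] p) {..p}" by (intro pigeonhole) simp
  then obtain i j where "i \<in> {..p}" "j \<in> {..p}" "i \<noteq> j" "e i [^] p = e j [^] p" by (auto simp: inj_on_def)
  then obtain i j where ij: "i < j" "j \<le> p" "e i [^] p = e j [^] p" by (metis atMost_iff nat_neq_iff)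
  have "e i \<otimes> e j \<noteq> e j \<otimes> e i" using nc[OF ij(1,2)] om_eq_1_iff[OF ec ec] by metis
  then show ?thesis using that ec ij(3) by blast
qed

text \<open>Exactly one of \<open>e = 0\<close> and \<open>e = 1\<close> is realised by a given group; for odd \<open>p\<close> the former
  means exponent \<open>p\<close>, and for \<open>p = 2\<close> it distinguishes the dihedral from the quaternion group.\<close>

lemma standard_generators:
  assumes ab: "a \<in> carrier G" "b \<in> carrier G" "a \<otimes> b \<noteq> b \<otimes> a"
  obtains x y z and e :: nat where "x \<in> carrier G" "y \<in> carrier G" "z \<in> Z" "z \<noteq> \<one>"
    "y \<otimes> x = x \<otimes> y \<otimes> z" "x [^] p = z [^] e" "y [^] p = z [^] e" "e = 0 \<or> e = 1"
proof -
  obtain x y where xy: "x \<in> carrier G" "y \<in> carrier G" "x \<otimes> y \<noteq> y \<otimes> x" "x [^] p = y [^] p"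
    using noncommuting_same_power[OF ab] .
  have rel: "v \<otimes> u = u \<otimes> v \<otimes> commutator G v u" if "u \<in> carrier G" "v \<in> carrier G" for u v
    using commutator_swap[OF that(2,1)] Z_comm[OF commutator_in_center[OF that(2,1)], of "u \<otimes> v"] that by simp
  let ?z = "commutator G y x"
  have z: "?z \<in> Z" "?z \<noteq> \<one>"
    using commutator_in_center xy commutator_eq_one_iff by metis+
  show ?thesis
  proof (cases "x [^] p = \<one>")
    case True
    show ?thesis
    proof (rule that[OF xy(1,2) z rel[OF xy(1,2)], of 0])
      show "x [^] p = ?z [^] (0::nat)" using True by simp
      show "y [^] p = ?z [^] (0::nat)" using True xy(4) by simp
    qed simp
  next
    case False
    have "x [^] p \<in> (\<lambda>i::nat. ?z [^] i) ` {..<p}" using pow_in_center[OF xy(1)] Z_eq_powers[OF z] by metis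
    then obtain k where k: "x [^] p = ?z [^] (k::nat)" by blast
    have nk: "\<not> p dvd k" using False k Z_pow_eq_one_iff[OF z] by metis
    \<comment> \<open>Both p-th powers equal the k-th power of the commutator. Passing to k-th
      powers of the generators raises the exponent of the common p-th power from k to k * k and that
      of the commutator from 1 to k * k, so that they coincide.\<close>
    define u v where "u = x [^] k" and "v = y [^] k"
    have uv: "u \<in> carrier G" "v \<in> carrier G" using xy by (simp_all add: u_def v_def)
    have "om v u = (om y x ^ k) ^ k" using xy by (simp add: u_def v_def om_pow_left om_pow_right)
    also have "\<dots> = zchar ?z ^ (k * k)" by (simp add: om_def power_mult)
    also have "\<dots> = zchar (?z [^] (k * k))" using character_on_nat_pow[OF Z_subgroup zchar_character z(1)] by simp
    finally have zeq: "zchar (commutator G v u) = zchar (?z [^] (k * k))" by (simp add: om_def)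
    have zkk: "?z [^] (k * k) \<in> Z" using subgroup_nat_pow_closed[OF Z_subgroup z(1)] .
    have cvu: "commutator G v u \<in> Z" using commutator_in_center uv by blast
    have "zchar (commutator G v u \<otimes> inv (?z [^] (k * k))) = 1"
      using character_on_mult[OF zchar_character cvu Z_inv[OF zkk]] character_on_inv[OF Z_subgroup zchar_character zkk]
        zeq character_on_nonzero[OF zchar_character zkk] by simp
    then have "commutator G v u \<otimes> inv (?z [^] (k * k)) = \<one>" by (rule zchar_faithful[OF Z_mult[OF cvu Z_inv[OF zkk]]])
    then have c: "commutator G v u = ?z [^] (k * k)"
      using inv_solve_right'[of \<one> "commutator G v u" "?z [^] (k * k)"] cvu zkk Z_carrier by simp
    have zc: "?z \<in> carrier G" using z Z_carrier by blast
    have pows: "u [^] p = ?z [^] (k * k)" "v [^] p = ?z [^] (k * k)"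
    proof -
      have "u [^] p = (x [^] p) [^] k" unfolding u_def using xy(1) by (simp add: nat_pow_pow mult.commute)
      then show "u [^] p = ?z [^] (k * k)" unfolding k using zc by (simp add: nat_pow_pow)
      have "v [^] p = (y [^] p) [^] k" unfolding v_def using xy(2) by (simp add: nat_pow_pow mult.commute)
      then show "v [^] p = ?z [^] (k * k)" unfolding xy(4)[symmetric] k using zc by (simp add: nat_pow_pow)
    qed
    have "\<not> p dvd k * k" using nk prime_p by (simp add: prime_dvd_mult_iff)
    then have ne: "commutator G v u \<noteq> \<one>" unfolding c using Z_pow_eq_one_iff[OF z] by blast
    have c1: "commutator G v u [^] (1::nat) = commutator G v u" using Z_carrier[OF cvu] by simp
    show ?thesis
    proof (rule that[OF uv cvu ne rel[OF uv], of 1])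
      show "u [^] p = commutator G v u [^] (1::nat)" using pows(1) unfolding c[symmetric] c1 .
      show "v [^] p = commutator G v u [^] (1::nat)" using pows(2) unfolding c[symmetric] c1 .
    qed simp
  qed
qed

end

section \<open>Normal forms in Heisenberg groups\<close>

definition heis_word :: "('a, 'm) monoid_scheme \<Rightarrow> 'a \<Rightarrow> 'a \<Rightarrow> 'a \<Rightarrow> nat \<Rightarrow> nat \<Rightarrow> nat \<Rightarrow> 'a" where
  "heis_word G x y z a b c = x [^]\<^bsub>G\<^esub> a \<otimes>\<^bsub>G\<^esub> y [^]\<^bsub>G\<^esub> b \<otimes>\<^bsub>G\<^esub> z [^]\<^bsub>G\<^esub> c"

lemma (in group) nat_pow_commute:
  assumes "u \<in> carrier G" "v \<in> carrier G" "u \<otimes> v = v \<otimes> u"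
  shows "u [^] (i::nat) \<otimes> v [^] (j::nat) = v [^] j \<otimes> u [^] i"
proof -
  have "u \<in> {b \<in> carrier G. b \<otimes> v = v \<otimes> b}" using assms by simp
  then have "u [^] i \<in> {b \<in> carrier G. b \<otimes> v = v \<otimes> b}"
    by (rule subgroup_nat_pow_closed[OF subgroup_centralizer[OF assms(2)]])
  then have "v \<in> {b \<in> carrier G. b \<otimes> u [^] i = u [^] i \<otimes> b}" using assms(2) by simp
  then have "v [^] j \<in> {b \<in> carrier G. b \<otimes> u [^] i = u [^] i \<otimes> b}"
    using assms(1) by (intro subgroup_nat_pow_closed[OF subgroup_centralizer]) simp_all
  then show ?thesis by simp
qed

text \<open>Images of the standard generators of the integral Heisenberg group. No orders are
  imposed, so the word calculus also applies in the infinite central extension, and unreduced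
  exponents keep \<open>word_mult\<close> free of carries when the p-th power of \<open>x\<close> is
  a power of \<open>z\<close>.\<close>

locale heisenberg_triple = group G for G (structure) +
  fixes x y z
  assumes x: "x \<in> carrier G" and y: "y \<in> carrier G" and z: "z \<in> carrier G"
    and yx: "y \<otimes> x = x \<otimes> y \<otimes> z"
    and zx: "z \<otimes> x = x \<otimes> z" and zy: "z \<otimes> y = y \<otimes> z"
begin

abbreviation "word \<equiv> heis_word G x y z"

lemma word_closed [simp]: "word a b c \<in> carrier G"
  using x y z by (simp add: heis_word_def)

lemma pow_y_x: "y [^] (b::nat) \<otimes> x = x \<otimes> y [^] b \<otimes> z [^] b"
proof (induction b)
  case 0 then show ?case using x by simp
next
  case (Suc b)
  have zyb: "z [^] b \<otimes> y = y \<otimes> z [^] b" using nat_pow_commute[OF z y zy, of b 1] z y by simp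
  have "y [^] Suc b \<otimes> x = y [^] b \<otimes> (y \<otimes> x)" using x y by (simp add: m_assoc)
  also have "\<dots> = (y [^] b \<otimes> x) \<otimes> y \<otimes> z" unfolding yx using x y z by (simp add: m_assoc)
  also have "\<dots> = x \<otimes> y [^] b \<otimes> (z [^] b \<otimes> y) \<otimes> z" unfolding Suc using x y z by (simp add: m_assoc)
  also have "\<dots> = x \<otimes> y [^] Suc b \<otimes> z [^] Suc b" unfolding zyb using x y z by (simp add: m_assoc)
  finally show ?case .
qed

lemma pow_y_pow_x: "y [^] (b::nat) \<otimes> x [^] (a::nat) = x [^] a \<otimes> y [^] b \<otimes> z [^] (b * a)"
proof (induction a)
  case 0 then show ?case using y by simp
next
  case (Suc a)
  have zxa: "z [^] (b * a) \<otimes> x = x \<otimes> z [^] (b * a)" using nat_pow_commute[OF z x zx, of "b * a" 1] z x by simp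
  have "y [^] b \<otimes> x [^] Suc a = (y [^] b \<otimes> x [^] a) \<otimes> x" using x y by (simp add: m_assoc)
  also have "\<dots> = x [^] a \<otimes> y [^] b \<otimes> (z [^] (b * a) \<otimes> x)" unfolding Suc using x y z by (simp add: m_assoc)
  also have "\<dots> = x [^] a \<otimes> (y [^] b \<otimes> x) \<otimes> z [^] (b * a)" unfolding zxa using x y z by (simp add: m_assoc)
  also have "\<dots> = x [^] Suc a \<otimes> y [^] b \<otimes> (z [^] b \<otimes> z [^] (b * a))"
    unfolding pow_y_x using x y z by (simp add: m_assoc)
  also have "z [^] b \<otimes> z [^] (b * a) = z [^] (b * Suc a)" using nat_pow_mult[OF z] by simp
  finally show ?case .
qed

lemma word_mult: "word a b c \<otimes> word a' b' c' = word (a + a') (b + b') (c + c' + b * a')"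
proof -
  have [simp]: "x [^] (i::nat) \<in> carrier G" "y [^] (i::nat) \<in> carrier G" "z [^] (i::nat) \<in> carrier G" for i
    using x y z by simp_all
  note zx' = nat_pow_commute[OF z x zx] and zy' = nat_pow_commute[OF z y zy]
  have "word a b c \<otimes> word a' b' c' = x [^] a \<otimes> y [^] b \<otimes> (z [^] c \<otimes> x [^] a') \<otimes> y [^] b' \<otimes> z [^] c'"
    by (simp add: heis_word_def m_assoc)
  also have "\<dots> = x [^] a \<otimes> (y [^] b \<otimes> x [^] a') \<otimes> (z [^] c \<otimes> y [^] b') \<otimes> z [^] c'"
    unfolding zx' by (simp add: m_assoc)
  also have "\<dots> = (x [^] a \<otimes> x [^] a') \<otimes> y [^] b \<otimes> (z [^] (b * a') \<otimes> y [^] b') \<otimes> (z [^] c \<otimes> z [^] c')"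
    unfolding zy'[of c] pow_y_pow_x by (simp add: m_assoc)
  also have "\<dots> = (x [^] a \<otimes> x [^] a') \<otimes> (y [^] b \<otimes> y [^] b') \<otimes> (z [^] (b * a') \<otimes> (z [^] c \<otimes> z [^] c'))"
    unfolding zy' by (simp add: m_assoc)
  also have "\<dots> = word (a + a') (b + b') (b * a' + (c + c'))"
    unfolding heis_word_def nat_pow_mult[OF x] nat_pow_mult[OF y] nat_pow_mult[OF z] ..
  finally show ?thesis by (simp add: add.commute)
qed

end

text \<open>A form of von Dyck's theorem. Exponents are natural numbers, so equality of two words is
  reduced to triviality by multiplying both with a word for an inverse.\<close>

lemma heisenberg_hom_exists:
  assumes "heisenberg_triple G x y z" "heisenberg_triple E u v w"
    and gen: "\<And>g. g \<in> carrier G \<Longrightarrow> \<exists>a b c. g = heis_word G x y z a b c"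
    and ker: "\<And>a b c. heis_word G x y z a b c = \<one>\<^bsub>G\<^esub> \<Longrightarrow> heis_word E u v w a b c = \<one>\<^bsub>E\<^esub>"
  obtains \<phi> where "\<phi> \<in> hom G E" "\<And>a b c. \<phi> (heis_word G x y z a b c) = heis_word E u v w a b c"
proof -
  interpret G: heisenberg_triple G x y z by fact
  interpret E: heisenberg_triple E u v w by fact
  have eq: "E.word a b c = E.word a' b' c'" if e: "G.word a b c = G.word a' b' c'" for a b c a' b' c'
  proof -
    obtain l m n where i: "inv\<^bsub>G\<^esub> (G.word a' b' c') = G.word l m n"
      using gen[OF G.inv_closed[OF G.word_closed]] by blast
    have "G.word a' b' c' \<otimes>\<^bsub>G\<^esub> G.word l m n = \<one>\<^bsub>G\<^esub>" unfolding i[symmetric] by (rule G.r_inv) simp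
    then have 1: "E.word a' b' c' \<otimes>\<^bsub>E\<^esub> E.word l m n = \<one>\<^bsub>E\<^esub>"
      unfolding G.word_mult E.word_mult by (rule ker)
    have "G.word a b c \<otimes>\<^bsub>G\<^esub> G.word l m n = \<one>\<^bsub>G\<^esub>" unfolding e i[symmetric] by (rule G.r_inv) simp
    then have 2: "E.word a b c \<otimes>\<^bsub>E\<^esub> E.word l m n = \<one>\<^bsub>E\<^esub>"
      unfolding G.word_mult E.word_mult by (rule ker)
    have "E.word a b c \<otimes>\<^bsub>E\<^esub> E.word l m n = E.word a' b' c' \<otimes>\<^bsub>E\<^esub> E.word l m n" unfolding 1 2 ..
    then show ?thesis by (rule E.right_cancel[THEN iffD1, rotated -1]) simp_all
  qed
  define \<phi> where "\<phi> g = (SOME h. \<exists>a b c. g = G.word a b c \<and> h = E.word a b c)" for g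
  have \<phi>: "\<phi> (G.word a b c) = E.word a b c" for a b c
  proof -
    have "\<exists>a' b' c'. G.word a b c = G.word a' b' c' \<and> \<phi> (G.word a b c) = E.word a' b' c'"
      unfolding \<phi>_def by (rule someI[of _ "E.word a b c"]) blast
    then obtain a' b' c' where "G.word a b c = G.word a' b' c'" "\<phi> (G.word a b c) = E.word a' b' c'" by blast
    then show ?thesis using eq by metis
  qed
  have "\<phi> \<in> hom G E"
  proof (rule homI)
    fix g assume "g \<in> carrier G"
    then obtain a b c where "g = G.word a b c" using gen by blast
    then show "\<phi> g \<in> carrier E" using \<phi> by simp
  next
    fix g h assume "g \<in> carrier G" "h \<in> carrier G"
    then obtain a b c a' b' c' where g: "g = G.word a b c" and h: "h = G.word a' b' c'" using gen by metis
    show "\<phi> (g \<otimes>\<^bsub>G\<^esub> h) = \<phi> g \<otimes>\<^bsub>E\<^esub> \<phi> h"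
      unfolding g h G.word_mult \<phi> E.word_mult ..
  qed
  then show ?thesis using that \<phi> by blast
qed

context central_commutator_group
begin

lemma noncommuting_of_relation:
  assumes "x \<in> carrier G" "y \<in> carrier G" "z \<in> Z" "z \<noteq> \<one>" "y \<otimes> x = x \<otimes> y \<otimes> z"
  shows "x \<otimes> y \<noteq> y \<otimes> x"
proof
  assume "x \<otimes> y = y \<otimes> x"
  then have "x \<otimes> y \<otimes> z = x \<otimes> y \<otimes> \<one>" using assms by simp
  then show False using assms(1,2,4) Z_carrier[OF assms(3)] by simp
qed

lemma heisenberg_triple_center:
  assumes "x \<in> carrier G" "y \<in> carrier G" "z \<in> Z" "y \<otimes> x = x \<otimes> y \<otimes> z"
  shows "heisenberg_triple G x y z"
  by unfold_locales (use assms Z_carrier Z_comm in blast)+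

lemma heis_word_p_multiples:
  assumes "group E" "x \<in> carrier E" "y \<in> carrier E" "z \<in> carrier E"
    and "x [^]\<^bsub>E\<^esub> (p::nat) = z [^]\<^bsub>E\<^esub> (e::nat)" "y [^]\<^bsub>E\<^esub> p = z [^]\<^bsub>E\<^esub> e"
  shows "heis_word E x y z (p * a) (p * b) c = z [^]\<^bsub>E\<^esub> (e * a + e * b + c)"
proof -
  interpret E: group E by fact
  have "x [^]\<^bsub>E\<^esub> (p * a) = z [^]\<^bsub>E\<^esub> (e * a)" "y [^]\<^bsub>E\<^esub> (p * b) = z [^]\<^bsub>E\<^esub> (e * b)"
    unfolding E.nat_pow_pow[OF assms(2), symmetric] E.nat_pow_pow[OF assms(3), symmetric] assms(5,6)
    by (rule E.nat_pow_pow[OF assms(4)])+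
  then show ?thesis unfolding heis_word_def by (simp only: E.nat_pow_mult[OF assms(4)])
qed

text \<open>The form with \<open>y\<close> and with \<open>x\<close> detects a and b modulo p; when
  p divides both, the word collapses to a power of \<open>z\<close>. The criterion involves only p,
  e and the exponents, so it is the same in all groups with generators of this type.\<close>

lemma heis_word_eq_one_iff:
  assumes xyz: "x \<in> carrier G" "y \<in> carrier G" "z \<in> Z" "z \<noteq> \<one>" "y \<otimes> x = x \<otimes> y \<otimes> z"
    and pw: "x [^] p = z [^] (e::nat)" "y [^] p = z [^] e"
  shows "heis_word G x y z a b c = \<one> \<longleftrightarrow> p dvd a \<and> p dvd b \<and> p dvd e * (a div p) + e * (b div p) + c"
proof -
  have zc: "z \<in> carrier G" using xyz Z_carrier by blast
  have nc: "x \<otimes> y \<noteq> y \<otimes> x" by (rule noncommuting_of_relation[OF xyz])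
  have om1: "om x y \<noteq> 1" "om y x \<noteq> 1" using nc om_eq_1_iff xyz(1,2) by metis+
  have omp: "om x y ^ p = 1" "om y x ^ p = 1"
    unfolding om_def using zchar_pow_p commutator_in_center xyz(1,2) by blast+
  have pa: "p dvd a \<and> p dvd b" if one: "heis_word G x y z a b c = \<one>"
  proof
    have omw: "om (heis_word G x y z a b c) t = om x t ^ a * om y t ^ b" if "t \<in> carrier G" for t
      unfolding heis_word_def using that xyz(1,2) zc om_center[OF subgroup_nat_pow_closed[OF Z_subgroup xyz(3)]]
      by (simp add: om_mult_left om_pow_left)
    have "om x y ^ a = 1" using omw[OF xyz(2)] om_self[OF xyz(2)] one om_center[OF Z_one xyz(2)] by simp
    then show "p dvd a" using complex_power_eq_one_iff_prime[OF prime_p omp(1) om1(1)] by blast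
    have "om y x ^ b = 1" using omw[OF xyz(1)] om_self[OF xyz(1)] one om_center[OF Z_one xyz(1)] by simp
    then show "p dvd b" using complex_power_eq_one_iff_prime[OF prime_p omp(2) om1(2)] by blast
  qed
  have "heis_word G x y z a b c = \<one> \<longleftrightarrow> p dvd e * (a div p) + e * (b div p) + c" if "p dvd a" "p dvd b"
  proof -
    have "p * (a div p) = a" "p * (b div p) = b" using that by simp_all
    then have "heis_word G x y z a b c = z [^] (e * (a div p) + e * (b div p) + c)"
      using heis_word_p_multiples[OF is_group xyz(1,2) zc pw, of "a div p" "b div p" c] by simp
    then show ?thesis using Z_pow_eq_one_iff[OF xyz(3,4)] by simp
  qed
  then show ?thesis using pa by blast
qed

lemma heis_word_exists:
  assumes ord: "card (carrier G) = p ^ 3"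
    and xyz: "x \<in> carrier G" "y \<in> carrier G" "z \<in> Z" "z \<noteq> \<one>" "y \<otimes> x = x \<otimes> y \<otimes> z"
    and g: "g \<in> carrier G"
  shows "\<exists>a b c. g = heis_word G x y z a b c"
proof -
  have zc: "z \<in> carrier G" using xyz Z_carrier by blast
  have nc: "x \<otimes> y \<noteq> y \<otimes> x" by (rule noncommuting_of_relation[OF xyz])
  have "g \<in> adjoin (adjoin Z x) y" using g generated_by_noncommuting(1)[OF ord xyz(1,2) nc] by simp
  then obtain h b where h: "h \<in> adjoin Z x" "g = h \<otimes> y [^] (b::nat)" by (rule adjoinE)
  obtain w a where w: "w \<in> Z" "h = w \<otimes> x [^] (a::nat)" using h(1) by (rule adjoinE)
  have "w \<in> (\<lambda>i::nat. z [^] i) ` {..<p}" using w(1) Z_eq_powers[OF xyz(3,4)] by metis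
  then obtain c where c: "w = z [^] (c::nat)" by blast
  have "g = w \<otimes> (x [^] a \<otimes> y [^] b)" unfolding h(2) w(2) using Z_carrier[OF w(1)] xyz(1,2) by (simp add: m_assoc)
  also have "\<dots> = heis_word G x y z a b c"
    unfolding heis_word_def c[symmetric] using xyz(1,2) by (intro Z_comm[OF w(1)]) simp
  finally show ?thesis by blast
qed

end

text \<open>Words become trivial under the same condition in both groups, so matching the generators
  is well defined and injective.\<close>

lemma same_type_isomorphic:
  assumes G: "central_commutator_group G p" "card (carrier G) = p ^ 3"
    and gG: "x \<in> carrier G" "y \<in> carrier G" "z \<in> group_center G" "z \<noteq> \<one>\<^bsub>G\<^esub>" "y \<otimes>\<^bsub>G\<^esub> x = x \<otimes>\<^bsub>G\<^esub> y \<otimes>\<^bsub>G\<^esub> z"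
      "x [^]\<^bsub>G\<^esub> p = z [^]\<^bsub>G\<^esub> (e::nat)" "y [^]\<^bsub>G\<^esub> p = z [^]\<^bsub>G\<^esub> e"
    and H: "central_commutator_group H p" "card (carrier H) = p ^ 3"
    and gH: "u \<in> carrier H" "v \<in> carrier H" "w \<in> group_center H" "w \<noteq> \<one>\<^bsub>H\<^esub>" "v \<otimes>\<^bsub>H\<^esub> u = u \<otimes>\<^bsub>H\<^esub> v \<otimes>\<^bsub>H\<^esub> w"
      "u [^]\<^bsub>H\<^esub> p = w [^]\<^bsub>H\<^esub> e" "v [^]\<^bsub>H\<^esub> p = w [^]\<^bsub>H\<^esub> e"
  shows "G \<cong> H"
proof -
  interpret G: central_commutator_group G p by fact
  interpret H: central_commutator_group H p by fact
  note kG = G.heis_word_eq_one_iff[OF gG] and kH = H.heis_word_eq_one_iff[OF gH]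
  note wG = G.heis_word_exists[OF G(2) gG(1-5)] and wH = H.heis_word_exists[OF H(2) gH(1-5)]
  have tG: "heisenberg_triple G x y z" by (rule G.heisenberg_triple_center[OF gG(1-3,5)])
  have tH: "heisenberg_triple H u v w" by (rule H.heisenberg_triple_center[OF gH(1-3,5)])
  obtain \<phi> where \<phi>: "\<phi> \<in> hom G H" "\<And>a b c. \<phi> (heis_word G x y z a b c) = heis_word H u v w a b c"
    using heisenberg_hom_exists[OF tG tH wG] kG kH by metis
  interpret f: group_hom G H \<phi> using \<phi>(1) by unfold_locales
  have "\<phi> \<in> iso G H"
    unfolding f.iso_iff
  proof (intro conjI ballI impI subsetI)
    fix h assume "h \<in> carrier H"
    then obtain a b c where "h = heis_word H u v w a b c" using wH by blast
    then have "h = \<phi> (heis_word G x y z a b c)" using \<phi>(2) by simp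
    then show "h \<in> \<phi> ` carrier G" using heisenberg_triple.word_closed[OF tG] by blast
  next
    fix g assume g: "g \<in> carrier G" "\<phi> g = \<one>\<^bsub>H\<^esub>"
    then obtain a b c where abc: "g = heis_word G x y z a b c" using wG by blast
    then show "g = \<one>\<^bsub>G\<^esub>" using g(2) \<phi>(2) kG kH by metis
  qed
  then show ?thesis by (rule is_isoI)
qed

text \<open>The central extension whose elements \<open>(g, a)\<close> stand for the invertible elements \<open>a\<close> times
  the basis vector of \<open>g\<close> in the twisted group algebra.\<close>

definition cocycle_extension :: "('a, 'm) monoid_scheme \<Rightarrow> ('a \<times> 'a \<Rightarrow> complex) \<Rightarrow> ('a \<times> complex) monoid" where
  "cocycle_extension G \<alpha> =
     \<lparr>carrier = carrier G \<times> (UNIV - {0}),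
      monoid.mult = (\<lambda>r s. (fst r \<otimes>\<^bsub>G\<^esub> fst s, snd r * snd s * \<alpha> (fst r, fst s))),
      one = (\<one>\<^bsub>G\<^esub>, inverse (\<alpha> (\<one>\<^bsub>G\<^esub>, \<one>\<^bsub>G\<^esub>)))\<rparr>"

section \<open>The central extension of a cocycle and its splitting\<close>

context group
begin

lemma cocycle_extension_group:
  assumes \<alpha>: "\<alpha> \<in> cocycles G" shows "group (cocycle_extension G \<alpha>)"
proof (rule groupI)
  let ?E = "cocycle_extension G \<alpha>"
  fix r s t assume r: "r \<in> carrier ?E" and s: "s \<in> carrier ?E" and t: "t \<in> carrier ?E"
  have "snd r * snd s * \<alpha> (fst r, fst s) * snd t * \<alpha> (fst r \<otimes> fst s, fst t) =
    snd r * snd s * snd t * (\<alpha> (fst r, fst s) * \<alpha> (fst r \<otimes> fst s, fst t))" by (simp only: mult_ac)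
  also have "\<dots> = snd r * snd s * snd t * (\<alpha> (fst r, fst s \<otimes> fst t) * \<alpha> (fst s, fst t))"
    using cocycle_eq[OF \<alpha>, of "fst r" "fst s" "fst t"] r s t by (simp add: cocycle_extension_def mem_Times_iff)
  also have "\<dots> = snd r * (snd s * snd t * \<alpha> (fst s, fst t)) * \<alpha> (fst r, fst s \<otimes> fst t)" by (simp only: mult_ac)
  finally show "r \<otimes>\<^bsub>?E\<^esub> s \<otimes>\<^bsub>?E\<^esub> t = r \<otimes>\<^bsub>?E\<^esub> (s \<otimes>\<^bsub>?E\<^esub> t)"
    using r s t by (simp add: cocycle_extension_def mem_Times_iff m_assoc)
next
  note nz = cocycle_nonzero[OF \<alpha>]
  let ?E = "cocycle_extension G \<alpha>"
  fix r s assume "r \<in> carrier ?E" "s \<in> carrier ?E"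
  then show "r \<otimes>\<^bsub>?E\<^esub> s \<in> carrier ?E" using nz by (auto simp: cocycle_extension_def)
next
  show "\<one>\<^bsub>cocycle_extension G \<alpha>\<^esub> \<in> carrier (cocycle_extension G \<alpha>)"
    using cocycle_nonzero[OF \<alpha>] by (simp add: cocycle_extension_def)
next
  fix r assume r: "r \<in> carrier (cocycle_extension G \<alpha>)"
  then have "fst r \<in> carrier G" by (auto simp: cocycle_extension_def)
  then show "\<one>\<^bsub>cocycle_extension G \<alpha>\<^esub> \<otimes>\<^bsub>cocycle_extension G \<alpha>\<^esub> r = r"
    using cocycle_nonzero[OF \<alpha>, of \<one> \<one>] cocycle_one_left[OF \<alpha>, of "fst r"]
    by (simp add: cocycle_extension_def prod_eq_iff)
next
  fix r assume r: "r \<in> carrier (cocycle_extension G \<alpha>)"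
  note nz = cocycle_nonzero[OF \<alpha>]
  have c: "fst r \<in> carrier G" "snd r \<noteq> 0" using r by (auto simp: cocycle_extension_def)
  let ?i = "(inv (fst r), inverse (\<alpha> (\<one>, \<one>)) * inverse (snd r) * inverse (\<alpha> (inv (fst r), fst r)))"
  have "?i \<otimes>\<^bsub>cocycle_extension G \<alpha>\<^esub> r = \<one>\<^bsub>cocycle_extension G \<alpha>\<^esub>"
    using c nz[of "inv (fst r)" "fst r"] by (simp add: cocycle_extension_def field_simps)
  moreover have "?i \<in> carrier (cocycle_extension G \<alpha>)"
    using c nz[of "inv (fst r)" "fst r"] nz[of \<one> \<one>] by (simp add: cocycle_extension_def)
  ultimately show "\<exists>i\<in>carrier (cocycle_extension G \<alpha>). i \<otimes>\<^bsub>cocycle_extension G \<alpha>\<^esub> r = \<one>\<^bsub>cocycle_extension G \<alpha>\<^esub>" by blast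
qed

lemma cocycle_extension_mult:
  "(g, a) \<otimes>\<^bsub>cocycle_extension G \<alpha>\<^esub> (h, b) = (g \<otimes> h, a * b * \<alpha> (g, h))"
  by (simp add: cocycle_extension_def)

lemma cocycle_extension_carrier:
  "(g, a) \<in> carrier (cocycle_extension G \<alpha>) \<longleftrightarrow> g \<in> carrier G \<and> a \<noteq> 0"
  by (simp add: cocycle_extension_def)

lemma fst_cocycle_extension_pow: "fst (r [^]\<^bsub>cocycle_extension G \<alpha>\<^esub> (n::nat)) = fst r [^] n"
  by (induction n) (simp_all add: cocycle_extension_def nat_pow_def)

text \<open>Scalars are central in the extension; this is the freedom used to adjust p-th powers of
  lifts.\<close>

lemma cocycle_extension_pow_scale:
  "(g, s * a) [^]\<^bsub>cocycle_extension G \<alpha>\<^esub> (n::nat) = (g [^] n, s ^ n * snd ((g, a) [^]\<^bsub>cocycle_extension G \<alpha>\<^esub> n))"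
proof (induction n)
  case 0 then show ?case by (simp add: cocycle_extension_def nat_pow_def)
next
  case (Suc n)
  let ?E = "cocycle_extension G \<alpha>"
  have S: "r [^]\<^bsub>?E\<^esub> Suc n = r [^]\<^bsub>?E\<^esub> n \<otimes>\<^bsub>?E\<^esub> r" for r by (simp add: nat_pow_def)
  have "(g, a) [^]\<^bsub>?E\<^esub> n = (g [^] n, snd ((g, a) [^]\<^bsub>?E\<^esub> n))"
    using fst_cocycle_extension_pow[where r = "(g, a)" and n = n] by (metis fst_conv prod.collapse)
  then have "(g, a) [^]\<^bsub>?E\<^esub> Suc n = (g [^] Suc n, snd ((g, a) [^]\<^bsub>?E\<^esub> n) * a * \<alpha> (g [^] n, g))"
    unfolding S by (metis cocycle_extension_mult nat_pow_Suc)
  then have "snd ((g, a) [^]\<^bsub>?E\<^esub> Suc n) = snd ((g, a) [^]\<^bsub>?E\<^esub> n) * a * \<alpha> (g [^] n, g)" by simp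
  then show ?case unfolding S[of "(g, s * a)"] Suc cocycle_extension_mult by simp
qed

end

context central_commutator_group
begin

text \<open>Lifts of \<open>x\<close> and \<open>y\<close> to the central extension can be rescaled
  so that both p-th powers equal the lift of \<open>z\<close> prescribed by the commutator relation.
  All relations of \<open>G\<close> then hold among the lifts, so the extension splits, and a
  splitting amounts to a function with coboundary \<alpha>.\<close>

lemma cocycles_eq_coboundaries:
  assumes ord: "card (carrier G) = p ^ 3"
    and xyz: "x \<in> carrier G" "y \<in> carrier G" "z \<in> Z" "z \<noteq> \<one>" "y \<otimes> x = x \<otimes> y \<otimes> z"
    and pw: "x [^] p = z" "y [^] p = z"
    and \<alpha>: "\<alpha> \<in> cocycles G"
  shows "\<alpha> \<in> coboundaries G"
proof -
  let ?E = "cocycle_extension G \<alpha>"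
  interpret E: group ?E by (rule cocycle_extension_group[OF \<alpha>])
  note nz = cocycle_nonzero[OF \<alpha>]
  have zc: "z \<in> carrier G" using xyz Z_carrier by blast
  have p0: "p > 0" using p_gt_1 by simp
  define a where "a = snd ((x, 1) [^]\<^bsub>?E\<^esub> p)"
  define b where "b = snd ((y, 1) [^]\<^bsub>?E\<^esub> p)"
  have "(x, 1) [^]\<^bsub>?E\<^esub> p \<in> carrier ?E" "(y, 1) [^]\<^bsub>?E\<^esub> p \<in> carrier ?E"
    by (rule E.nat_pow_closed, simp add: cocycle_extension_carrier xyz)+
  then have ab: "a \<noteq> 0" "b \<noteq> 0" unfolding a_def b_def by (metis cocycle_extension_carrier prod.collapse)+
  obtain v where v: "v ^ p = a / b" using complex_nth_root_exists[OF p0] .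
  \<comment> \<open>Solves the commutator relation for the lift of \<open>z\<close>. It is
    independent of the scalars in the lifts of \<open>x\<close> and \<open>y\<close>, since each of
    these lifts occurs once on both sides.\<close>
  define w where "w = \<alpha> (y, x) / (\<alpha> (x, y) * \<alpha> (x \<otimes> y, z))"
  have w0: "w \<noteq> 0" unfolding w_def using nz xyz(1,2) zc by simp
  \<comment> \<open>While \<open>v\<close> equalizes the two p-th powers, \<open>l\<close> rescales
    both lifts so that these powers reach \<open>w\<close>.\<close>
  obtain l where l: "l ^ p = w / a" using complex_nth_root_exists[OF p0] .
  have "l ^ p \<noteq> 0" "v ^ p \<noteq> 0" unfolding l v using w0 ab by simp_all
  then have lv0: "l \<noteq> 0" "v \<noteq> 0" using zero_power[OF p0] by metis+
  let ?u = "(x, l)" and ?v = "(y, l * v)" and ?w = "(z, w)"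
  have mem: "?u \<in> carrier ?E" "?v \<in> carrier ?E" "?w \<in> carrier ?E"
    using xyz zc lv0 w0 by (simp_all add: cocycle_extension_carrier)
  have up: "?u [^]\<^bsub>?E\<^esub> p = ?w"
  proof -
    have "(x, l * 1) [^]\<^bsub>?E\<^esub> p = (x [^] p, l ^ p * a)" unfolding a_def by (rule cocycle_extension_pow_scale)
    moreover have "l ^ p * a = w" unfolding l using ab by simp
    ultimately show ?thesis unfolding pw(1) mult_1_right by (simp only:)
  qed
  have vp: "?v [^]\<^bsub>?E\<^esub> p = ?w"
  proof -
    have "(y, l * v * 1) [^]\<^bsub>?E\<^esub> p = (y [^] p, (l * v) ^ p * b)" unfolding b_def by (rule cocycle_extension_pow_scale)
    moreover have "(l * v) ^ p * b = w" unfolding power_mult_distrib l v using ab by simp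
    ultimately show ?thesis unfolding pw(2) mult_1_right by (simp only:)
  qed
  have rel: "?v \<otimes>\<^bsub>?E\<^esub> ?u = ?u \<otimes>\<^bsub>?E\<^esub> ?v \<otimes>\<^bsub>?E\<^esub> ?w"
    unfolding cocycle_extension_mult using xyz(5) nz xyz(1,2) zc by (simp add: w_def)
  have wu: "?w \<otimes>\<^bsub>?E\<^esub> ?u = ?u \<otimes>\<^bsub>?E\<^esub> ?w"
    using E.nat_pow_Suc2[OF mem(1), of p] by (simp add: up)
  have wv: "?w \<otimes>\<^bsub>?E\<^esub> ?v = ?v \<otimes>\<^bsub>?E\<^esub> ?w"
    using E.nat_pow_Suc2[OF mem(2), of p] by (simp add: vp)
  have tE: "heisenberg_triple ?E ?u ?v ?w"
    by unfold_locales (rule mem rel wu wv)+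
  \<comment> \<open>Moving \<open>?v\<close> past the p-th power of \<open>?u\<close> creates the
    p-th power of \<open>?w\<close>; but that power of \<open>?u\<close> is \<open>?w\<close>, which
    commutes with \<open>?v\<close>. Hence the p-th power of \<open>?w\<close> is trivial.\<close>
  have "?v [^]\<^bsub>?E\<^esub> (1::nat) \<otimes>\<^bsub>?E\<^esub> ?u [^]\<^bsub>?E\<^esub> p = ?u [^]\<^bsub>?E\<^esub> p \<otimes>\<^bsub>?E\<^esub> ?v [^]\<^bsub>?E\<^esub> (1::nat) \<otimes>\<^bsub>?E\<^esub> ?w [^]\<^bsub>?E\<^esub> (1 * p)"
    by (rule heisenberg_triple.pow_y_pow_x[OF tE])
  then have "?w \<otimes>\<^bsub>?E\<^esub> ?v = ?w \<otimes>\<^bsub>?E\<^esub> ?v \<otimes>\<^bsub>?E\<^esub> ?w [^]\<^bsub>?E\<^esub> p"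
    unfolding up E.nat_pow_eone[OF mem(2)] wv by simp
  moreover note E.l_cancel_one'[OF E.m_closed[OF mem(3,2)] E.nat_pow_closed[OF mem(3)]]
  ultimately have wp: "?w [^]\<^bsub>?E\<^esub> p = \<one>\<^bsub>?E\<^esub>" by (rule iffD1[rotated])
  have w1: "?w [^]\<^bsub>?E\<^esub> (1::nat) = ?w" "z [^] (1::nat) = z" using E.nat_pow_eone[OF mem(3)] zc by simp_all
  have tG: "heisenberg_triple G x y z" by (rule heisenberg_triple_center[OF xyz(1-3,5)])
  have ker: "heis_word ?E ?u ?v ?w i j k = \<one>\<^bsub>?E\<^esub>" if "heis_word G x y z i j k = \<one>" for i j k
  proof -
    have d: "p dvd i" "p dvd j" "p dvd 1 * (i div p) + 1 * (j div p) + k"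
      using that heis_word_eq_one_iff[OF xyz, of 1 i j k] unfolding pw w1(2) by blast+
    have "p * (i div p) = i" "p * (j div p) = j" using d by simp_all
    then have "heis_word ?E ?u ?v ?w i j k = ?w [^]\<^bsub>?E\<^esub> (1 * (i div p) + 1 * (j div p) + k)"
      using heis_word_p_multiples[OF E.is_group mem, of 1 "i div p" "j div p" k] up vp w1(1) by simp
    also obtain m where "1 * (i div p) + 1 * (j div p) + k = p * m" using d(3) by (rule dvdE)
    also have "?w [^]\<^bsub>?E\<^esub> (p * m) = \<one>\<^bsub>?E\<^esub>"
      unfolding E.nat_pow_pow[OF mem(3), symmetric] wp by (rule E.nat_pow_one)
    finally show ?thesis .
  qed
  obtain \<phi> where \<phi>: "\<phi> \<in> hom G ?E" "\<And>i j k. \<phi> (heis_word G x y z i j k) = heis_word ?E ?u ?v ?w i j k"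
    using heisenberg_hom_exists[OF tG tE heis_word_exists[OF ord xyz] ker] by blast
  have fst_\<phi>: "fst (\<phi> g) = g" if g: "g \<in> carrier G" for g
  proof -
    obtain i j k where ijk: "g = heis_word G x y z i j k" using heis_word_exists[OF ord xyz g] by blast
    have m: "fst (r \<otimes>\<^bsub>?E\<^esub> s) = fst r \<otimes> fst s" for r s by (simp add: cocycle_extension_def)
    show ?thesis unfolding ijk \<phi>(2) unfolding heis_word_def m fst_cocycle_extension_pow by simp
  qed
  \<comment> \<open>The section consists of multiples of basis vectors that multiply exactly as in
    \<open>G\<close>; the convention in \<open>coboundary\<close> calls for the inverses of these
    scalars.\<close>
  define f where "f g = inverse (snd (\<phi> g))" for g
  have \<phi>_eq: "\<phi> g = (g, inverse (f g))" "f g \<noteq> 0" if "g \<in> carrier G" for g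
  proof -
    have "\<phi> g \<in> carrier ?E" using \<phi>(1) that by (auto simp: hom_def)
    then show "f g \<noteq> 0" unfolding f_def by (auto simp: cocycle_extension_def)
    show "\<phi> g = (g, inverse (f g))" unfolding f_def using fst_\<phi>[OF that] by (simp add: prod_eq_iff)
  qed
  have fp: "f \<in> carrier G \<rightarrow> UNIV - {0}" using \<phi>_eq(2) by auto
  have "\<alpha> = coboundary G f"
  proof (rule cocycle_eqI[OF \<alpha> coboundary_in_cocycles[OF is_group fp]])
    fix g h assume gh: "g \<in> carrier G" "h \<in> carrier G"
    have "(g \<otimes> h, inverse (f (g \<otimes> h))) = (g, inverse (f g)) \<otimes>\<^bsub>?E\<^esub> (h, inverse (f h))"
      using \<phi>_eq(1)[OF gh(1)] \<phi>_eq(1)[OF gh(2)] \<phi>_eq(1)[of "g \<otimes> h"] gh hom_mult[OF \<phi>(1) gh] by simp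
    then have "inverse (f (g \<otimes> h)) = inverse (f g) * inverse (f h) * \<alpha> (g, h)"
      unfolding cocycle_extension_mult by simp
    then show "\<alpha> (g, h) = coboundary G f (g, h)"
      using \<phi>_eq(2)[OF gh(1)] \<phi>_eq(2)[OF gh(2)] \<phi>_eq(2)[of "g \<otimes> h"] gh
      by (simp add: coboundary_apply field_simps)
  qed
  then show ?thesis using fp by (auto simp: coboundaries_def)
qed

end

section \<open>A nontrivial class when the p-th powers of the generators are trivial\<close>

context central_commutator_group
begin

text \<open>The group is \<open>A \<rtimes> \<langle>x\<rangle>\<close> for the abelian subgroup \<open>A\<close> generated by the centre and \<open>u = x\<^sup>-\<^sup>1 y\<close>.
  Twisting the action of \<open>x\<close> on \<open>A \<times> \<complex>\<^sup>\<times>\<close> by a character \<open>\<kappa>\<close> of \<open>A\<close> still has order \<open>p\<close> because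
  \<open>(u x)\<^sup>p = 1\<close>, and gives a central extension in which \<open>x\<close> does not commute with the centre.\<close>

lemma cocycle_not_coboundary_exists:
  assumes ord: "card (carrier G) = p ^ 3"
    and x: "x \<in> carrier G" and y: "y \<in> carrier G" and nc: "x \<otimes> y \<noteq> y \<otimes> x"
    and xp: "x [^] p = \<one>" and yp: "y [^] p = \<one>"
  shows "\<exists>\<alpha>\<in>cocycles G. \<alpha> \<notin> coboundaries G"
proof -
  define u where "u = inv x \<otimes> y"
  have u: "u \<in> carrier G" using x y by (simp add: u_def)
  have xu: "x \<otimes> u = y" unfolding u_def using x y by (simp add: m_assoc[symmetric])
  have ncu: "u \<otimes> x \<noteq> x \<otimes> u"
  proof
    assume e: "u \<otimes> x = x \<otimes> u"
    have "y \<otimes> x = x \<otimes> (u \<otimes> x)" unfolding xu[symmetric] using x u by (simp add: m_assoc)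
    also have "\<dots> = x \<otimes> y" unfolding e xu ..
    finally show False using nc by simp
  qed
  define A where "A = adjoin Z u"
  have gen: "adjoin A x = carrier G" and A: "subgroup A G" and xA: "x \<notin> A"
    using generated_by_noncommuting[OF ord u x ncu] by (simp_all add: A_def)
  have Ac: "a \<in> carrier G" if "a \<in> A" for a using A that by (rule subgroup.mem_carrier)
  have ZA: "z \<in> A" if "z \<in> Z" for z using subset_adjoin[of Z u] Z_carrier that unfolding A_def by blast
  have Acomm: "a \<otimes> b = b \<otimes> a" if ab: "a \<in> A" "b \<in> A" for a b
  proof -
    obtain z i where a: "z \<in> Z" "a = z \<otimes> u [^] (i::nat)" using ab(1) unfolding A_def by (rule adjoinE)
    obtain w j where b: "w \<in> Z" "b = w \<otimes> u [^] (j::nat)" using ab(2) unfolding A_def by (rule adjoinE)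
    have "om a b = 1" unfolding a(2) b(2) om_adjoin[OF Z_carrier[OF a(1)] Z_carrier[OF b(1)] u]
      using a(1) b(1) Z_carrier u by (simp add: om_center)
    then show ?thesis using om_eq_1_iff[OF Ac[OF ab(1)] Ac[OF ab(2)]] by blast
  qed
  obtain \<kappa> where \<kappa>: "character_on G A \<kappa>" "\<And>z. z \<in> Z \<Longrightarrow> \<kappa> z = zchar z"
  proof -
    have "\<exists>\<chi>'. character_on G A \<chi>' \<and> (\<forall>n\<in>Z. \<chi>' n = zchar n)"
    proof (rule character_extend[OF finite_carrier A Z_subgroup _ zchar_character])
      show "Z \<subseteq> A" using ZA by blast
      fix a b assume ab: "a \<in> A" "b \<in> A"
      then have "commutator G a b = \<one>" using Acomm[OF ab] commutator_eq_one_iff Ac by blast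
      then show "commutator G a b \<in> Z \<and> zchar (commutator G a b) = 1"
        using Z_one zchar_eq_1_iff[OF Z_one] by simp
    qed
    then show ?thesis using that by blast
  qed
  define cj where "cj k b = x [^] (k::nat) \<otimes> b \<otimes> inv (x [^] k)" for k b
  have xk: "x [^] (k::nat) \<in> carrier G" for k using x by simp
  have cjA: "cj k b \<in> A" if "b \<in> A" for k b
    unfolding cj_def conj_eq_commutator[OF xk Ac[OF that]]
    using ZA[OF commutator_in_center[OF xk Ac[OF that]]] that by (rule subgroup.m_closed[OF A])
  have cj_mult: "cj k (a \<otimes> b) = cj k a \<otimes> cj k b" if "a \<in> A" "b \<in> A" for k a b
  proof -
    have "cj k a \<otimes> cj k b = x [^] k \<otimes> a \<otimes> (inv (x [^] k) \<otimes> x [^] k) \<otimes> b \<otimes> inv (x [^] k)"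
      unfolding cj_def using xk[of k] Ac[OF that(1)] Ac[OF that(2)]
      by (simp only: m_assoc m_closed inv_closed)
    also have "\<dots> = cj k (a \<otimes> b)" unfolding l_inv[OF xk] cj_def
      using xk[of k] Ac[OF that(1)] Ac[OF that(2)] by (simp add: m_assoc)
    finally show ?thesis by simp
  qed
  have cj_add: "cj (k + j) b = cj k (cj j b)" if "b \<in> A" for k j b
  proof -
    have "cj (k + j) b = x [^] k \<otimes> x [^] j \<otimes> b \<otimes> inv (x [^] k \<otimes> x [^] j)"
      unfolding cj_def nat_pow_mult[OF x] ..
    also have "\<dots> = cj k (cj j b)"
      unfolding cj_def inv_mult_group[OF xk xk] using xk Ac[OF that] by (simp add: m_assoc)
    finally show ?thesis .
  qed
  have cj_center: "cj k z = z" if "z \<in> Z" for k z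
  proof -
    have "cj k z = z \<otimes> x [^] k \<otimes> inv (x [^] k)" unfolding cj_def Z_comm[OF that xk] ..
    then show ?thesis using xk[of k] Z_carrier[OF that] by (simp add: m_assoc)
  qed
  \<comment> \<open>The scalar by which the i-th power of the twisted action of \<open>x\<close>
    multiplies b.\<close>
  define K where "K i b = (\<Prod>k<i. \<kappa> (cj k b))" for i b
  have K_char: "character_on G A (K i)" for i
  proof (rule character_onI)
    show "K i b \<noteq> 0" if "b \<in> A" for b
      unfolding K_def using character_on_nonzero[OF \<kappa>(1) cjA[OF that]] by simp
    show "K i (a \<otimes> b) = K i a * K i b" if "a \<in> A" "b \<in> A" for a b
      unfolding K_def cj_mult[OF that] character_on_mult[OF \<kappa>(1) cjA[OF that(1)] cjA[OF that(2)]]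
      by (rule prod.distrib)
  qed
  have K_add: "K (i + j) c = K j c * K i (cj j c)" if "c \<in> A" for i j c
  proof (induction i)
    case (Suc i)
    have "K (Suc i + j) c = K (i + j) c * \<kappa> (cj (i + j) c)" by (simp add: K_def)
    also have "\<dots> = K j c * (K i (cj j c) * \<kappa> (cj i (cj j c)))" unfolding Suc cj_add[OF that] by simp
    also have "K i (cj j c) * \<kappa> (cj i (cj j c)) = K (Suc i) (cj j c)" by (simp add: K_def)
    finally show ?case .
  qed (simp add: K_def)
  have K_center: "K i z = zchar z ^ i" if "z \<in> Z" for i z
    by (simp add: K_def cj_center[OF that] \<kappa>(2)[OF that])
  have uA: "u \<in> A" unfolding A_def using mem_adjoin[OF Z_subgroup u] .
  \<comment> \<open>The n-th power of \<open>u \<otimes> x\<close>, divided by that of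
    \<open>x\<close>, telescopes into the product of the conjugates \<open>cj k u\<close> with k <
    n; this ties \<open>K\<close> to the order of \<open>u \<otimes> x\<close>.\<close>
  have Ku: "(u \<otimes> x) [^] n \<otimes> inv (x [^] n) \<in> A \<and> K n u = \<kappa> ((u \<otimes> x) [^] n \<otimes> inv (x [^] n))" for n :: nat
  proof (induction n)
    case 0
    then show ?case using subgroup.one_closed[OF A] character_on_one[OF A \<kappa>(1)] by (simp add: K_def)
  next
    case (Suc n)
    let ?q = "(u \<otimes> x) [^] n"
    have q: "?q \<in> carrier G" using u x by simp
    have "(u \<otimes> x) [^] Suc n \<otimes> inv (x [^] Suc n) = ?q \<otimes> (u \<otimes> x) \<otimes> (inv x \<otimes> inv (x [^] n))"
      using x by (simp add: inv_mult_group)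
    also have "\<dots> = ?q \<otimes> (u \<otimes> (x \<otimes> inv x) \<otimes> inv (x [^] n))"
      using x u q xk[of n] by (simp only: m_assoc m_closed inv_closed)
    also have "\<dots> = ?q \<otimes> (inv (x [^] n) \<otimes> x [^] n) \<otimes> (u \<otimes> inv (x [^] n))"
      unfolding r_inv[OF x] l_inv[OF xk] using q u xk[of n] by (simp add: m_assoc)
    also have "\<dots> = (?q \<otimes> inv (x [^] n)) \<otimes> cj n u"
      unfolding cj_def using q u xk[of n] by (simp only: m_assoc m_closed inv_closed)
    finally have e: "(u \<otimes> x) [^] Suc n \<otimes> inv (x [^] Suc n) = (?q \<otimes> inv (x [^] n)) \<otimes> cj n u" .
    have m: "?q \<otimes> inv (x [^] n) \<in> A" and v: "K n u = \<kappa> (?q \<otimes> inv (x [^] n))" using Suc by simp_all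
    have "K (Suc n) u = K n u * \<kappa> (cj n u)" by (simp add: K_def)
    then show ?case
      unfolding e v character_on_mult[OF \<kappa>(1) m cjA[OF uA]] using subgroup.m_closed[OF A m cjA[OF uA]] by simp
  qed
  \<comment> \<open>The element \<open>u \<otimes> x\<close> is a conjugate of \<open>y\<close>, so
    its p-th power is trivial as well.\<close>
  have conj_pow: "(u \<otimes> x) [^] n = inv x \<otimes> y [^] n \<otimes> x" for n :: nat
  proof (induction n)
    case 0 then show ?case using x by simp
  next
    case (Suc n)
    have yn: "y [^] n \<in> carrier G" using y by simp
    have "(u \<otimes> x) [^] Suc n = (inv x \<otimes> y [^] n \<otimes> x) \<otimes> (u \<otimes> x)" unfolding nat_pow_Suc Suc ..
    also have "\<dots> = inv x \<otimes> y [^] n \<otimes> (x \<otimes> inv x) \<otimes> y \<otimes> x"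
      unfolding u_def using x y yn by (simp only: m_assoc m_closed inv_closed)
    finally show ?case unfolding r_inv[OF x] using x y yn by (simp add: m_assoc)
  qed
  have Kpu: "K p u = 1"
  proof -
    have "(u \<otimes> x) [^] p \<otimes> inv (x [^] p) = \<one>" unfolding conj_pow yp xp using x by simp
    then show ?thesis using Ku[of p] character_on_one[OF A \<kappa>(1)] by simp
  qed
  have Kp: "K p b = 1" if "b \<in> A" for b
  proof -
    obtain z i where b: "z \<in> Z" "b = z \<otimes> u [^] (i::nat)" using \<open>b \<in> A\<close> unfolding A_def by (rule adjoinE)
    have "K p b = K p z * K p (u [^] i)"
      unfolding b(2) by (rule character_on_mult[OF K_char ZA[OF b(1)] subgroup_nat_pow_closed[OF A uA]])
    then show ?thesis
      using K_center[OF b(1)] zchar_pow_p[OF b(1)] character_on_nat_pow[OF A K_char uA] Kpu by simp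
  qed
  have K_period: "K (i + p * m) b = K i b" if b: "b \<in> A" for i m b
  proof (induction m)
    case (Suc m)
    have cjp: "cj p b = b" unfolding cj_def xp using Ac[OF b] by simp
    have "K (i + p * Suc m) b = K ((i + p * m) + p) b" by (simp add: algebra_simps)
    also have "\<dots> = K (i + p * m) b" unfolding K_add[OF b] cjp Kp[OF b] by simp
    finally show ?case using Suc by simp
  qed simp
  have uniq_le: "a = a' \<and> K i b = K j b"
    if "a \<in> A" "a' \<in> A" "a \<otimes> x [^] i = a' \<otimes> x [^] j" "i \<le> j" "b \<in> A" for a a' b and i j :: nat
  proof -
    obtain d where j: "j = d + i" using \<open>i \<le> j\<close> by (metis add.commute le_iff_add)
    have "a \<otimes> x [^] i = a' \<otimes> x [^] d \<otimes> x [^] i"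
      using that(3) Ac[OF that(2)] xk unfolding j nat_pow_mult[OF x, symmetric] by (simp add: m_assoc)
    then have a: "a = a' \<otimes> x [^] d" using Ac[OF that(1)] Ac[OF that(2)] xk by simp
    then have "inv a' \<otimes> a = x [^] d" using Ac[OF that(2)] xk by (simp add: m_assoc[symmetric])
    moreover have "inv a' \<otimes> a \<in> A"
      by (rule subgroup.m_closed[OF A subgroup.m_inv_closed[OF A that(2)] that(1)])
    ultimately have "x [^] d \<in> A" by simp
    moreover have "x [^] p \<in> A" unfolding xp by (rule subgroup.one_closed[OF A])
    ultimately have "p dvd d" by (intro subgroup_prime_pow[OF A prime_p x xA])
    then obtain m where m: "d = p * m" by (rule dvdE)
    have "x [^] d = \<one>" unfolding m nat_pow_pow[OF x, symmetric] xp by simp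
    then have "a = a'" using a Ac[OF that(2)] by simp
    moreover have "K j b = K i b" unfolding j m add.commute[of "p * m"] by (rule K_period[OF that(5)])
    ultimately show ?thesis by simp
  qed
  have uniq: "a = a' \<and> K i b = K j b"
    if "a \<in> A" "a' \<in> A" "a \<otimes> x [^] i = a' \<otimes> x [^] j" "b \<in> A" for a a' b and i j :: nat
  proof (cases "i \<le> j")
    case True
    then show ?thesis using uniq_le[OF that(1-3) _ that(4)] by blast
  next
    case False
    then show ?thesis using uniq_le[OF that(2,1) that(3)[symmetric] _ that(4)] by simp
  qed
  have dec: "\<exists>a\<in>A. \<exists>i::nat. g = a \<otimes> x [^] i" if "g \<in> carrier G" for g
  proof -
    have "g \<in> adjoin A x" using that gen by simp
    then show ?thesis by (rule adjoinE) blast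
  qed
  define ax where "ax g = (SOME a. a \<in> A \<and> (\<exists>i::nat. g = a \<otimes> x [^] i))" for g
  define ix where "ix g = (SOME i::nat. g = ax g \<otimes> x [^] i)" for g
  have ax: "ax g \<in> A" "g = ax g \<otimes> x [^] ix g" if "g \<in> carrier G" for g
  proof -
    have *: "ax g \<in> A \<and> (\<exists>i::nat. g = ax g \<otimes> x [^] i)"
      unfolding ax_def by (rule someI_ex) (use dec[OF that] in blast)
    then show "ax g \<in> A" by blast
    show "g = ax g \<otimes> x [^] ix g" unfolding ix_def using * by (intro someI_ex[where P = "\<lambda>i. g = ax g \<otimes> x [^] i"]) blast
  qed
  \<comment> \<open>If g and h decompose as a x^i and b x^j with a and b in \<open>A\<close>, the
    value is \<open>K i b\<close>; by \<open>uniq\<close> the choices in \<open>ax\<close> and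
    \<open>ix\<close> do not matter.\<close>
  define \<alpha> where "\<alpha> = (\<lambda>(g, h) \<in> carrier G \<times> carrier G. K (ix g) (ax h))"
  have val: "K (ix (a \<otimes> x [^] i)) (ax (b \<otimes> x [^] j)) = K i b" if "a \<in> A" "b \<in> A" for a b and i j :: nat
  proof -
    have g: "a \<otimes> x [^] i \<in> carrier G" and h: "b \<otimes> x [^] j \<in> carrier G" using Ac[OF that(1)] Ac[OF that(2)] xk by simp_all
    have "ax (b \<otimes> x [^] j) = b" using uniq[OF ax(1)[OF h] that(2) ax(2)[OF h, symmetric] that(2)] by blast
    moreover have "K (ix (a \<otimes> x [^] i)) b = K i b" using uniq[OF ax(1)[OF g] that(1) ax(2)[OF g, symmetric] that(2)] by blast
    ultimately show ?thesis by simp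
  qed
  have prod: "(a \<otimes> x [^] i) \<otimes> (b \<otimes> x [^] j) = (a \<otimes> cj i b) \<otimes> x [^] (i + j)" if "a \<in> A" "b \<in> A" for a b and i j :: nat
  proof -
    have "(a \<otimes> cj i b) \<otimes> x [^] (i + j) = a \<otimes> x [^] i \<otimes> b \<otimes> (inv (x [^] i) \<otimes> x [^] i) \<otimes> x [^] j"
      unfolding cj_def nat_pow_mult[OF x, symmetric] using Ac[OF that(1)] Ac[OF that(2)] xk
      by (simp only: m_assoc m_closed inv_closed)
    also have "\<dots> = (a \<otimes> x [^] i) \<otimes> (b \<otimes> x [^] j)"
      unfolding l_inv[OF xk] using Ac[OF that(1)] Ac[OF that(2)] xk by (simp add: m_assoc)
    finally show ?thesis by simp
  qed
  have "\<alpha> \<in> cocycles G"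
    unfolding \<alpha>_def
  proof (rule cocyclesI)
    fix g h assume "g \<in> carrier G" "h \<in> carrier G"
    then show "K (ix g) (ax h) \<noteq> 0" using character_on_nonzero[OF K_char ax(1)] by blast
  next
    fix g h k assume g: "g \<in> carrier G" and h: "h \<in> carrier G" and k: "k \<in> carrier G"
    obtain a i where a: "a \<in> A" "g = a \<otimes> x [^] (i::nat)" using dec[OF g] by blast
    obtain b j where b: "b \<in> A" "h = b \<otimes> x [^] (j::nat)" using dec[OF h] by blast
    obtain c l where c: "c \<in> A" "k = c \<otimes> x [^] (l::nat)" using dec[OF k] by blast
    have ab: "a \<otimes> cj i b \<in> A" and bc: "b \<otimes> cj j c \<in> A"
      using subgroup.m_closed[OF A a(1) cjA[OF b(1)]] subgroup.m_closed[OF A b(1) cjA[OF c(1)]] .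
    have "K i b * K (i + j) c = K i (b \<otimes> cj j c) * K j c"
      unfolding K_add[OF c(1)] character_on_mult[OF K_char b(1) cjA[OF c(1)]] by simp
    then show "K (ix g) (ax h) * K (ix (g \<otimes> h)) (ax k) = K (ix g) (ax (h \<otimes> k)) * K (ix h) (ax k)"
      unfolding a(2) b(2) c(2) prod[OF a(1) b(1)] prod[OF b(1) c(1)]
        val[OF a(1) b(1)] val[OF ab c(1)] val[OF a(1) bc] val[OF b(1) c(1)] .
  qed unfold_locales
  moreover have "\<alpha> \<notin> coboundaries G"
  proof
    assume "\<alpha> \<in> coboundaries G"
    then obtain f where f: "\<alpha> = coboundary G f" by (auto simp: coboundaries_def)
    obtain z where z: "z \<in> Z" "z \<noteq> \<one>" by (rule Z_ne_trivial)
    have zc: "z \<in> carrier G" using Z_carrier[OF z(1)] .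
    \<comment> \<open>A coboundary is symmetric on commuting pairs, whereas this cocycle takes the
      value \<open>zchar z\<close> at (x, z) and 1 at (z, x).\<close>
    have "\<alpha> (x, z) = \<alpha> (z, x)"
      unfolding f coboundary_apply[OF x zc] coboundary_apply[OF zc x] Z_comm[OF z(1) x] by simp
    then have "K (ix x) (ax z) = K (ix z) (ax x)" using x zc by (simp add: \<alpha>_def)
    moreover have "x = \<one> \<otimes> x [^] (1::nat)" "z = z \<otimes> x [^] (0::nat)" using x zc by simp_all
    moreover note val[OF subgroup.one_closed[OF A] ZA[OF z(1)], of 1 0]
      val[OF ZA[OF z(1)] subgroup.one_closed[OF A], of 0 1]
    ultimately have "K 1 z = K 0 \<one>" by metis
    then have "zchar z = 1" using K_center[OF z(1), of 1] by (simp add: K_def)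
    then show False using zchar_faithful[OF z(1)] z(2) by blast
  qed
  ultimately show ?thesis by blast
qed

end

section \<open>Properties preserved by the equivalence\<close>

lemma second_cohomology_one: "\<one>\<^bsub>second_cohomology G\<^esub> = coboundaries G"
  by (simp add: second_cohomology_def FactGroup_def)

lemma second_cohomology_trivial_iff:
  assumes "group G"
  shows "carrier (second_cohomology G) = {coboundaries G} \<longleftrightarrow> cocycles G \<subseteq> coboundaries G"
proof -
  interpret ZG: comm_group "cocycle_group G" by (rule cocycle_group_comm_group[OF assms])
  interpret B: normal "coboundaries G" "cocycle_group G" by (rule coboundaries_normal[OF assms])
  have cg: "carrier (cocycle_group G) = cocycles G" by (simp add: cocycle_group_def)
  have car: "carrier (second_cohomology G) = (\<lambda>\<alpha>. coboundaries G #>\<^bsub>cocycle_group G\<^esub> \<alpha>) ` cocycles G"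
    by (auto simp: second_cohomology_def FactGroup_def RCOSETS_def cg)
  have iff: "coboundaries G #>\<^bsub>cocycle_group G\<^esub> \<alpha> = coboundaries G \<longleftrightarrow> \<alpha> \<in> coboundaries G"
    if "\<alpha> \<in> cocycles G" for \<alpha>
    using ZG.coset_join1[OF _ _ B.is_subgroup, of \<alpha>] ZG.coset_join2[OF _ B.is_subgroup, of \<alpha>] that cg by blast
  have "\<one>\<^bsub>cocycle_group G\<^esub> \<in> cocycles G" using ZG.one_closed cg by simp
  then show ?thesis unfolding car using iff by (auto simp: image_subset_iff set_eq_iff) blast+
qed

lemma iso_trivial_iff:
  assumes "group A" "group B" "\<psi> \<in> iso A B"
  shows "carrier A = {\<one>\<^bsub>A\<^esub>} \<longleftrightarrow> carrier B = {\<one>\<^bsub>B\<^esub>}"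
proof -
  interpret group_hom A B \<psi> using assms by (simp add: group_hom_def group_hom_axioms_def iso_def)
  have bij: "bij_betw \<psi> (carrier A) (carrier B)" using assms(3) by (simp add: iso_def)
  have "card (carrier A) = card (carrier B)" using bij by (rule bij_betw_same_card)
  moreover have "carrier A = {\<one>\<^bsub>A\<^esub>} \<longleftrightarrow> card (carrier A) = 1"
    using G.one_closed by (metis card_1_singleton_iff One_nat_def singletonD)
  moreover have "carrier B = {\<one>\<^bsub>B\<^esub>} \<longleftrightarrow> card (carrier B) = 1"
    using H.one_closed by (metis card_1_singleton_iff One_nat_def singletonD)
  ultimately show ?thesis by simp
qed

lemma twisted_equiv_cocycles_trivial_iff:
  assumes "group K" "group G" "twisted_equiv K G"
  shows "cocycles K \<subseteq> coboundaries K \<longleftrightarrow> cocycles G \<subseteq> coboundaries G"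
proof -
  obtain \<psi> where "\<psi> \<in> iso (second_cohomology K) (second_cohomology G)"
    using assms(3) by (auto simp: twisted_equiv_def)
  moreover have "group (second_cohomology K)" "group (second_cohomology G)"
    using second_cohomology_comm_group[OF assms(1)] second_cohomology_comm_group[OF assms(2)]
    by (simp_all add: comm_group.axioms)
  ultimately show ?thesis
    using iso_trivial_iff[of "second_cohomology K" "second_cohomology G" \<psi>] second_cohomology_one[of K] second_cohomology_one[of G]
      second_cohomology_trivial_iff[OF assms(1)] second_cohomology_trivial_iff[OF assms(2)] by simp
qed

text \<open>The trivial class goes to the trivial class, so the ordinary group algebras are
  isomorphic; a group is abelian exactly when its group algebra is commutative.\<close>

lemma twisted_equiv_abelian:
  fixes K (structure) and G :: "('b, 'n) monoid_scheme"
  assumes K: "group K" and G: "group G" "finite (carrier G)" and eq: "twisted_equiv K G"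
    and ab: "\<And>g h. g \<in> carrier K \<Longrightarrow> h \<in> carrier K \<Longrightarrow> g \<otimes> h = h \<otimes> g"
    and gh: "g \<in> carrier G" "h \<in> carrier G"
  shows "g \<otimes>\<^bsub>G\<^esub> h = h \<otimes>\<^bsub>G\<^esub> g"
proof -
  let ?\<alpha> = "coboundary K (\<lambda>_. 1)" and ?\<beta> = "coboundary G (\<lambda>_. 1)"
  let ?A = "twisted_group_algebra K ?\<alpha>" and ?B = "twisted_group_algebra G ?\<beta>"
  obtain \<psi> where \<psi>: "\<psi> \<in> iso (second_cohomology K) (second_cohomology G)"
    "\<And>C \<alpha> \<beta>. C \<in> carrier (second_cohomology K) \<Longrightarrow> \<alpha> \<in> C \<Longrightarrow> \<beta> \<in> \<psi> C \<Longrightarrow>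
      complex_algebra_iso (twisted_group_algebra K \<alpha>) (twisted_group_algebra G \<beta>)"
    using eq unfolding twisted_equiv_def by blast
  interpret HK: comm_group "second_cohomology K" by (rule second_cohomology_comm_group[OF K])
  interpret HG: comm_group "second_cohomology G" by (rule second_cohomology_comm_group[OF G(1)])
  interpret f: group_hom "second_cohomology K" "second_cohomology G" \<psi>
    using \<psi>(1) by unfold_locales (simp add: iso_def)
  have "\<psi> (coboundaries K) = coboundaries G" using f.hom_one by (simp add: second_cohomology_one)
  moreover have "coboundaries K \<in> carrier (second_cohomology K)"
    using HK.one_closed by (simp add: second_cohomology_one)
  moreover have "?\<alpha> \<in> coboundaries K" "?\<beta> \<in> coboundaries G" by (auto simp: coboundaries_def)
  ultimately have "complex_algebra_iso ?A ?B" using \<psi>(2) by metis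
  then obtain \<phi> where \<phi>: "\<phi> \<in> ring_iso ?A ?B" unfolding complex_algebra_iso_def by blast
  have commA: "s \<otimes>\<^bsub>?A\<^esub> t = t \<otimes>\<^bsub>?A\<^esub> s" for s t
  proof
    fix k
    have "(\<Sum>(a, b) | a \<in> carrier K \<and> b \<in> carrier K \<and> a \<otimes> b = k. s a * t b * ?\<alpha> (a, b)) =
      (\<Sum>(a, b) | a \<in> carrier K \<and> b \<in> carrier K \<and> a \<otimes> b = k. t a * s b * ?\<alpha> (a, b))"
      by (rule sum.reindex_bij_witness[where i = prod.swap and j = prod.swap])
         (auto simp: coboundary_apply ab)
    then show "(s \<otimes>\<^bsub>?A\<^esub> t) k = (t \<otimes>\<^bsub>?A\<^esub> s) k" by (simp add: twisted_group_algebra_def)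
  qed
  have commB: "s \<otimes>\<^bsub>?B\<^esub> t = t \<otimes>\<^bsub>?B\<^esub> s" if st: "s \<in> carrier ?B" "t \<in> carrier ?B" for s t
  proof -
    have im: "\<phi> ` carrier ?A = carrier ?B" using ring_iso_memE(5)[OF \<phi>] by (simp add: bij_betw_def)
    obtain s' t' where s': "s' \<in> carrier ?A" "s = \<phi> s'" and t': "t' \<in> carrier ?A" "t = \<phi> t'"
      using st unfolding im[symmetric] by blast
    show ?thesis unfolding s'(2) t'(2) ring_iso_memE(2)[OF \<phi> s'(1) t'(1), symmetric]
      ring_iso_memE(2)[OF \<phi> t'(1) s'(1), symmetric] commA[of s' t'] ..
  qed
  have bc: "basis_vector k \<in> carrier ?B" if "k \<in> carrier G" for k
    using that by (auto simp: twisted_group_algebra_def basis_vector_def)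
  have "?\<beta> (g, h) \<odot>\<^bsub>?B\<^esub> basis_vector (g \<otimes>\<^bsub>G\<^esub> h) = ?\<beta> (h, g) \<odot>\<^bsub>?B\<^esub> basis_vector (h \<otimes>\<^bsub>G\<^esub> g)"
    using basis_vector_mult[OF G gh, of ?\<beta>] basis_vector_mult[OF G gh(2,1), of ?\<beta>] commB[OF bc[OF gh(1)] bc[OF gh(2)]] by simp
  then have "basis_vector (g \<otimes>\<^bsub>G\<^esub> h) (g \<otimes>\<^bsub>G\<^esub> h) = basis_vector (h \<otimes>\<^bsub>G\<^esub> g) (g \<otimes>\<^bsub>G\<^esub> h)"
    using gh by (simp add: twisted_group_algebra_def coboundary_apply fun_eq_iff)
  then show ?thesis by (simp add: basis_vector_def split: if_splits)
qed

text \<open>Ties \<open>e\<close> to the vanishing of the Schur multiplier, which makes the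
  generators of equivalent groups of the same type.\<close>

lemma central_commutator_group_order_p_cubed_cases:
  fixes G (structure)
  assumes G: "central_commutator_group G p" "card (carrier G) = p ^ 3"
    and ab: "a \<in> carrier G" "b \<in> carrier G" "a \<otimes> b \<noteq> b \<otimes> a"
  obtains x y z and e :: nat where "x \<in> carrier G" "y \<in> carrier G" "z \<in> group_center G" "z \<noteq> \<one>"
    "y \<otimes> x = x \<otimes> y \<otimes> z" "x [^] p = z [^] e" "y [^] p = z [^] e"
    "e = (if cocycles G \<subseteq> coboundaries G then 1 else 0)"
proof -
  interpret central_commutator_group G p by fact
  obtain x y z and e :: nat where g: "x \<in> carrier G" "y \<in> carrier G" "z \<in> group_center G" "z \<noteq> \<one>"
    "y \<otimes> x = x \<otimes> y \<otimes> z" "x [^] p = z [^] e" "y [^] p = z [^] e" "e = 0 \<or> e = 1"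
    by (rule standard_generators[OF ab])
  have zc: "z \<in> carrier G" using Z_carrier[OF g(3)] .
  have nc: "x \<otimes> y \<noteq> y \<otimes> x" by (rule noncommuting_of_relation[OF g(1-5)])
  have "e = (if cocycles G \<subseteq> coboundaries G then 1 else 0)"
  proof (cases "e = 0")
    case True
    then have "x [^] p = \<one>" "y [^] p = \<one>" using g(6,7) by simp_all
    then show ?thesis using cocycle_not_coboundary_exists[OF G(2) g(1,2) nc] True by auto
  next
    case False
    then have e: "e = 1" using g(8) by simp
    then have "x [^] p = z" "y [^] p = z" using g(6,7) zc by simp_all
    then show ?thesis using cocycles_eq_coboundaries[OF G(2) g(1-5)] e by auto
  qed
  then show ?thesis using that[OF g(1-7)] by blast
qed

theorem twisted_equiv_order_p_cubed_isomorphic: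
  assumes p: "Factorial_Ring.prime p" and G: "extra_special p G" "Coset.order G = p ^ 3"
    and K: "group K" "Coset.order K = p ^ 3" and eq: "twisted_equiv K G"
  shows "K \<cong> G"
proof -
  interpret G: central_commutator_group G p by (rule extra_special_central_commutator_group[OF p G(1)])
  have cG: "card (carrier G) = p ^ 3" and cK: "card (carrier K) = p ^ 3"
    using G(2) K(2) by (simp_all add: Coset.order_def)
  have "card G.Z \<noteq> card (carrier G)"
    using G.card_center cG G.p_gt_1 power_inject_exp[of p 1 3] by simp
  then have "\<not> carrier G \<subseteq> G.Z" using G.Z_carrier by (metis subsetI subset_antisym)
  then obtain a b where ab: "a \<in> carrier G" "b \<in> carrier G" "a \<otimes>\<^bsub>G\<^esub> b \<noteq> b \<otimes>\<^bsub>G\<^esub> a"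
    unfolding group_center_def by blast
  then obtain c d where cd: "c \<in> carrier K" "d \<in> carrier K" "c \<otimes>\<^bsub>K\<^esub> d \<noteq> d \<otimes>\<^bsub>K\<^esub> c"
    using twisted_equiv_abelian[OF K(1) G.is_group G.finite_carrier eq] by blast
  have KC: "central_commutator_group K p" by (rule nonabelian_order_p_cubed[OF K(1) p K(2) cd])
  have GC: "central_commutator_group G p" by unfold_locales
  have same: "cocycles K \<subseteq> coboundaries K \<longleftrightarrow> cocycles G \<subseteq> coboundaries G"
    by (rule twisted_equiv_cocycles_trivial_iff[OF K(1) G.is_group eq])
  obtain x y z e where g: "x \<in> carrier G" "y \<in> carrier G" "z \<in> group_center G" "z \<noteq> \<one>\<^bsub>G\<^esub>"
    "y \<otimes>\<^bsub>G\<^esub> x = x \<otimes>\<^bsub>G\<^esub> y \<otimes>\<^bsub>G\<^esub> z" "x [^]\<^bsub>G\<^esub> p = z [^]\<^bsub>G\<^esub> (e::nat)" "y [^]\<^bsub>G\<^esub> p = z [^]\<^bsub>G\<^esub> e"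
    "e = (if cocycles G \<subseteq> coboundaries G then 1 else 0)"
    by (rule central_commutator_group_order_p_cubed_cases[OF GC cG ab])
  obtain u v w e' where k: "u \<in> carrier K" "v \<in> carrier K" "w \<in> group_center K" "w \<noteq> \<one>\<^bsub>K\<^esub>"
    "v \<otimes>\<^bsub>K\<^esub> u = u \<otimes>\<^bsub>K\<^esub> v \<otimes>\<^bsub>K\<^esub> w" "u [^]\<^bsub>K\<^esub> p = w [^]\<^bsub>K\<^esub> (e'::nat)" "v [^]\<^bsub>K\<^esub> p = w [^]\<^bsub>K\<^esub> e'"
    "e' = (if cocycles K \<subseteq> coboundaries K then 1 else 0)"
    by (rule central_commutator_group_order_p_cubed_cases[OF KC cK cd])
  have "e' = e" unfolding g(8) k(8) same ..
  then show ?thesis using same_type_isomorphic[OF KC cK k(1-5) _ _ GC cG g(1-7)] k(6,7) by blast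
qed

theorem theorem1p7:
  fixes p n :: nat
    and G :: "('a, 'm) monoid_scheme"
    and H :: "('b, 'n) monoid_scheme"
  assumes "Factorial_Ring.prime p" and "n \<ge> 1"
    and "extra_special p G" and "Coset.order G = p ^ (2 * n + 1)"
    and "extra_special p H" and "Coset.order H = p ^ (2 * n + 1)"
  shows "(n = 1 \<longrightarrow>
            (\<forall>K :: ('c, 'k) monoid_scheme.
               group K \<and> Coset.order K = p ^ 3 \<and> twisted_equiv K G \<longrightarrow> K \<cong> G)) \<and>
         (n > 1 \<longrightarrow> twisted_equiv G H)"
proof (intro conjI impI allI)
  fix K :: "('c, 'k) monoid_scheme"
  assume "n = 1" and K: "group K \<and> Coset.order K = p ^ 3 \<and> twisted_equiv K G"
  then have "Coset.order G = p ^ 3" using assms(4) by (simp add: numeral_3_eq_3)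
  then show "K \<cong> G"
    using twisted_equiv_order_p_cubed_isomorphic[OF assms(1,3)] K by blast
next
  assume "n > 1"
  then show "twisted_equiv G H" by (rule twisted_equiv_extra_special[OF assms(1) _ assms(3-6)])
qed

end
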